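(* For any $\epsilon>0$, there exists a polynomial-time algorithm that achieves a $(0.316-\epsilon)$-approximation for the problem of sequential selection with expirations (SSE) with deadlines, relative to the online optimum. Moreover, if the evaluation times are independently and identically distributed, there exists a polynomial-time algorithm that achieves a $0.5$-approximation. Here an algorithm achieves an $\alpha$-approximation if on every instance it implements an online policy whose expected total value is at least $\alpha$ times the maximum expected total value of an online policy for that instance.
   Context: SSE problem with deadlines. An instance consists of $n$ options. Option $j\in[n]=\{1,\dots,n\}$ has a deterministic value $v_j>0$, a deterministic deadline $D_j\in\mathbb N$, a random evaluation time $S_j$ and a random expiration time $E_j$, both taking positive integer values; all these $2n$ random variables are mutually independent, with known distributions and initially unknown realizations. Write $\overline F_{S_j}(t)=\Pr(S_j>t)$ and $p_j(t)=\Pr(E_j>t)$. Standing assumptions: there is $T\in\mathbb N$ with $\overline F_{S_j}(T)=0$ for all $j$, and $p_j(t)>0$ for all $t\ge 1$ and all $j$. Time is discrete, $t=1,2,\dots$. Option $j$ is unexpired at time $t$ iff $E_j>t$; all options are available at time $1$ (so $p_j(1)=1$). A decision-maker (DM) evaluates one option at a time. The DM is free at time 1. If the DM is free at time $t$, it may select one option $j$ that is unexpired at time $t$ and has not been selected before; it is then busy for $S_j$ time units (free again at time $t+S_j$), and it obtains value $v_j$ if $t+S_j\le D_j$ and value $0$ otherwise. A selected option cannot be preempted and cannot expire. Meanwhile other options may expire. If the DM selects nothing at $t$, it is still free at $t+1$. An online policy decides, when the DM is free, which available option (if any) to select, using only the information revealed so far (past decisions, realized evaluation times of completed options, which options have expired),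 and possibly internal randomness. Its value is the expected total value obtained. Polynomial time means that the running time is polynomial in $n$, $T$, $D_{\max}=\max_j D_j$ and (for the first part) $1/\epsilon$, with the distributions given explicitly. *)

theory Defs
  imports "HOL-Probability.Probability"
begin

section \<open>Instances\<close>

text \<open>Options are numbered \<open>1, \<dots>, n\<close>. The field \<open>horizon\<close> is the bound \<open>T\<close> on the evaluation
  times. Only the values of the fields on \<open>{1..n}\<close> are relevant.\<close>

record sse =
  num_opts :: nat
  horizon :: nat
  reward :: "nat \<Rightarrow> real"
  deadline :: "nat \<Rightarrow> nat"
  eval_dist :: "nat \<Rightarrow> nat pmf"
  exp_dist :: "nat \<Rightarrow> nat pmf"

definition opts :: "sse \<Rightarrow> nat set" where
  "opts I = {1..num_opts I}"

definition tail_prob :: "nat pmf \<Rightarrow> nat \<Rightarrow> real" where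
  "tail_prob X t = measure_pmf.prob X {x. x > t}"

definition sse_instance :: "sse \<Rightarrow> bool" where
  "sse_instance I \<longleftrightarrow> (\<forall>j \<in> opts I.
     reward I j > 0 \<and>
     set_pmf (eval_dist I j) \<subseteq> {1..} \<and>
     set_pmf (exp_dist I j) \<subseteq> {1..} \<and>
     tail_prob (eval_dist I j) (horizon I) = 0 \<and>
     (\<forall>t\<ge>1. tail_prob (exp_dist I j) t > 0) \<and>
     tail_prob (exp_dist I j) 1 = 1)"

definition iid_eval_times :: "sse \<Rightarrow> bool" where
  "iid_eval_times I \<longleftrightarrow> (\<forall>i \<in> opts I. \<forall>j \<in> opts I. eval_dist I i = eval_dist I j)"

text \<open>The \<open>insert 0\<close> only serves the instance without options.\<close>

definition max_deadline :: "sse \<Rightarrow> nat" where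
  "max_deadline I = Max (insert 0 (deadline I ` opts I))"


section \<open>The decision process\<close>

text \<open>A decision rule with memory \<open>'m\<close> is called at every time \<open>t\<close> at which the decision-maker is
  free. It sees its memory, the time \<open>t\<close> and the set \<open>A\<close> of available options (not yet selected and
  unexpired at \<open>t\<close>), and returns a random decision, \<open>None\<close> meaning that nothing is selected,
  together with its new memory. The realized evaluation time of a selected option is revealed as the
  difference between the next time at which the rule is called and the current one.\<close>

type_synonym 'm rule = "'m \<Rightarrow> nat \<Rightarrow> nat set \<Rightarrow> (nat option \<times> 'm) pmf"

text \<open>Here \<open>s\<close> and \<open>e\<close> are the realized evaluation and expiration times, \<open>k\<close> is the number of
  decision epochs still to be played, \<open>t\<close> is the current time and \<open>U\<close> is the set of options not yet
  selected. The result consists of the total value obtained and the final memory.\<close>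

primrec play :: "sse \<Rightarrow> 'm rule \<Rightarrow> (nat \<Rightarrow> nat) \<Rightarrow> (nat \<Rightarrow> nat) \<Rightarrow>
    nat \<Rightarrow> nat \<Rightarrow> nat set \<Rightarrow> 'm \<Rightarrow> (real \<times> 'm) pmf" where
  "play I act s e 0 t U m = return_pmf (0, m)"
| "play I act s e (Suc k) t U m =
     bind_pmf (act m t {j \<in> U. e j > t}) (\<lambda>(d, m').
       case d of
         None \<Rightarrow> play I act s e k (t + 1) U m'
       | Some j \<Rightarrow>
           map_pmf (\<lambda>(w, m''). ((if t + s j \<le> deadline I j then reward I j else 0) + w, m''))
             (play I act s e k (t + s j) (U - {j}) m'))"

text \<open>All evaluation and expiration times are independent. Since evaluation times are positive, the
  \<open>k\<close>-th decision epoch does not happen before time \<open>k\<close>, so that no value is obtained in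
  the epochs after the first \<open>max_deadline I\<close> ones; they are left out (see the lemma
  \<open>play_extra_epochs\<close> below).\<close>

definition outcome :: "sse \<Rightarrow> 'm rule \<Rightarrow> 'm \<Rightarrow> (real \<times> 'm) pmf" where
  "outcome I act m =
     bind_pmf (Pi_pmf (opts I) 0 (eval_dist I)) (\<lambda>s.
     bind_pmf (Pi_pmf (opts I) 0 (exp_dist I)) (\<lambda>e.
       play I act s e (max_deadline I) 1 (opts I) m))"

definition expected_value :: "sse \<Rightarrow> 'm rule \<Rightarrow> 'm \<Rightarrow> real" where
  "expected_value I act m = measure_pmf.expectation (outcome I act m) fst"

text \<open>Online policies remember everything: a history lists, for all earlier decision epochs, the
  time, the available options and the decision.\<close>

type_synonym history = "(nat \<times> nat set \<times> nat option) list"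
type_synonym policy = "history \<Rightarrow> nat \<Rightarrow> nat set \<Rightarrow> nat option pmf"

definition online_policy :: "policy \<Rightarrow> bool" where
  "online_policy \<pi> \<longleftrightarrow> (\<forall>h t A. set_pmf (\<pi> h t A) \<subseteq> insert None (Some ` A))"

definition rule_of_policy :: "policy \<Rightarrow> history rule" where
  "rule_of_policy \<pi> h t A = map_pmf (\<lambda>d. (d, h @ [(t, A, d)])) (\<pi> h t A)"

definition policy_value :: "sse \<Rightarrow> policy \<Rightarrow> real" where
  "policy_value I \<pi> = expected_value I (rule_of_policy \<pi>) []"

definition online_opt :: "sse \<Rightarrow> real" where
  "online_opt I = (SUP \<pi> \<in> {\<pi>. online_policy \<pi>}. policy_value I \<pi>)"


section \<open>Randomized real RAM\<close>

text \<open>The parameters of an instance are real numbers, and running times are measured in the number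
  of options, \<open>T\<close>, the deadlines and \<open>1 / \<epsilon>\<close>, but not in the length of an encoding of these reals.
  Hence the model of computation is the real RAM with unit-cost exact arithmetic. It is given as a
  while language over cells that hold natural or real numbers; a cell is addressed by an array name
  and a list of indices. Program constants are natural numbers, there is no rounding of reals to
  integers, and natural numbers (used for indices and counters) have no multiplication.
  Expressions take one step to evaluate, their size being a constant of the program. Randomness
  comes from Bernoulli trials.\<close>

datatype nexp =
    NConst nat
  | NCell string "nexp list"
  | NAdd nexp nexp
  | NSub nexp nexp

datatype rexp =
    RConst nat
  | RCell string "nexp list"
  | ROfNat nexp
  | RAdd rexp rexp
  | RSub rexp rexp
  | RMul rexp rexp
  | RDiv rexp rexp

datatype bexp =
    NLess nexp nexp
  | RLess rexp rexp
  | BNot bexp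
  | BAnd bexp bexp

datatype prog =
    Skip
  | NAssign string "nexp list" nexp
  | RAssign string "nexp list" rexp
  | Flip string "nexp list" rexp
  | Seq prog prog
  | Cond bexp prog prog
  | While bexp prog

record store =
  ncell :: "string \<Rightarrow> nat list \<Rightarrow> nat"
  rcell :: "string \<Rightarrow> nat list \<Rightarrow> real"

definition nset :: "string \<Rightarrow> nat list \<Rightarrow> nat \<Rightarrow> store \<Rightarrow> store" where
  "nset x i a \<sigma> = \<sigma>\<lparr>ncell := (ncell \<sigma>)(x := (ncell \<sigma> x)(i := a))\<rparr>"

definition rset :: "string \<Rightarrow> nat list \<Rightarrow> real \<Rightarrow> store \<Rightarrow> store" where
  "rset x i a \<sigma> = \<sigma>\<lparr>rcell := (rcell \<sigma>)(x := (rcell \<sigma> x)(i := a))\<rparr>"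

primrec neval :: "store \<Rightarrow> nexp \<Rightarrow> nat" where
  "neval \<sigma> (NConst a) = a"
| "neval \<sigma> (NCell x is) = ncell \<sigma> x (map (neval \<sigma>) is)"
| "neval \<sigma> (NAdd a b) = neval \<sigma> a + neval \<sigma> b"
| "neval \<sigma> (NSub a b) = neval \<sigma> a - neval \<sigma> b"

primrec reval :: "store \<Rightarrow> rexp \<Rightarrow> real" where
  "reval \<sigma> (RConst a) = real a"
| "reval \<sigma> (RCell x is) = rcell \<sigma> x (map (neval \<sigma>) is)"
| "reval \<sigma> (ROfNat a) = real (neval \<sigma> a)"
| "reval \<sigma> (RAdd a b) = reval \<sigma> a + reval \<sigma> b"
| "reval \<sigma> (RSub a b) = reval \<sigma> a - reval \<sigma> b"
| "reval \<sigma> (RMul a b) = reval \<sigma> a * reval \<sigma> b"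
| "reval \<sigma> (RDiv a b) = reval \<sigma> a / reval \<sigma> b"

primrec beval :: "store \<Rightarrow> bexp \<Rightarrow> bool" where
  "beval \<sigma> (NLess a b) \<longleftrightarrow> neval \<sigma> a < neval \<sigma> b"
| "beval \<sigma> (RLess a b) \<longleftrightarrow> reval \<sigma> a < reval \<sigma> b"
| "beval \<sigma> (BNot b) \<longleftrightarrow> \<not> beval \<sigma> b"
| "beval \<sigma> (BAnd a b) \<longleftrightarrow> beval \<sigma> a \<and> beval \<sigma> b"

text \<open>A configuration consists of the stack of programs still to be executed and the store; the
  machine has halted when the stack is empty. The constant \<open>bernoulli_pmf\<close> clamps its argument to
  the unit interval.\<close>

type_synonym config = "prog list \<times> store"

primrec exec1 :: "prog \<Rightarrow> prog list \<Rightarrow> store \<Rightarrow> config pmf" where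
  "exec1 Skip K \<sigma> = return_pmf (K, \<sigma>)"
| "exec1 (NAssign x is a) K \<sigma> = return_pmf (K, nset x (map (neval \<sigma>) is) (neval \<sigma> a) \<sigma>)"
| "exec1 (RAssign x is a) K \<sigma> = return_pmf (K, rset x (map (neval \<sigma>) is) (reval \<sigma> a) \<sigma>)"
| "exec1 (Flip x is a) K \<sigma> =
     map_pmf (\<lambda>b. (K, nset x (map (neval \<sigma>) is) (of_bool b) \<sigma>)) (bernoulli_pmf (reval \<sigma> a))"
| "exec1 (Seq P Q) K \<sigma> = return_pmf (P # Q # K, \<sigma>)"
| "exec1 (Cond b P Q) K \<sigma> = return_pmf ((if beval \<sigma> b then P else Q) # K, \<sigma>)"
| "exec1 (While b P) K \<sigma> =
     return_pmf (if beval \<sigma> b then (P # While b P # K, \<sigma>) else (K, \<sigma>))"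

fun step :: "config \<Rightarrow> config pmf" where
  "step ([], \<sigma>) = return_pmf ([], \<sigma>)"
| "step (P # K, \<sigma>) = exec1 P K \<sigma>"

primrec steps :: "nat \<Rightarrow> config \<Rightarrow> config pmf" where
  "steps 0 c = return_pmf c"
| "steps (Suc k) c = bind_pmf (step c) (steps k)"


section \<open>Algorithms\<close>

text \<open>Distributions are given explicitly by the tables of their tail probabilities. The table of an
  expiration time ends at \<open>max_deadline I\<close>, since later expirations are irrelevant.\<close>

definition input_store :: "sse \<Rightarrow> store" where
  "input_store I = \<lparr>
     ncell = (\<lambda>x i.
       if x = ''n'' \<and> i = [] then num_opts I
       else if x = ''T'' \<and> i = [] then horizon I
       else if x = ''Dmax'' \<and> i = [] then max_deadline I
       else if x = ''D'' \<and> (\<exists>j \<in> opts I. i = [j]) then deadline I (hd i)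
       else 0),
     rcell = (\<lambda>x i.
       if x = ''v'' \<and> (\<exists>j \<in> opts I. i = [j]) then reward I (hd i)
       else if x = ''FS'' \<and> (\<exists>j \<in> opts I. \<exists>t \<le> horizon I. i = [j, t])
         then tail_prob (eval_dist I (hd i)) (i ! 1)
       else if x = ''p'' \<and> (\<exists>j \<in> opts I. \<exists>t \<le> max_deadline I. i = [j, t])
         then tail_prob (exp_dist I (hd i)) (i ! 1)
       else 0)\<rparr>"

text \<open>At each decision epoch the program is started on the store that it left behind at the previous
  one, with the current time and the available options written to the cells \<open>''t''\<close> and \<open>''avail''\<close>.
  It returns its decision in the cell \<open>''sel''\<close>, where any number that is not an available option
  means that nothing is selected.\<close>

definition observe :: "nat \<Rightarrow> nat set \<Rightarrow> store \<Rightarrow> store" where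
  "observe t A \<sigma> = nset ''sel'' [] 0 (nset ''t'' [] t
     (\<sigma>\<lparr>ncell := (ncell \<sigma>)(''avail'' :=
        (\<lambda>i. if \<exists>j. i = [j] then of_bool (hd i \<in> A) else ncell \<sigma> ''avail'' i))\<rparr>))"

definition decision :: "nat set \<Rightarrow> store \<Rightarrow> nat option" where
  "decision A \<sigma> = (if ncell \<sigma> ''sel'' [] \<in> A then Some (ncell \<sigma> ''sel'' []) else None)"

text \<open>The memory \<open>None\<close> records that some call of the program was cut off, not having halted within
  \<open>B\<close> steps.\<close>

fun rule_of_prog :: "prog \<Rightarrow> nat \<Rightarrow> store option rule" where
  "rule_of_prog P B None t A = return_pmf (None, None)"
| "rule_of_prog P B (Some \<sigma>) t A =
     map_pmf (\<lambda>(K, \<sigma>'). if K = [] then (decision A \<sigma>', Some \<sigma>') else (None, None))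
       (steps B ([P], observe t A \<sigma>))"

definition runs_within :: "sse \<Rightarrow> prog \<Rightarrow> nat \<Rightarrow> bool" where
  "runs_within I P B \<longleftrightarrow>
     None \<notin> snd ` set_pmf (outcome I (rule_of_prog P B) (Some (input_store I)))"

definition prog_value :: "sse \<Rightarrow> prog \<Rightarrow> nat \<Rightarrow> real" where
  "prog_value I P B = expected_value I (rule_of_prog P B) (Some (input_store I))"

text \<open>On the instance \<open>I\<close>, the program makes each of its at most \<open>max_deadline I\<close> decisions, for all
  realizations of the random variables and of its own random choices, within at most \<open>B\<close> steps, and
  it achieves an \<open>\<alpha>\<close>-fraction of the online optimum.\<close>

definition achieves :: "prog \<Rightarrow> nat \<Rightarrow> real \<Rightarrow> sse \<Rightarrow> bool" where
  "achieves P B \<alpha> I \<longleftrightarrow> runs_within I P B \<and> prog_value I P B \<ge> \<alpha> * online_opt I"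


section \<open>Adequacy of the definitions\<close>

lemma deadline_le_max: "j \<in> opts I \<Longrightarrow> deadline I j \<le> max_deadline I"
  unfolding max_deadline_def opts_def by (intro Max_ge) auto

lemma play_SucE:
  assumes "x \<in> set_pmf (play I act s e (Suc k) t U m)"
    and "\<And>m t A. fst ` set_pmf (act m t A) \<subseteq> insert None (Some ` A)"
  obtains (idle) m' where "x \<in> set_pmf (play I act s e k (t + 1) U m')"
  | (select) j m' y where "j \<in> U" "y \<in> set_pmf (play I act s e k (t + s j) (U - {j}) m')"
      "fst x = (if t + s j \<le> deadline I j then reward I j else 0) + fst y"
proof -
  let ?f = "\<lambda>(d, m'). case d of
         None \<Rightarrow> play I act s e k (t + 1) U m'
       | Some j \<Rightarrow>
           map_pmf (\<lambda>(w, m''). ((if t + s j \<le> deadline I j then reward I j else 0) + w, m''))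
             (play I act s e k (t + s j) (U - {j}) m')"
  have "x \<in> (\<Union>z\<in>set_pmf (act m t {j \<in> U. e j > t}). set_pmf (?f z))"
    using assms(1) by (simp only: play.simps set_bind_pmf)
  then obtain z where z: "z \<in> set_pmf (act m t {j \<in> U. e j > t})" "x \<in> set_pmf (?f z)"
    by (rule UN_E)
  obtain d m' where "z = (d, m')" by (rule prod.exhaust)
  with z have dm: "(d, m') \<in> set_pmf (act m t {j \<in> U. e j > t})"
    and x: "x \<in> set_pmf (?f (d, m'))"
    by (simp_all only:)
  have d: "d \<in> insert None (Some ` {j \<in> U. e j > t})"
    using subsetD[OF assms(2) imageI[OF dm]] by simp
  show ?thesis
  proof (cases d)
    case None
    with x show ?thesis by (intro idle[of m']) simp
  next
    case (Some j)
    with x obtain y where y: "y \<in> set_pmf (play I act s e k (t + s j) (U - {j}) m')"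
      "fst x = (if t + s j \<le> deadline I j then reward I j else 0) + fst y"
      by (auto simp del: play.simps)
    from d Some have "j \<in> U" by blast
    with y show ?thesis by (intro select)
  qed
qed

lemma play_late:
  assumes "\<And>m t A. fst ` set_pmf (act m t A) \<subseteq> insert None (Some ` A)"
    and "\<And>j. j \<in> opts I \<Longrightarrow> s j \<ge> 1"
    and "U \<subseteq> opts I" "t \<ge> max_deadline I" "x \<in> set_pmf (play I act s e k t U m)"
  shows "fst x = 0"
  using assms(3-5)
proof (induction k arbitrary: t U m x)
  case 0
  then show ?case by simp
next
  case (Suc k)
  from Suc.prems(3) assms(1) show ?case
  proof (cases rule: play_SucE)
    case (idle m')
    then show ?thesis using Suc.IH[of U "t + 1" x m'] Suc.prems(1,2) by simp
  next
    case (select j m' y)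
    then have j: "j \<in> opts I" using Suc.prems(1) by blast
    have "\<not> t + s j \<le> deadline I j"
      using assms(2)[OF j] deadline_le_max[OF j] Suc.prems(2) by linarith
    moreover have "fst y = 0"
      by (rule Suc.IH[OF _ _ select(2)]) (use Suc.prems(1,2) in auto)
    ultimately show ?thesis using select(3) by simp
  qed
qed

lemma play_extra_epochs:
  assumes "\<And>m t A. fst ` set_pmf (act m t A) \<subseteq> insert None (Some ` A)"
    and "\<And>j. j \<in> opts I \<Longrightarrow> s j \<ge> 1"
    and "U \<subseteq> opts I" "t + k \<ge> max_deadline I"
  shows "map_pmf fst (play I act s e (k + l) t U m) = map_pmf fst (play I act s e k t U m)"
  using assms(3-4)
proof (induction k arbitrary: t U m)
  case 0
  have "map_pmf fst (play I act s e l t U m) = map_pmf (\<lambda>_. 0) (play I act s e l t U m)"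
  proof (intro map_pmf_cong refl)
    fix x assume "x \<in> set_pmf (play I act s e l t U m)"
    then show "fst x = 0" by (rule play_late[OF assms(1,2), rotated 3]) (use 0 in auto)
  qed
  then show ?case by (simp add: map_pmf_const)
next
  case (Suc k)
  let ?f = "\<lambda>k (d, m'). case d of
         None \<Rightarrow> play I act s e k (t + 1) U m'
       | Some j \<Rightarrow>
           map_pmf (\<lambda>(w, m''). ((if t + s j \<le> deadline I j then reward I j else 0) + w, m''))
             (play I act s e k (t + s j) (U - {j}) m')"
  have "map_pmf fst (?f (k + l) z) = map_pmf fst (?f k z)"
    if z: "z \<in> set_pmf (act m t {j \<in> U. e j > t})" for z
  proof -
    obtain d m' where dm: "z = (d, m')" by fastforce
    have d: "d \<in> insert None (Some ` {j \<in> U. e j > t})"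
      using subsetD[OF assms(1) imageI[OF z]] by (simp add: dm)
    show ?thesis
    proof (cases d)
      case None
      then show ?thesis using Suc.IH[of U "t + 1" m'] Suc.prems dm by simp
    next
      case (Some j)
      with d have j: "j \<in> opts I" using Suc.prems(1) by blast
      have eq: "map_pmf fst (map_pmf (\<lambda>(w, m''). (c + w, m'')) p)
          = map_pmf ((+) c) (map_pmf fst p)" for c :: real and p :: "(real \<times> 'a) pmf"
        by (simp add: pmf.map_comp o_def case_prod_unfold)
      have "map_pmf fst (play I act s e (k + l) (t + s j) (U - {j}) m')
          = map_pmf fst (play I act s e k (t + s j) (U - {j}) m')"
        by (rule Suc.IH) (use Suc.prems assms(2)[OF j] in auto)
      then show ?thesis unfolding dm Some prod.case option.case eq by simp
    qed
  qed
  then have "bind_pmf (act m t {j \<in> U. e j > t}) (\<lambda>z. map_pmf fst (?f (k + l) z))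
      = bind_pmf (act m t {j \<in> U. e j > t}) (\<lambda>z. map_pmf fst (?f k z))"
    by (intro bind_pmf_cong refl)
  then show ?case unfolding add_Suc play.simps map_bind_pmf .
qed

lemma play_bounds:
  assumes "\<And>m t A. fst ` set_pmf (act m t A) \<subseteq> insert None (Some ` A)"
    and "\<And>j. j \<in> opts I \<Longrightarrow> reward I j \<ge> 0"
    and "U \<subseteq> opts I" "x \<in> set_pmf (play I act s e k t U m)"
  shows "0 \<le> fst x \<and> fst x \<le> (\<Sum>j\<in>U. reward I j)"
  using assms(3-4)
proof (induction k arbitrary: t U m x)
  case 0
  have "0 \<le> (\<Sum>j\<in>U. reward I j)" by (rule sum_nonneg) (use 0 assms(2) in blast)
  with 0 show ?case by simp
next
  case (Suc k)
  from Suc.prems(2) assms(1) show ?case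
  proof (cases rule: play_SucE)
    case (idle m')
    then show ?thesis by (rule Suc.IH[OF Suc.prems(1)])
  next
    case (select j m' y)
    have "finite U" using Suc.prems(1) by (rule finite_subset) (simp add: opts_def)
    then have "(\<Sum>i\<in>U. reward I i) = reward I j + (\<Sum>i\<in>U - {j}. reward I i)"
      using select(1) by (rule sum.remove)
    moreover have "0 \<le> fst y \<and> fst y \<le> (\<Sum>i\<in>U - {j}. reward I i)"
      by (rule Suc.IH[OF _ select(2)]) (use Suc.prems(1) in blast)
    moreover have "reward I j \<ge> 0" using assms(2) Suc.prems(1) select(1) by blast
    ultimately show ?thesis using select(3) by auto
  qed
qed

lemma fst_rule_of_policy:
  "online_policy \<pi> \<Longrightarrow> fst ` set_pmf (rule_of_policy \<pi> h t A) \<subseteq> insert None (Some ` A)"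
  by (simp add: online_policy_def rule_of_policy_def image_image)

lemma fst_rule_of_prog: "fst ` set_pmf (rule_of_prog P B m t A) \<subseteq> insert None (Some ` A)"
  by (cases m) (auto simp: decision_def split: if_splits)

lemma expected_value_bounds:
  assumes "\<And>m t A. fst ` set_pmf (act m t A) \<subseteq> insert None (Some ` A)" "sse_instance I"
  shows "0 \<le> expected_value I act m" "expected_value I act m \<le> (\<Sum>j\<in>opts I. reward I j)"
proof -
  have nn: "\<And>j. j \<in> opts I \<Longrightarrow> reward I j \<ge> 0"
    using assms(2) by (auto simp: sse_instance_def intro: less_imp_le)
  have b: "0 \<le> fst x \<and> fst x \<le> (\<Sum>j\<in>opts I. reward I j)"
    if "x \<in> set_pmf (outcome I act m)" for x
  proof -
    from that obtain s e
      where "x \<in> set_pmf (play I act s e (max_deadline I) 1 (opts I) m)"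
      unfolding outcome_def set_bind_pmf by blast
    then show ?thesis
      using play_bounds[of act I "opts I" x s e "max_deadline I" 1 m] assms(1) nn by simp
  qed
  show "0 \<le> expected_value I act m"
    unfolding expected_value_def
    by (intro integral_nonneg_AE) (use b in \<open>auto simp: AE_measure_pmf_iff\<close>)
  have "integrable (measure_pmf (outcome I act m)) fst"
    by (intro measure_pmf.integrable_const_bound[where B = "\<Sum>j\<in>opts I. reward I j"])
      (use b in \<open>auto simp: AE_measure_pmf_iff\<close>)
  then have "expected_value I act m
      \<le> measure_pmf.expectation (outcome I act m) (\<lambda>_. \<Sum>j\<in>opts I. reward I j)"
    unfolding expected_value_def
    by (intro integral_mono_AE) (use b in \<open>auto simp: AE_measure_pmf_iff\<close>)
  then show "expected_value I act m \<le> (\<Sum>j\<in>opts I. reward I j)" by simp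
qed

lemma bdd_above_policy_value:
  assumes "sse_instance I"
  shows "bdd_above (policy_value I ` {\<pi>. online_policy \<pi>})"
proof (rule bdd_aboveI2)
  fix \<pi> assume "\<pi> \<in> {\<pi>. online_policy \<pi>}"
  then have "online_policy \<pi>" by simp
  from expected_value_bounds(2)[of "rule_of_policy \<pi>", OF fst_rule_of_policy[OF this] assms]
  show "policy_value I \<pi> \<le> (\<Sum>j\<in>opts I. reward I j)" unfolding policy_value_def .
qed

lemma ex_online_policy: "\<exists>\<pi>. online_policy \<pi>"
  by (rule exI[of _ "\<lambda>_ _ _. return_pmf None"]) (simp add: online_policy_def)

end

theory Submission
  imports Defs
begin

text \<open>Neither part needs a linear program. Both policies select the available option of largest index,
  if that index is positive.

  If the evaluation times are identically distributed, the index is the expected immediate reward.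
  Couple this greedy policy with any other one such that their \<open>l\<close>-th selections take the same
  time. Then greedy is never behind, and every selection of the other policy can be charged either
  to the simultaneous greedy selection or to the earlier greedy selection of the same option, because
  expected rewards only decrease over time. This gives the factor 1/2, even if the expiration times
  are known in advance.

  In general, the index of option \<open>j\<close> at time \<open>t\<close> is its expected reward minus the prices of the two
  resources that it consumes: the time of the decision-maker, priced \<open>h(t) - E h(t + S\<^sub>j)\<close>, and the
  option itself, priced \<open>C\<^sub>j(t + 1) / p\<^sub>j(t)\<close>. Backwards in time, \<open>C\<^sub>j(t)\<close> exceeds \<open>C\<^sub>j(t + 1)\<close> by
  the expected positive part of the index on the event that \<open>j\<close> is alive at \<open>t\<close> and every option of
  larger index has expired, and \<open>h = \<Sum>\<^sub>j C\<^sub>j\<close>. If \<open>N\<close> is the set of options whose expiration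
  has not been looked at, the policy earns at least \<open>\<Sum>\<^sub>j\<^sub>\<in>\<^sub>N C\<^sub>j(t)\<close> from time \<open>t\<close> on, hence at least
  \<open>h(1)\<close> overall. Any online policy earns at most the initial prices \<open>h(1) + \<Sum>\<^sub>j C\<^sub>j(1)\<close> of all
  resources plus \<open>\<Sum>\<^sub>t E (max\<^sub>j index)\<^sup>+\<close>, which is \<open>3 h(1)\<close>. The resulting factor 1/3 exceeds
  \<open>0.316\<close>, so that \<open>\<epsilon>\<close> plays no role.\<close>

section \<open>Expectations and products of probability mass functions\<close>

lemma integrable_pmf_bounded:
  fixes f :: "'a \<Rightarrow> real"
  assumes "\<And>x. x \<in> set_pmf p \<Longrightarrow> 0 \<le> f x \<and> f x \<le> B"
  shows "integrable (measure_pmf p) f"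
  by (rule measure_pmf.integrable_const_bound[where B = B]) (use assms in \<open>auto simp: AE_measure_pmf_iff\<close>)

lemma expectation_pmf_mono:
  fixes f g :: "'a \<Rightarrow> real"
  assumes "\<And>x. x \<in> set_pmf p \<Longrightarrow> 0 \<le> f x" "\<And>x. x \<in> set_pmf p \<Longrightarrow> f x \<le> g x"
    "\<And>x. x \<in> set_pmf p \<Longrightarrow> g x \<le> B"
  shows "measure_pmf.expectation p f \<le> measure_pmf.expectation p g"
proof (rule integral_mono_AE)
  show "integrable (measure_pmf p) f" "integrable (measure_pmf p) g"
    using assms by (auto intro!: integrable_pmf_bounded[where B = B] intro: order_trans)
qed (use assms in \<open>auto simp: AE_measure_pmf_iff\<close>)

lemma expectation_pmf_bounds:
  fixes f :: "'a \<Rightarrow> real"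
  assumes "\<And>x. x \<in> set_pmf p \<Longrightarrow> 0 \<le> f x \<and> f x \<le> B"
  shows "0 \<le> measure_pmf.expectation p f" "measure_pmf.expectation p f \<le> B"
proof -
  show "0 \<le> measure_pmf.expectation p f"
    by (intro integral_nonneg_AE) (use assms in \<open>auto simp: AE_measure_pmf_iff\<close>)
  have "measure_pmf.expectation p f \<le> measure_pmf.expectation p (\<lambda>_. B)"
    by (rule expectation_pmf_mono[where B = B]) (use assms in auto)
  then show "measure_pmf.expectation p f \<le> B" by simp
qed

lemma expectation_pmf_cong:
  assumes "\<And>x. x \<in> set_pmf p \<Longrightarrow> f x = g x"
  shows "measure_pmf.expectation p f = measure_pmf.expectation p g"
  by (intro integral_cong_AE) (use assms in \<open>auto simp: AE_measure_pmf_iff\<close>)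

text \<open>The law of total expectation, inherited from the nonnegative integral, where it needs no
  integrability. The bound \<open>B\<close> justifies the passage back to real expectations.\<close>

lemma expectation_bind_pmf:
  fixes f :: "'b \<Rightarrow> real"
  assumes "\<And>x. x \<in> set_pmf (bind_pmf p q) \<Longrightarrow> 0 \<le> f x \<and> f x \<le> B"
  shows "measure_pmf.expectation (bind_pmf p q) f
    = measure_pmf.expectation p (\<lambda>x. measure_pmf.expectation (q x) f)"
proof -
  have q: "0 \<le> f y \<and> f y \<le> B" if "x \<in> set_pmf p" "y \<in> set_pmf (q x)" for x y
    using assms that by auto
  have "ennreal (measure_pmf.expectation (bind_pmf p q) f) = (\<integral>\<^sup>+y. f y \<partial>bind_pmf p q)"
    by (rule nn_integral_eq_integral[symmetric])
      (use assms in \<open>auto intro!: integrable_pmf_bounded[where B = B] simp: AE_measure_pmf_iff\<close>)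
  also have "\<dots> = (\<integral>\<^sup>+x. \<integral>\<^sup>+y. f y \<partial>q x \<partial>p)" by simp
  also have "\<dots> = (\<integral>\<^sup>+x. ennreal (measure_pmf.expectation (q x) f) \<partial>p)"
    by (intro nn_integral_cong_AE, simp add: AE_measure_pmf_iff, intro ballI nn_integral_eq_integral)
      (use q in \<open>auto intro!: integrable_pmf_bounded[where B = B] simp: AE_measure_pmf_iff\<close>)
  also have "\<dots> = ennreal (measure_pmf.expectation p (\<lambda>x. measure_pmf.expectation (q x) f))"
    by (rule nn_integral_eq_integral)
      (use q in \<open>auto intro!: integrable_pmf_bounded[where B = B] expectation_pmf_bounds simp: AE_measure_pmf_iff\<close>)
  finally show ?thesis
    using q assms by (subst (asm) ennreal_inj)
      (auto intro!: expectation_pmf_bounds(1)[where B = B] intro: expectation_pmf_bounds)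
qed

lemma expectation_if_prob:
  "measure_pmf.expectation p (\<lambda>x. if P x then c else d)
    = measure_pmf.prob p {x. P x} * c + (1 - measure_pmf.prob p {x. P x}) * (d::real)"
proof -
  have "measure_pmf.expectation p (\<lambda>x. if P x then c else d)
      = measure_pmf.expectation p (\<lambda>x. d + (c - d) * indicat_real {x. P x} x)"
    by (rule expectation_pmf_cong) (simp add: indicator_def)
  also have "\<dots> = d + (c - d) * measure_pmf.prob p {x. P x}"
    by (subst Bochner_Integration.integral_add)
      (auto intro!: integrable_mult_right measure_pmf.integrable_const_bound[where B = 1] simp del: indicator_simps)
  finally show ?thesis by (simp add: algebra_simps)
qed

section \<open>Conditioning and resampling\<close>

lemma bind_cond_pmf_resample:
  assumes "set_pmf p \<inter> B \<noteq> {}"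
  shows "bind_pmf p (\<lambda>x. if x \<in> B then cond_pmf p B else return_pmf x) = p"
proof -
  \<comment> \<open>An equivalence relation with \<open>B\<close> as one class and singletons
    elsewhere. Drawing a point and then redrawing it within its class leaves the law
    unchanged.\<close>
  let ?R = "\<lambda>x y. (x \<in> B \<and> y \<in> B) \<or> (x \<notin> B \<and> x = y)"
  have "bind_pmf p (\<lambda>x. if x \<in> B then cond_pmf p B else return_pmf x)
      = bind_pmf p (\<lambda>x. cond_pmf p {y. ?R x y})"
  proof (rule bind_pmf_cong[OF refl])
    fix x assume x: "x \<in> set_pmf p"
    show "(if x \<in> B then cond_pmf p B else return_pmf x) = cond_pmf p {y. ?R x y}"
    proof (cases "x \<in> B")
      case True
      then show ?thesis by simp
    next
      case False
      have "cond_pmf p {x} = return_pmf x"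
        using x set_cond_pmf[of p "{x}"] by (subst set_pmf_subset_singleton[symmetric]) auto
      with False show ?thesis by simp
    qed
  qed
  also have "\<dots> = p"
    by (rule bind_cond_pmf_cancel) (auto intro!: arg_cong[where f = "measure_pmf.prob p"])
  finally show ?thesis .
qed

lemma prob_cond_pmf:
  assumes "set_pmf p \<inter> B \<noteq> {}" "C \<subseteq> B"
  shows "measure_pmf.prob (cond_pmf p B) C = measure_pmf.prob p C / measure_pmf.prob p B"
  unfolding cond_pmf.rep_eq[OF assms(1)] using assms(2)
  by (subst measure_uniform_measure) (auto simp: Int_absorb1 emeasure_measure_pmf_not_zero[OF assms(1)])

lemma cond_pmf_triv:
  assumes "set_pmf p \<subseteq> B"
  shows "cond_pmf p B = p"
proof (rule pmf_eqI)
  fix x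
  have B: "set_pmf p \<inter> B \<noteq> {}" using assms set_pmf_not_empty[of p] by blast
  have "measure_pmf.prob p B = 1"
    by (rule measure_pmf.prob_eq_1[THEN iffD2]) (use assms in \<open>auto simp: AE_measure_pmf_iff\<close>)
  then show "pmf (cond_pmf p B) x = pmf p x"
    using assms by (auto simp: pmf_cond[OF B] pmf_eq_0_set_pmf)
qed

lemma cond_pmf_cond_pmf:
  assumes "set_pmf p \<inter> C \<noteq> {}" "C \<subseteq> B"
  shows "cond_pmf (cond_pmf p B) C = cond_pmf p C"
proof (rule pmf_eqI)
  fix x
  have B: "set_pmf p \<inter> B \<noteq> {}" using assms by blast
  have BC: "set_pmf (cond_pmf p B) \<inter> C \<noteq> {}" using assms by (auto simp: set_cond_pmf[OF B])
  have "measure_pmf.prob (cond_pmf p B) C = measure_pmf.prob p C / measure_pmf.prob p B"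
    by (rule prob_cond_pmf[OF B assms(2)])
  moreover have "measure_pmf.prob p B \<noteq> 0" by (rule measure_measure_pmf_not_zero[OF B])
  ultimately show "pmf (cond_pmf (cond_pmf p B) C) x = pmf (cond_pmf p C) x"
    using assms(2) by (auto simp: pmf_cond[OF BC] pmf_cond[OF B] pmf_cond[OF assms(1)])
qed

text \<open>Redrawing every coordinate that lies in \<open>B\<close> from its conditional law
  changes neither the joint law nor the set of these coordinates. Given that set, the retained
  coordinates are therefore independent with their conditional laws.\<close>

lemma Pi_pmf_resample:
  fixes X :: "'a \<Rightarrow> 'b pmf"
  assumes "finite U" and "\<And>j. j \<in> U \<Longrightarrow> set_pmf (X j) \<inter> B \<noteq> {}"
  shows "map_pmf (\<lambda>e j. if j \<in> U \<and> e j \<in> B then e j else d) (Pi_pmf U d X)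
    = bind_pmf (Pi_pmf U d X) (\<lambda>e. Pi_pmf {j \<in> U. e j \<in> B} d (\<lambda>j. cond_pmf (X j) B))"
proof -
  let ?R = "\<lambda>j x. if x \<in> B then cond_pmf (X j) B else return_pmf x"
  let ?f = "\<lambda>(e::'a \<Rightarrow> 'b) j. if j \<in> U \<and> e j \<in> B then e j else d"
  have "Pi_pmf U d X = Pi_pmf U d (\<lambda>j. bind_pmf (X j) (?R j))"
    by (rule Pi_pmf_cong) (simp_all add: bind_cond_pmf_resample assms(2))
  also have "\<dots> = bind_pmf (Pi_pmf U d X) (\<lambda>e. Pi_pmf U d (\<lambda>j. ?R j (e j)))"
    by (rule Pi_pmf_bind[OF assms(1)])
  finally have "map_pmf ?f (Pi_pmf U d X)
      = bind_pmf (Pi_pmf U d X) (\<lambda>e. map_pmf ?f (Pi_pmf U d (\<lambda>j. ?R j (e j))))"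
    by (metis map_bind_pmf)
  also have "\<dots> = bind_pmf (Pi_pmf U d X) (\<lambda>e. Pi_pmf {j \<in> U. e j \<in> B} d (\<lambda>j. cond_pmf (X j) B))"
  proof (rule bind_pmf_cong[OF refl])
    fix e
    let ?A = "{j \<in> U. e j \<in> B}"
    have "Pi_pmf ?A d (\<lambda>j. cond_pmf (X j) B) = Pi_pmf ?A d (\<lambda>j. ?R j (e j))"
      by (rule Pi_pmf_cong) auto
    also have "\<dots> = map_pmf (\<lambda>f x. if x \<in> ?A then f x else d) (Pi_pmf U d (\<lambda>j. ?R j (e j)))"
      by (rule Pi_pmf_subset) (use assms in auto)
    also have "\<dots> = map_pmf ?f (Pi_pmf U d (\<lambda>j. ?R j (e j)))"
    proof (rule map_pmf_cong[OF refl])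
      fix f assume "f \<in> set_pmf (Pi_pmf U d (\<lambda>j. ?R j (e j)))"
      then have f: "f j \<in> set_pmf (?R j (e j))" if "j \<in> U" for j
        using that assms(1) by (auto simp: set_Pi_pmf PiE_dflt_def)
      have "f j \<in> B \<longleftrightarrow> e j \<in> B" if "j \<in> U" for j
        using f[OF that] set_cond_pmf[OF assms(2)[OF that]] by (auto split: if_splits)
      then show "(\<lambda>x. if x \<in> ?A then f x else d) = ?f f" by (auto simp: fun_eq_iff)
    qed
    finally show "map_pmf ?f (Pi_pmf U d (\<lambda>j. ?R j (e j))) = Pi_pmf ?A d (\<lambda>j. cond_pmf (X j) B)" ..
  qed
  finally show ?thesis .
qed

section \<open>The decision process\<close>

definition admissible :: "'m rule \<Rightarrow> bool" where
  "admissible act \<longleftrightarrow> (\<forall>m t A. fst ` set_pmf (act m t A) \<subseteq> insert None (Some ` A))"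

lemma admissibleD:
  "admissible act \<Longrightarrow> (Some j, m') \<in> set_pmf (act m t A) \<Longrightarrow> j \<in> A"
  unfolding admissible_def by (force simp: image_subset_iff)

text \<open>An admissible rule selects only options in \<open>U\<close>, so no other times are ever
  read.\<close>

lemma play_cong:
  assumes "admissible act" "\<And>j. j \<in> U \<Longrightarrow> s j = s' j \<and> e j = e' j"
  shows "play I act s e k t U m = play I act s' e' k t U m"
  using assms(2)
proof (induction k arbitrary: t U m)
  case (Suc k)
  have A: "{j \<in> U. e j > t} = {j \<in> U. e' j > t}" using Suc.prems by auto
  show ?case unfolding play.simps A
  proof (rule bind_pmf_cong[OF refl])
    fix z assume z: "z \<in> set_pmf (act m t {j \<in> U. e' j > t})"
    obtain d m' where dm: "z = (d, m')" by fastforce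
    show "(case z of (d, m') \<Rightarrow> case d of None \<Rightarrow> play I act s e k (t + 1) U m'
        | Some j \<Rightarrow> map_pmf (\<lambda>(w, m''). ((if t + s j \<le> deadline I j then reward I j else 0) + w, m''))
            (play I act s e k (t + s j) (U - {j}) m'))
      = (case z of (d, m') \<Rightarrow> case d of None \<Rightarrow> play I act s' e' k (t + 1) U m'
        | Some j \<Rightarrow> map_pmf (\<lambda>(w, m''). ((if t + s' j \<le> deadline I j then reward I j else 0) + w, m''))
            (play I act s' e' k (t + s' j) (U - {j}) m'))"
    proof (cases d)
      case None
      then show ?thesis using Suc.IH[OF Suc.prems] dm by simp
    next
      case (Some j)
      with z dm have "j \<in> U" using admissibleD[OF assms(1)] by blast
      then have "s j = s' j" using Suc.prems by blast
      moreover have "play I act s e k (t + s' j) (U - {j}) m' = play I act s' e' k (t + s' j) (U - {j}) m'"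
        by (rule Suc.IH) (use Suc.prems in auto)
      ultimately show ?thesis using dm Some by simp
    qed
  qed
qed simp

text \<open>Time never runs backwards, so an option expired at \<open>t\<close> stays out of every
  later available set.\<close>

lemma play_remove_expired:
  assumes "U' \<subseteq> U" "\<And>j. j \<in> U - U' \<Longrightarrow> e j \<le> t"
  shows "play I act s e k t U m = play I act s e k t U' m"
  using assms
proof (induction k arbitrary: t U U' m)
  case (Suc k)
  have A: "{j \<in> U. e j > t} = {j \<in> U'. e j > t}"
    using Suc.prems by (auto simp: not_less[symmetric])
  have "play I act s e k (t + 1) U m' = play I act s e k (t + 1) U' m'" for m'
    by (rule Suc.IH) (use Suc.prems in \<open>auto intro: le_SucI\<close>)
  moreover have "play I act s e k (t + s j) (U - {j}) m' = play I act s e k (t + s j) (U' - {j}) m'" for j m'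
    by (rule Suc.IH) (use Suc.prems in \<open>auto intro: trans_le_add1\<close>)
  ultimately show ?case unfolding play.simps A by (simp only:)
qed simp

text \<open>The expiration laws \<open>X\<close> are a parameter because several choices occur: the
  original laws, the laws conditioned on survival, and point masses once expiration times are
  fixed.\<close>

definition rand_play :: "sse \<Rightarrow> 'm rule \<Rightarrow> (nat \<Rightarrow> nat pmf) \<Rightarrow> nat \<Rightarrow> nat \<Rightarrow> nat set \<Rightarrow> 'm
    \<Rightarrow> (real \<times> 'm) pmf" where
  "rand_play I act X k t U m = bind_pmf (Pi_pmf U 0 (eval_dist I)) (\<lambda>s.
     bind_pmf (Pi_pmf U 0 X) (\<lambda>e. play I act s e k t U m))"

definition val :: "sse \<Rightarrow> 'm rule \<Rightarrow> (nat \<Rightarrow> nat pmf) \<Rightarrow> nat \<Rightarrow> nat \<Rightarrow> nat set \<Rightarrow> 'm \<Rightarrow> real" where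
  "val I act X k t U m = measure_pmf.expectation (rand_play I act X k t U m) fst"

lemma expected_value_eq_val:
  "expected_value I act m = val I act (exp_dist I) (max_deadline I) 1 (opts I) m"
  by (simp add: expected_value_def val_def outcome_def rand_play_def)

lemma finite_opts [simp]: "finite (opts I)"
  by (simp add: opts_def)

text \<open>By independence the expiration time of \<open>a\<close> may be drawn first. This is how
  a single option gets examined.\<close>

lemma rand_play_split:
  assumes "finite U" "a \<in> U"
  shows "rand_play I act X k t U m
    = bind_pmf (X a) (\<lambda>x. rand_play I act (X(a := return_pmf x)) k t U m)"
proof -
  have U: "U = insert a (U - {a})" and f: "finite (U - {a})" using assms by auto
  have eq: "Pi_pmf U 0 X = bind_pmf (X a) (\<lambda>x. Pi_pmf U 0 (X(a := return_pmf x)))"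
  proof -
    have "Pi_pmf (U - {a}) 0 (X(a := return_pmf x)) = Pi_pmf (U - {a}) 0 X" for x
      by (rule Pi_pmf_cong) auto
    then show ?thesis
      by (subst (1 2) U, subst (1 2) Pi_pmf_insert'[OF f]) (auto simp: bind_return_pmf)
  qed
  show ?thesis
    unfolding rand_play_def
    by (subst eq, subst bind_assoc_pmf, subst bind_commute_pmf) (rule refl)
qed

lemma rand_play_cong:
  assumes "\<And>j. j \<in> U \<Longrightarrow> X j = X' j"
  shows "rand_play I act X k t U m = rand_play I act X' k t U m"
proof -
  have "Pi_pmf U 0 X = Pi_pmf U 0 X'" by (rule Pi_pmf_cong) (use assms in auto)
  then show ?thesis by (simp add: rand_play_def)
qed

lemma rand_play_subset:
  assumes "admissible act" "finite U" "U' \<subseteq> U"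
    and "\<And>e j. e \<in> set_pmf (Pi_pmf U 0 X) \<Longrightarrow> j \<in> U - U' \<Longrightarrow> e j \<le> t"
  shows "rand_play I act X k t U m = rand_play I act X k t U' m"
proof -
  let ?r = "\<lambda>(f::nat \<Rightarrow> nat) x. if x \<in> U' then f x else 0"
  have s: "Pi_pmf U' 0 p = map_pmf ?r (Pi_pmf U 0 p)" for p :: "nat \<Rightarrow> nat pmf"
    by (rule Pi_pmf_subset[OF assms(2,3)])
  show ?thesis
    unfolding rand_play_def s bind_map_pmf
  proof (intro bind_pmf_cong refl)
    fix s e assume e: "e \<in> set_pmf (Pi_pmf U 0 X)"
    have "play I act s e k t U m = play I act s e k t U' m"
      by (rule play_remove_expired) (use assms(3,4) e in auto)
    also have "\<dots> = play I act (?r s) (?r e) k t U' m"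
      by (rule play_cong[OF assms(1)]) auto
    finally show "play I act s e k t U m = play I act (?r s) (?r e) k t U' m" .
  qed
qed

text \<open>By the third assumption the rule answers with the same \<open>q\<close> for all
  expiration times, so the decision reveals nothing about them. The remaining realizations stay
  independent with the same laws, and the evaluation time of the selected option is drawn only
  now.\<close>

lemma rand_play_step:
  assumes "admissible act" "finite U"
    and "\<And>e. e \<in> set_pmf (Pi_pmf U 0 X) \<Longrightarrow> act m t {j \<in> U. e j > t} = q"
  shows "rand_play I act X (Suc k) t U m = bind_pmf q (\<lambda>(d, m'). case d of
      None \<Rightarrow> rand_play I act X k (t + 1) U m'
    | Some j \<Rightarrow> bind_pmf (eval_dist I j) (\<lambda>x.
        map_pmf (\<lambda>(w, m''). ((if t + x \<le> deadline I j then reward I j else 0) + w, m''))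
          (rand_play I act X k (t + x) (U - {j}) m')))"
proof -
  let ?g = "\<lambda>j x. \<lambda>(w, m''). ((if t + x \<le> deadline I j then reward I j else 0) + w, m'' :: 'a)"
  let ?F = "\<lambda>s e (d, m'). case d of None \<Rightarrow> play I act s e k (t + 1) U m'
        | Some j \<Rightarrow> map_pmf (?g j (s j)) (play I act s e k (t + s j) (U - {j}) m')"
  let ?S = "Pi_pmf U 0 (eval_dist I)" and ?E = "Pi_pmf U 0 X"
  have "rand_play I act X (Suc k) t U m = bind_pmf ?S (\<lambda>s. bind_pmf ?E (\<lambda>e. bind_pmf q (?F s e)))"
    unfolding rand_play_def
    by (intro bind_pmf_cong refl) (simp add: assms(3))
  also have "\<dots> = bind_pmf q (\<lambda>z. bind_pmf ?S (\<lambda>s. bind_pmf ?E (\<lambda>e. ?F s e z)))"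
    by (subst bind_commute_pmf[of ?E], subst bind_commute_pmf[of ?S]) (rule refl)
  also have "\<dots> = bind_pmf q (\<lambda>(d, m'). case d of
      None \<Rightarrow> rand_play I act X k (t + 1) U m'
    | Some j \<Rightarrow> bind_pmf (eval_dist I j) (\<lambda>x. map_pmf (?g j x) (rand_play I act X k (t + x) (U - {j}) m')))"
  proof (rule bind_pmf_cong[OF refl])
    fix z assume z: "z \<in> set_pmf q"
    obtain d m' where dm: "z = (d, m')" by fastforce
    \<comment> \<open>Any realization serves to conclude from admissibility that the selected option
      lies in \<open>U\<close>.\<close>
    obtain e0 where e0: "e0 \<in> set_pmf ?E" by (meson ex_in_conv set_pmf_not_empty)
    show "bind_pmf ?S (\<lambda>s. bind_pmf ?E (\<lambda>e. ?F s e z)) = (case z of (d, m') \<Rightarrow> case d of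
        None \<Rightarrow> rand_play I act X k (t + 1) U m'
      | Some j \<Rightarrow> bind_pmf (eval_dist I j) (\<lambda>x. map_pmf (?g j x) (rand_play I act X k (t + x) (U - {j}) m')))"
    proof (cases d)
      case None
      then show ?thesis by (simp add: dm rand_play_def)
    next
      case (Some j)
      have j: "j \<in> U"
        using admissibleD[OF assms(1), of j m' m t "{j \<in> U. e0 j > t}"] z dm Some assms(3)[OF e0] by auto
      then have U: "U = insert j (U - {j})" and f: "finite (U - {j})" using assms(2) by auto
      have ins: "Pi_pmf U 0 p = bind_pmf (p j) (\<lambda>y. bind_pmf (Pi_pmf (U - {j}) 0 p)
          (\<lambda>f. return_pmf (f(j := y))))" for p :: "nat \<Rightarrow> nat pmf"
        by (subst U, subst Pi_pmf_insert'[OF f]) auto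
      \<comment> \<open>The selected option has left \<open>U - {j}\<close>, so its own draws no
        longer influence the rest.\<close>
      have pc: "play I act (s(j := x)) (e(j := y)) k t' (U - {j}) m' = play I act s e k t' (U - {j}) m'"
        for s e x y t'
        by (rule play_cong[OF assms(1)]) auto
      show ?thesis unfolding dm Some prod.case option.case
        by (simp only: ins bind_assoc_pmf bind_return_pmf fun_upd_same pc bind_pmf_const
            rand_play_def map_bind_pmf)
    qed
  qed
  finally show ?thesis .
qed

text \<open>The truncated subtraction is harmless: from the deadline on, the tail is taken at 0,
  where it is 1 for positive evaluation times, and the reward vanishes.\<close>

definition exp_reward :: "sse \<Rightarrow> nat \<Rightarrow> nat \<Rightarrow> real" where
  "exp_reward I j t = reward I j * (1 - tail_prob (eval_dist I j) (deadline I j - t))"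

section \<open>Values of rules on a fixed instance\<close>

locale sse_inst =
  fixes I :: sse
  assumes inst: "sse_instance I"
begin

lemma reward_pos: "j \<in> opts I \<Longrightarrow> reward I j > 0"
  and eval_pos: "j \<in> opts I \<Longrightarrow> x \<in> set_pmf (eval_dist I j) \<Longrightarrow> 1 \<le> x"
  and eval_tail: "j \<in> opts I \<Longrightarrow> tail_prob (eval_dist I j) (horizon I) = 0"
  and exp_tail_pos: "j \<in> opts I \<Longrightarrow> 1 \<le> t \<Longrightarrow> tail_prob (exp_dist I j) t > 0"
  and exp_tail_1: "j \<in> opts I \<Longrightarrow> tail_prob (exp_dist I j) 1 = 1"
  using inst by (auto simp: sse_instance_def)

lemma eval_le: "j \<in> opts I \<Longrightarrow> x \<in> set_pmf (eval_dist I j) \<Longrightarrow> x \<le> horizon I"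
  using eval_tail[of j] measure_pmf_posI[of x "eval_dist I j" "{x. x > horizon I}"]
  by (fastforce simp: tail_prob_def not_less[symmetric])

lemma finite_eval: "j \<in> opts I \<Longrightarrow> finite (set_pmf (eval_dist I j))"
  by (rule finite_subset[of _ "{..horizon I}"]) (auto dest: eval_le)

lemma integrable_eval: "j \<in> opts I \<Longrightarrow> integrable (measure_pmf (eval_dist I j)) (f :: nat \<Rightarrow> real)"
  by (intro integrable_measure_pmf_finite finite_eval)

lemma expectation_eval_mono:
  assumes "j \<in> opts I" "\<And>x. 1 \<le> x \<Longrightarrow> f x \<le> (g x :: real)"
  shows "measure_pmf.expectation (eval_dist I j) f \<le> measure_pmf.expectation (eval_dist I j) g"
  by (intro integral_mono_AE integrable_eval assms) (use assms eval_pos in \<open>auto simp: AE_measure_pmf_iff\<close>)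

lemma eval_tail_0: "j \<in> opts I \<Longrightarrow> tail_prob (eval_dist I j) 0 = 1"
  unfolding tail_prob_def by (rule measure_pmf.prob_eq_1[THEN iffD2]) (auto simp: AE_measure_pmf_iff dest: eval_pos)

lemma exp_reward_eq:
  assumes "j \<in> opts I"
  shows "measure_pmf.expectation (eval_dist I j) (\<lambda>x. if t + x \<le> deadline I j then reward I j else 0)
    = exp_reward I j t"
proof -
  have "measure_pmf.expectation (eval_dist I j) (\<lambda>x. if t + x \<le> deadline I j then reward I j else 0)
      = measure_pmf.expectation (eval_dist I j) (\<lambda>x. if deadline I j - t < x then 0 else reward I j)"
    by (rule expectation_pmf_cong) (use eval_pos[OF assms] in fastforce)
  also have "\<dots> = exp_reward I j t"
    unfolding expectation_if_prob by (simp add: exp_reward_def tail_prob_def)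
  finally show ?thesis .
qed

lemma exp_reward_nonneg: "j \<in> opts I \<Longrightarrow> 0 \<le> exp_reward I j t"
  unfolding exp_reward_def tail_prob_def using reward_pos[of j]
  by (intro mult_nonneg_nonneg) (auto intro: measure_pmf.prob_le_1)

lemma exp_reward_antimono: "j \<in> opts I \<Longrightarrow> t \<le> t' \<Longrightarrow> exp_reward I j t' \<le> exp_reward I j t"
  unfolding exp_reward_def tail_prob_def using reward_pos[of j]
  by (intro mult_left_mono diff_left_mono measure_pmf.finite_measure_mono) auto

lemma exp_reward_late: "j \<in> opts I \<Longrightarrow> max_deadline I \<le> t \<Longrightarrow> exp_reward I j t = 0"
  using deadline_le_max[of j I] by (simp add: exp_reward_def eval_tail_0)

lemma rand_play_bounds:
  assumes "admissible act" "U \<subseteq> opts I" "x \<in> set_pmf (rand_play I act X k t U m)"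
  shows "0 \<le> fst x \<and> fst x \<le> (\<Sum>j\<in>U. reward I j)"
proof -
  obtain s e where "x \<in> set_pmf (play I act s e k t U m)"
    using assms(3) unfolding rand_play_def set_bind_pmf by blast
  with assms(2) show ?thesis
    by (intro play_bounds[of act I U]) (use assms(1) reward_pos in \<open>auto simp: admissible_def less_imp_le\<close>)
qed

lemma val_bounds:
  assumes "admissible act" "U \<subseteq> opts I"
  shows "0 \<le> val I act X k t U m" "val I act X k t U m \<le> (\<Sum>j\<in>opts I. reward I j)"
proof -
  have "(\<Sum>j\<in>U. reward I j) \<le> (\<Sum>j\<in>opts I. reward I j)"
    using assms(2) reward_pos by (intro sum_mono2) (auto intro: less_imp_le)
  then have "0 \<le> fst x \<and> fst x \<le> (\<Sum>j\<in>opts I. reward I j)"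
    if "x \<in> set_pmf (rand_play I act X k t U m)" for x
    using rand_play_bounds[OF assms that] by linarith
  then show "0 \<le> val I act X k t U m" "val I act X k t U m \<le> (\<Sum>j\<in>opts I. reward I j)"
    unfolding val_def by (intro expectation_pmf_bounds; blast)+
qed

lemma val_0 [simp]: "val I act X 0 t U m = 0"
  by (simp add: val_def rand_play_def)

lemma val_bind:
  assumes "admissible act" "\<And>x. x \<in> set_pmf p \<Longrightarrow> U x \<subseteq> opts I"
    "rand_play I act X k t U' m = bind_pmf p (\<lambda>x. rand_play I act (X' x) (k' x) (t' x) (U x) (m' x))"
  shows "val I act X k t U' m = measure_pmf.expectation p (\<lambda>x. val I act (X' x) (k' x) (t' x) (U x) (m' x))"
proof -
  have *: "(\<Sum>j\<in>U x. reward I j) \<le> (\<Sum>j\<in>opts I. reward I j)" if "x \<in> set_pmf p" for x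
    using assms(2)[OF that] reward_pos by (intro sum_mono2) (auto intro: less_imp_le)
  show ?thesis
    unfolding val_def assms(3)
  proof (rule expectation_bind_pmf[where B = "\<Sum>j\<in>opts I. reward I j"])
    fix y assume "y \<in> set_pmf (bind_pmf p (\<lambda>x. rand_play I act (X' x) (k' x) (t' x) (U x) (m' x)))"
    then obtain x where x: "x \<in> set_pmf p"
        "y \<in> set_pmf (rand_play I act (X' x) (k' x) (t' x) (U x) (m' x))"
      unfolding set_bind_pmf by blast
    show "0 \<le> fst y \<and> fst y \<le> (\<Sum>j\<in>opts I. reward I j)"
      using rand_play_bounds[OF assms(1) assms(2)[OF x(1)] x(2)] *[OF x(1)] by linarith
  qed
qed

lemma val_split:
  assumes "admissible act" "U \<subseteq> opts I" "a \<in> U"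
  shows "val I act X k t U m
    = measure_pmf.expectation (X a) (\<lambda>x. val I act (X(a := return_pmf x)) k t U m)"
  by (rule val_bind[OF assms(1)], use assms in blast, rule rand_play_split)
    (use assms in \<open>auto intro: finite_subset\<close>)

text \<open>The Bellman equation of a fixed rule: \<open>rand_play_step\<close> followed by total
  expectation, with the random reward of the epoch replaced by its mean
  \<open>exp_reward\<close>.\<close>

lemma val_step:
  assumes "admissible act" "U \<subseteq> opts I"
    and "\<And>e. e \<in> set_pmf (Pi_pmf U 0 X) \<Longrightarrow> act m t {j \<in> U. e j > t} = q"
  shows "val I act X (Suc k) t U m = measure_pmf.expectation q (\<lambda>(d, m'). case d of
      None \<Rightarrow> val I act X k (t + 1) U m'
    | Some j \<Rightarrow> exp_reward I j t
        + measure_pmf.expectation (eval_dist I j) (\<lambda>x. val I act X k (t + x) (U - {j}) m'))"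
proof -
  have fin: "finite U" using assms(2) by (rule finite_subset) simp
  have nn: "\<And>j. j \<in> opts I \<Longrightarrow> 0 \<le> reward I j" using reward_pos by (auto intro: less_imp_le)
  let ?g = "\<lambda>j x. \<lambda>(w, m''). ((if t + x \<le> deadline I j then reward I j else 0) + w, m'' :: 'a)"
  let ?Q = "\<lambda>j m'. bind_pmf (eval_dist I j) (\<lambda>x. map_pmf (?g j x) (rand_play I act X k (t + x) (U - {j}) m'))"
  let ?F = "\<lambda>(d, m'). case d of None \<Rightarrow> rand_play I act X k (t + 1) U m' | Some j \<Rightarrow> ?Q j m'"
  have eq: "rand_play I act X (Suc k) t U m = bind_pmf q ?F"
    by (rule rand_play_step[OF assms(1) fin assms(3)])
  have b: "0 \<le> fst y \<and> fst y \<le> (\<Sum>j\<in>U. reward I j)" if "y \<in> set_pmf (bind_pmf q ?F)" for y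
    using rand_play_bounds[OF assms(1,2)] that unfolding eq[symmetric] by blast
  have "val I act X (Suc k) t U m = measure_pmf.expectation q (\<lambda>z. measure_pmf.expectation (?F z) fst)"
    unfolding val_def eq by (rule expectation_bind_pmf[OF b])
  also have "\<dots> = measure_pmf.expectation q (\<lambda>(d, m'). case d of
      None \<Rightarrow> val I act X k (t + 1) U m'
    | Some j \<Rightarrow> exp_reward I j t
        + measure_pmf.expectation (eval_dist I j) (\<lambda>x. val I act X k (t + x) (U - {j}) m'))"
  proof (rule expectation_pmf_cong)
    fix z assume z: "z \<in> set_pmf q"
    obtain d m' where dm: "z = (d, m')" by fastforce
    obtain e0 where e0: "e0 \<in> set_pmf (Pi_pmf U 0 X)" by (meson ex_in_conv set_pmf_not_empty)
    show "measure_pmf.expectation (?F z) fst = (case z of (d, m') \<Rightarrow> case d of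
        None \<Rightarrow> val I act X k (t + 1) U m'
      | Some j \<Rightarrow> exp_reward I j t
          + measure_pmf.expectation (eval_dist I j) (\<lambda>x. val I act X k (t + x) (U - {j}) m'))"
    proof (cases d)
      case None
      then show ?thesis by (simp add: dm val_def)
    next
      case (Some j)
      have j: "j \<in> U"
        using admissibleD[OF assms(1), of j m' m t "{j \<in> U. e0 j > t}"] z dm Some assms(3)[OF e0] by auto
      then have jo: "j \<in> opts I" using assms(2) by blast
      have "measure_pmf.expectation (?Q j m') fst
          = measure_pmf.expectation (eval_dist I j) (\<lambda>x.
              measure_pmf.expectation (map_pmf (?g j x) (rand_play I act X k (t + x) (U - {j}) m')) fst)"
        by (rule expectation_bind_pmf[where B = "\<Sum>j\<in>U. reward I j"], rule b)
          (use z dm Some in force)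
      also have "\<dots> = measure_pmf.expectation (eval_dist I j) (\<lambda>x.
          (if t + x \<le> deadline I j then reward I j else 0) + val I act X k (t + x) (U - {j}) m')"
      proof (rule expectation_pmf_cong)
        fix x
        have "integrable (measure_pmf (rand_play I act X k (t + x) (U - {j}) m')) fst"
          by (rule integrable_pmf_bounded, rule rand_play_bounds[OF assms(1)]) (use assms(2) in auto)
        then show "measure_pmf.expectation (map_pmf (?g j x) (rand_play I act X k (t + x) (U - {j}) m')) fst
            = (if t + x \<le> deadline I j then reward I j else 0) + val I act X k (t + x) (U - {j}) m'"
          by (simp add: val_def case_prod_unfold)
      qed
      also have "\<dots> = exp_reward I j t
          + measure_pmf.expectation (eval_dist I j) (\<lambda>x. val I act X k (t + x) (U - {j}) m')"
        by (subst Bochner_Integration.integral_add)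
          (simp_all add: integrable_eval[OF jo] exp_reward_eq[OF jo])
      finally show ?thesis by (simp add: dm Some)
    qed
  qed
  finally show ?thesis .
qed

lemma val_subset:
  assumes "admissible act" "U \<subseteq> opts I" "U' \<subseteq> U"
    and "\<And>e j. e \<in> set_pmf (Pi_pmf U 0 X) \<Longrightarrow> j \<in> U - U' \<Longrightarrow> e j \<le> t"
  shows "val I act X k t U m = val I act X k t U' m"
proof -
  have "finite U" using assms(2) by (rule finite_subset) simp
  from rand_play_subset[OF assms(1) this assms(3)] assms(4)
  have "rand_play I act X k t U m = rand_play I act X k t U' m" by blast
  then show ?thesis by (simp add: val_def)
qed

lemma val_cong: "(\<And>j. j \<in> U \<Longrightarrow> X j = X' j) \<Longrightarrow> val I act X k t U m = val I act X' k t U m"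
  unfolding val_def by (subst rand_play_cong) auto

end

section \<open>Index policies and the greedy policy\<close>

text \<open>Ties are broken by number so that the best option is unique. The product over better
  options in \<open>option_price\<close> uses the same order.\<close>

definition before :: "(nat \<Rightarrow> real) \<Rightarrow> nat \<Rightarrow> nat \<Rightarrow> bool" where
  "before f i j \<longleftrightarrow> f j < f i \<or> (f i = f j \<and> i < j)"

definition top_of :: "(nat \<Rightarrow> real) \<Rightarrow> nat set \<Rightarrow> nat \<Rightarrow> bool" where
  "top_of f A a \<longleftrightarrow> a \<in> A \<and> (\<forall>i\<in>A. i \<noteq> a \<longrightarrow> before f a i)"

definition pick :: "(nat \<Rightarrow> real) \<Rightarrow> nat set \<Rightarrow> nat option" where
  "pick f A = (if \<exists>a. top_of f A a \<and> f a > 0 then Some (SOME a. top_of f A a \<and> f a > 0) else None)"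

definition index_rule :: "(nat \<Rightarrow> nat \<Rightarrow> real) \<Rightarrow> unit rule" where
  "index_rule f m t A = return_pmf (pick (\<lambda>j. f j t) A, ())"

lemma top_of_le: "top_of f A a \<Longrightarrow> i \<in> A \<Longrightarrow> f i \<le> f a"
  unfolding top_of_def before_def by (cases "i = a") auto

lemma top_of_unique: "top_of f A a \<Longrightarrow> top_of f A b \<Longrightarrow> a = b"
  unfolding top_of_def before_def by (rule ccontr) (metis order.asym)

lemma pick_Some_iff: "pick f A = Some a \<longleftrightarrow> top_of f A a \<and> f a > 0"
proof
  assume "pick f A = Some a"
  then have "\<exists>b. top_of f A b \<and> f b > 0" "a = (SOME b. top_of f A b \<and> f b > 0)"
    by (auto simp: pick_def split: if_splits)
  then show "top_of f A a \<and> f a > 0" using someI_ex by metis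
next
  assume a: "top_of f A a \<and> f a > 0"
  then have "(SOME b. top_of f A b \<and> f b > 0) = a"
    by (intro some_equality) (auto intro: top_of_unique)
  with a show "pick f A = Some a" by (auto simp: pick_def)
qed

text \<open>Among the maximizers of \<open>f\<close>, the one with the smallest number is on
  top.\<close>

lemma ex_top_of:
  assumes "finite A" "A \<noteq> {}"
  shows "\<exists>a. top_of f A a"
proof -
  let ?P = "\<lambda>j. j \<in> A \<and> (\<forall>i\<in>A. f i \<le> f j)"
  have "Max (f ` A) \<in> f ` A" using assms by (intro Max_in) auto
  then obtain b where "b \<in> A" "f b = Max (f ` A)" by auto
  then have "?P b" using assms by simp
  then have P: "?P (LEAST j. ?P j)" by (rule LeastI)
  have "before f (LEAST j. ?P j) i" if i: "i \<in> A" "i \<noteq> (LEAST j. ?P j)" for i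
  proof (cases "?P i")
    case True
    then have "(LEAST j. ?P j) \<le> i" by (rule Least_le)
    then show ?thesis using True i P by (force simp: before_def)
  next
    case False
    then have "\<exists>i'\<in>A. f i < f i'" using i by (simp add: not_le)
    then show ?thesis using P by (force simp: before_def)
  qed
  with P show ?thesis unfolding top_of_def by blast
qed

lemma pick_None_iff: "finite A \<Longrightarrow> pick f A = None \<longleftrightarrow> (\<forall>j\<in>A. f j \<le> 0)"
proof
  assume "finite A" "pick f A = None"
  then show "\<forall>j\<in>A. f j \<le> 0"
    using ex_top_of[of A f] top_of_le[of f A] by (force simp: pick_def not_less split: if_splits)
next
  assume "\<forall>j\<in>A. f j \<le> 0"
  then show "pick f A = None" by (fastforce simp: pick_def top_of_def)
qed

lemma pick_mem: "pick f A = Some a \<Longrightarrow> a \<in> A"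
  by (simp add: pick_Some_iff top_of_def)

lemma admissible_index_rule [simp]: "admissible (index_rule f)"
  unfolding admissible_def index_rule_def by (auto dest: pick_mem) (metis not_None_eq pick_mem imageI)

section \<open>The greedy policy for identically distributed evaluation times\<close>

context sse_inst
begin

text \<open>Drawing all expiration times first reduces a comparison of rules to fixed expiration
  times, with only evaluation times left random.\<close>

lemma rand_play_fix_exp:
  assumes "admissible act" "U \<subseteq> opts I"
  shows "rand_play I act X k t U m
    = bind_pmf (Pi_pmf U 0 X) (\<lambda>e. rand_play I act (\<lambda>j. return_pmf (e j)) k t U m)"
proof -
  have U: "finite U" using assms(2) by (rule finite_subset) simp
  have "play I act s e k t U m = play I act s (\<lambda>x. if x \<in> U then e x else 0) k t U m" for s e
    by (rule play_cong[OF assms(1)]) simp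
  then show ?thesis
    unfolding rand_play_def Pi_pmf_return_pmf[OF U] bind_return_pmf
    by (subst bind_commute_pmf) simp
qed

text \<open>With point masses the available set is the same in every realization, so
  \<open>val_step\<close> applies to every admissible rule.\<close>

lemma val_step_fixed:
  assumes "admissible act" "U \<subseteq> opts I"
  shows "val I act (\<lambda>j. return_pmf (e j)) (Suc k) t U m
    = measure_pmf.expectation (act m t {j \<in> U. e j > t}) (\<lambda>(d, m'). case d of
      None \<Rightarrow> val I act (\<lambda>j. return_pmf (e j)) k (t + 1) U m'
    | Some j \<Rightarrow> exp_reward I j t
        + measure_pmf.expectation (eval_dist I j)
            (\<lambda>x. val I act (\<lambda>j. return_pmf (e j)) k (t + x) (U - {j}) m'))"
proof (rule val_step[OF assms])
  fix e' assume "e' \<in> set_pmf (Pi_pmf U 0 (\<lambda>j. return_pmf (e j)))"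
  moreover have "finite U" using assms(2) by (rule finite_subset) simp
  ultimately have "{j \<in> U. e' j > t} = {j \<in> U. e j > t}" by auto
  then show "act m t {j \<in> U. e' j > t} = act m t {j \<in> U. e j > t}" by simp
qed

text \<open>The two rules see the same evaluation times: the \<open>l\<close>-th selection of either rule lasts equally
  long, so that the greedy rule is never behind the other one. Each selection of the other rule is
  charged to the simultaneous greedy selection or, through the last sum, to the earlier greedy
  selection of the same option.\<close>

lemma greedy_charging:
  fixes e :: "nat \<Rightarrow> nat"
  defines "X \<equiv> \<lambda>j. return_pmf (e j)"
  assumes "iid_eval_times I" "admissible act"
    and "t' \<le> t" "U \<subseteq> opts I" "U' \<subseteq> opts I" "max_deadline I \<le> t' + k'"
  shows "val I act X k t U m
    \<le> 2 * val I (index_rule (exp_reward I)) X k' t' U' () + (\<Sum>j\<in>U - U'. exp_reward I j t')"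
  using assms(4-)
proof (induction k arbitrary: t t' U U' m k')
  case 0
  have "0 \<le> (\<Sum>j\<in>U - U'. exp_reward I j t')"
    by (intro sum_nonneg exp_reward_nonneg) (use 0 in auto)
  with val_bounds(1)[OF admissible_index_rule 0(3)] show ?case by simp
next
  case (Suc k)
  let ?gr = "index_rule (exp_reward I)"
  let ?A = "{j \<in> U. e j > t}" and ?A' = "{j \<in> U'. e j > t'}"
  let ?R = "2 * val I ?gr X k' t' U' () + (\<Sum>j\<in>U - U'. exp_reward I j t')"
  note vb = val_bounds[OF assms(3)]
  have fin: "finite U" "finite U'" using Suc.prems(2,3) finite_subset finite_opts by blast+
  have nn: "0 \<le> val I act X k (t + x) (U - {j}) m'" for x j m'
    by (rule vb) (use Suc.prems in auto)
  have *: "0 \<le> (case d of None \<Rightarrow> val I act X k (t + 1) U m'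
      | Some j \<Rightarrow> exp_reward I j t + measure_pmf.expectation (eval_dist I j)
            (\<lambda>x. val I act X k (t + x) (U - {j}) m'))
      \<and> (case d of None \<Rightarrow> val I act X k (t + 1) U m'
      | Some j \<Rightarrow> exp_reward I j t + measure_pmf.expectation (eval_dist I j)
            (\<lambda>x. val I act X k (t + x) (U - {j}) m')) \<le> ?R"
    if dm: "(d, m') \<in> set_pmf (act m t ?A)" for d m'
  proof (cases d)
    case None
    \<comment> \<open>The other rule idles while the greedy state stays put: the greedy clock may
      lag behind, never run ahead.\<close>
    have "val I act X k (t + 1) U m' \<le> ?R" by (rule Suc.IH) (use Suc.prems in auto)
    then show ?thesis using None vb(1)[OF Suc.prems(2)] by simp
  next
    case (Some j)
    have j: "j \<in> U" "e j > t" using admissibleD[OF assms(3), of j m' m t ?A] dm Some by auto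
    then have jo: "j \<in> opts I" using Suc.prems by blast
    have rj: "exp_reward I j t \<le> exp_reward I j t'" by (rule exp_reward_antimono[OF jo Suc.prems(1)])
    let ?E = "measure_pmf.expectation (eval_dist I j) (\<lambda>x. val I act X k (t + x) (U - {j}) m')"
    have "0 \<le> exp_reward I j t + ?E"
      by (intro add_nonneg_nonneg exp_reward_nonneg[OF jo] Bochner_Integration.integral_nonneg nn)
    moreover have "exp_reward I j t + ?E \<le> ?R"
    \<comment> \<open>If greedy makes no selection at \<open>t'\<close>, its state is kept unchanged
      while the other rule proceeds.\<close>
    proof (cases "\<exists>g k''. pick (\<lambda>j. exp_reward I j t') ?A' = Some g \<and> k' = Suc k''")
      case True
      then obtain g k'' where g: "pick (\<lambda>j. exp_reward I j t') ?A' = Some g" and k': "k' = Suc k''"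
        by blast
      have gU: "g \<in> U'" using pick_mem[OF g] by simp
      then have go: "g \<in> opts I" using Suc.prems by blast
      \<comment> \<open>Identical distributions enter here: one variable \<open>x\<close> with this
        common law advances both clocks.\<close>
      have ed: "eval_dist I g = eval_dist I j" using assms(2) jo go unfolding iid_eval_times_def by blast
      let ?V = "\<lambda>x. val I ?gr X k'' (t' + x) (U' - {g}) ()"
      have gv: "val I ?gr X k' t' U' () = exp_reward I g t'
          + measure_pmf.expectation (eval_dist I j) ?V"
        unfolding k' X_def val_step_fixed[OF admissible_index_rule Suc.prems(3)]
        by (simp add: index_rule_def g ed)
      have "?E \<le> measure_pmf.expectation (eval_dist I j)
          (\<lambda>x. 2 * ?V x + (\<Sum>i\<in>(U - {j}) - (U' - {g}). exp_reward I i t'))"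
      proof (rule expectation_eval_mono[OF jo])
        fix x :: nat assume x: "1 \<le> x"
        have "val I act X k (t + x) (U - {j}) m'
            \<le> 2 * ?V x + (\<Sum>i\<in>(U - {j}) - (U' - {g}). exp_reward I i (t' + x))"
          by (rule Suc.IH) (use Suc.prems x k' in auto)
        also have "\<dots> \<le> 2 * ?V x + (\<Sum>i\<in>(U - {j}) - (U' - {g}). exp_reward I i t')"
          by (intro add_left_mono sum_mono exp_reward_antimono) (use Suc.prems in auto)
        finally show "val I act X k (t + x) (U - {j}) m'
            \<le> 2 * ?V x + (\<Sum>i\<in>(U - {j}) - (U' - {g}). exp_reward I i t')" .
      qed
      also have "\<dots> = 2 * measure_pmf.expectation (eval_dist I j) ?V
          + (\<Sum>i\<in>(U - {j}) - (U' - {g}). exp_reward I i t')"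
        by (subst Bochner_Integration.integral_add) (simp_all add: integrable_eval[OF jo])
      \<comment> \<open>Among the options left to the other rule but not to greedy, at most
        \<open>g\<close> is new. One of the two copies of \<open>exp_reward I g t'\<close> in twice
        the greedy value pays for it.\<close>
      also have "(\<Sum>i\<in>(U - {j}) - (U' - {g}). exp_reward I i t')
          \<le> (\<Sum>i\<in>insert g (U - U' - {j}). exp_reward I i t')"
        by (rule sum_mono2) (use fin Suc.prems go in \<open>auto intro: exp_reward_nonneg\<close>)
      also have "\<dots> = exp_reward I g t' + (\<Sum>i\<in>U - U' - {j}. exp_reward I i t')"
        using fin gU by (subst sum.insert) auto
      finally have E: "?E \<le> 2 * measure_pmf.expectation (eval_dist I j) ?V + exp_reward I g t'
          + (\<Sum>i\<in>U - U' - {j}. exp_reward I i t')" by simp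
      \<comment> \<open>The second copy pays for \<open>j\<close> if greedy could still have chosen
        \<open>j\<close>; otherwise \<open>j\<close> is paid by its own term in the sum.\<close>
      have "exp_reward I j t + (\<Sum>i\<in>U - U' - {j}. exp_reward I i t')
          \<le> exp_reward I g t' + (\<Sum>i\<in>U - U'. exp_reward I i t')"
      proof (cases "j \<in> U'")
        case True
        then have "U - U' - {j} = U - U'" by auto
        moreover have "exp_reward I j t' \<le> exp_reward I g t'"
          using g j True Suc.prems(1) by (auto simp: pick_Some_iff dest!: top_of_le)
        ultimately show ?thesis using rj by simp
      next
        case False
        then have "(\<Sum>i\<in>U - U'. exp_reward I i t')
            = exp_reward I j t' + (\<Sum>i\<in>U - U' - {j}. exp_reward I i t')"
          using j fin by (intro sum.remove) auto
        then show ?thesis using rj exp_reward_nonneg[OF go, of t'] by simp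
      qed
      with E gv show ?thesis by simp
    next
      case False
      have "?E \<le> measure_pmf.expectation (eval_dist I j)
          (\<lambda>x. 2 * val I ?gr X k' t' U' () + (\<Sum>i\<in>U - {j} - U'. exp_reward I i t'))"
        by (intro expectation_eval_mono[OF jo] Suc.IH) (use Suc.prems in auto)
      then have E: "?E \<le> 2 * val I ?gr X k' t' U' () + (\<Sum>i\<in>U - {j} - U'. exp_reward I i t')"
        by simp
      have "exp_reward I j t + (\<Sum>i\<in>U - {j} - U'. exp_reward I i t')
          \<le> (\<Sum>i\<in>U - U'. exp_reward I i t')"
      proof (cases "j \<in> U'")
        case True
        \<comment> \<open>Either no greedy epoch is left, so that \<open>t'\<close> is past all
          deadlines, or \<open>j\<close> was available to greedy and rejected because nothing had
          positive index.\<close>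
        have "exp_reward I j t' \<le> 0"
        proof (cases k')
          case 0
          then show ?thesis using exp_reward_late[OF jo] Suc.prems(4) by simp
        next
          case (Suc k'')
          then have "pick (\<lambda>j. exp_reward I j t') ?A' = None" using False by auto
          then show ?thesis using True j Suc.prems(1) fin by (subst (asm) pick_None_iff) auto
        qed
        moreover have "U - {j} - U' = U - U'" using True by auto
        ultimately show ?thesis using rj by simp
      next
        case False
        moreover have "U - {j} - U' = U - U' - {j}" by auto
        ultimately show ?thesis
          using j fin rj sum.remove[of "U - U'" j "\<lambda>i. exp_reward I i t'"] by simp
      qed
      with E show ?thesis by simp
    qed
    ultimately show ?thesis using Some by simp
  qed
  show ?case unfolding val_step_fixed[OF assms(3) Suc.prems(2), of e k t m, folded X_def]
  proof (rule expectation_pmf_bounds(2))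
    fix z assume "z \<in> set_pmf (act m t ?A)"
    then show "0 \<le> (case z of (d, m') \<Rightarrow> case d of None \<Rightarrow> val I act X k (t + 1) U m'
      | Some j \<Rightarrow> exp_reward I j t + measure_pmf.expectation (eval_dist I j)
            (\<lambda>x. val I act X k (t + x) (U - {j}) m'))
      \<and> (case z of (d, m') \<Rightarrow> case d of None \<Rightarrow> val I act X k (t + 1) U m'
      | Some j \<Rightarrow> exp_reward I j t + measure_pmf.expectation (eval_dist I j)
            (\<lambda>x. val I act X k (t + x) (U - {j}) m')) \<le> ?R"
      using * by (cases z) simp
  qed
qed

text \<open>Apply \<open>greedy_charging\<close> to each vector of expiration times, with equal
  initial states and hence an empty sum, and average.\<close>

lemma greedy_half:
  assumes "iid_eval_times I" "admissible act"
  shows "expected_value I act m \<le> 2 * expected_value I (index_rule (exp_reward I)) ()"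
proof -
  let ?D = "max_deadline I" and ?gr = "index_rule (exp_reward I)" and ?X = "\<lambda>e j. return_pmf (e j :: nat)"
  have fix': "val I ?gr (exp_dist I) ?D 1 (opts I) m
      = measure_pmf.expectation (Pi_pmf (opts I) 0 (exp_dist I)) (\<lambda>e. val I ?gr (?X e) ?D 1 (opts I) m)"
    for m
    by (rule val_bind) (auto intro: rand_play_fix_exp)
  have "expected_value I act m \<le> measure_pmf.expectation (Pi_pmf (opts I) 0 (exp_dist I))
      (\<lambda>e. 2 * val I ?gr (?X e) ?D 1 (opts I) ())"
    unfolding expected_value_eq_val
  proof (subst val_bind[OF assms(2) _ rand_play_fix_exp[OF assms(2)]],
      simp, simp, rule expectation_pmf_mono[where B = "2 * (\<Sum>j\<in>opts I. reward I j)"])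
    fix e
    show "0 \<le> val I act (?X e) ?D 1 (opts I) m" by (rule val_bounds[OF assms(2)]) simp
    show "val I act (?X e) ?D 1 (opts I) m \<le> 2 * val I ?gr (?X e) ?D 1 (opts I) ()"
      using greedy_charging[OF assms, of 1 1 "opts I" "opts I" ?D e ?D m] by simp
    show "2 * val I ?gr (?X e) ?D 1 (opts I) () \<le> 2 * (\<Sum>j\<in>opts I. reward I j)"
      using val_bounds(2)[OF admissible_index_rule, of "opts I"] by simp
  qed
  also have "\<dots> = 2 * expected_value I ?gr ()"
    unfolding expected_value_eq_val fix' by simp
  finally show ?thesis .
qed

end

section \<open>The price-directed policy\<close>

text \<open>In the notation of the introduction, \<open>option_price\<close> is \<open>C\<^sub>j(t)\<close> and \<open>score\<close> is the index of the
  option. The first sum in \<open>score\<close> is \<open>E h(t + S\<^sub>j)\<close>, cut off at the largest deadline, from which on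
  all prices vanish.\<close>

function option_price :: "sse \<Rightarrow> nat \<Rightarrow> nat \<Rightarrow> real" and score :: "sse \<Rightarrow> nat \<Rightarrow> nat \<Rightarrow> real" where
  "option_price I j t = (if t < max_deadline I
     then option_price I j (Suc t) + tail_prob (exp_dist I j) t * max 0 (score I j t)
       * (\<Prod>i\<in>{i \<in> opts I. before (\<lambda>i. score I i t) i j}. 1 - tail_prob (exp_dist I i) t)
     else 0)"
| "score I j t = (if t < max_deadline I
     then exp_reward I j t
       + (\<Sum>s<max_deadline I - t. (tail_prob (eval_dist I j) s - tail_prob (eval_dist I j) (Suc s))
           * (\<Sum>i\<in>opts I. option_price I i (t + Suc s)))
       - (\<Sum>i\<in>opts I. option_price I i (Suc t))
       - option_price I j (Suc t) / tail_prob (exp_dist I j) t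
     else 0)"
  by pat_completeness auto
termination
  by (relation "Wellfounded.measure (\<lambda>x. case x of Inl (I, j, t) \<Rightarrow> Suc (2 * (max_deadline I - t))
        | Inr (I, j, t) \<Rightarrow> 2 * (max_deadline I - t))") auto

declare option_price.simps [simp del] score.simps [simp del]

definition time_price :: "sse \<Rightarrow> nat \<Rightarrow> real" where
  "time_price I t = (\<Sum>i\<in>opts I. option_price I i t)"

text \<open>For \<open>N = opts I\<close> this is the increment of \<open>option_price\<close> from
  \<open>t + 1\<close> to \<open>t\<close>. Smaller \<open>N\<close> occur because only options not
  yet examined compete.\<close>

definition share :: "sse \<Rightarrow> nat set \<Rightarrow> nat \<Rightarrow> nat \<Rightarrow> real" where
  "share I N t j = tail_prob (exp_dist I j) t * max 0 (score I j t)
     * (\<Prod>i\<in>{i \<in> N. before (\<lambda>i. score I i t) i j}. 1 - tail_prob (exp_dist I i) t)"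

lemma tail_prob_bounds: "0 \<le> tail_prob X t" "tail_prob X t \<le> 1"
  by (simp_all add: tail_prob_def)

text \<open>Recovers point masses from the tail table; \<open>score\<close> averages over evaluation
  times in this way.\<close>

lemma tail_prob_diff: "tail_prob X s - tail_prob X (Suc s) = pmf X (Suc s)"
proof -
  have "{x. x > s} = {x. x > Suc s} \<union> {Suc s}" by auto
  then have "tail_prob X s = tail_prob X (Suc s) + measure_pmf.prob X {Suc s}"
    unfolding tail_prob_def by (subst measure_pmf.finite_measure_Union[symmetric]) auto
  then show ?thesis by (simp add: measure_pmf_single)
qed

lemma option_price_Suc:
  "t < max_deadline I \<Longrightarrow> option_price I j t = option_price I j (Suc t) + share I (opts I) t j"
  by (subst option_price.simps) (simp add: share_def)

lemma option_price_late [simp]: "max_deadline I \<le> t \<Longrightarrow> option_price I j t = 0"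
  by (subst option_price.simps) simp

lemma time_price_late [simp]: "max_deadline I \<le> t \<Longrightarrow> time_price I t = 0"
  by (simp add: time_price_def)

lemma score_late [simp]: "max_deadline I \<le> t \<Longrightarrow> score I j t = 0"
  by (subst score.simps) simp

lemma share_nonneg: "0 \<le> share I N t j"
  unfolding share_def by (intro mult_nonneg_nonneg prod_nonneg) (auto simp: tail_prob_bounds)

text \<open>Removing competitors only removes factors that lie between 0 and 1.\<close>

lemma share_antimono:
  assumes "finite N" "N' \<subseteq> N"
  shows "share I N t j \<le> share I N' t j"
proof -
  let ?A = "\<lambda>N. {i \<in> N. before (\<lambda>i. score I i t) i j}"
  let ?p = "\<lambda>i. 1 - tail_prob (exp_dist I i) t"
  have "prod ?p (?A N) = prod ?p (?A N') * prod ?p (?A N - ?A N')"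
    using assms by (subst prod.subset_diff[of "?A N'"]) (auto simp: mult.commute)
  also have "\<dots> \<le> prod ?p (?A N')"
    by (intro mult_right_le_one_le prod_nonneg prod_le_1) (auto simp: tail_prob_bounds)
  finally show ?thesis
    unfolding share_def by (intro mult_left_mono mult_nonneg_nonneg) (auto simp: tail_prob_bounds)
qed

lemma option_price_antimono:
  assumes "t \<le> t'"
  shows "option_price I j t' \<le> option_price I j t"
  using assms
proof (induction rule: dec_induct)
  case (step s)
  have "option_price I j (Suc s) \<le> option_price I j s"
    using share_nonneg[of I "opts I" s j] by (cases "s < max_deadline I") (simp_all add: option_price_Suc)
  with step show ?case by simp
qed simp

lemma option_price_nonneg: "0 \<le> option_price I j t"
  using option_price_antimono[of t "max t (max_deadline I)" I j] by simp

lemma time_price_antimono: "t \<le> t' \<Longrightarrow> time_price I t' \<le> time_price I t"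
  unfolding time_price_def by (intro sum_mono option_price_antimono)

lemma time_price_nonneg: "0 \<le> time_price I t"
  unfolding time_price_def by (intro sum_nonneg option_price_nonneg)

text \<open>Conditions on the best option: if alive, it contributes its whole positive score; if
  expired, the others compete without it. The same recursion governs the policy and the expected
  best score.\<close>

lemma share_remove_top:
  assumes "finite N" "top_of (\<lambda>i. score I i t) N a"
  shows "(\<Sum>j\<in>N. share I N t j) = tail_prob (exp_dist I a) t * max 0 (score I a t)
    + (1 - tail_prob (exp_dist I a) t) * (\<Sum>j\<in>N - {a}. share I (N - {a}) t j)"
proof -
  have a: "a \<in> N" using assms(2) by (simp add: top_of_def)
  have asym: "\<not> before (\<lambda>i. score I i t) i a" if "i \<in> N" for i
    using assms(2) that unfolding top_of_def before_def by force
  have "{i \<in> N. before (\<lambda>i. score I i t) i a} = {}" using asym by blast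
  then have "share I N t a = tail_prob (exp_dist I a) t * max 0 (score I a t)"
    by (simp only: share_def prod.empty mult_1_right)
  moreover have "share I N t j = (1 - tail_prob (exp_dist I a) t) * share I (N - {a}) t j"
    if "j \<in> N - {a}" for j
  proof -
    have "{i \<in> N. before (\<lambda>i. score I i t) i j}
        = insert a {i \<in> N - {a}. before (\<lambda>i. score I i t) i j}"
      using assms(2) that a by (auto simp: top_of_def)
    then show ?thesis using assms(1) by (simp add: share_def)
  qed
  ultimately show ?thesis
    using assms(1) a by (simp add: sum.remove sum_distrib_left)
qed

definition best_score :: "sse \<Rightarrow> nat \<Rightarrow> nat set \<Rightarrow> real" where
  "best_score I t A = Max (insert 0 ((\<lambda>j. score I j t) ` A))"

lemma best_score_nonneg: "finite A \<Longrightarrow> 0 \<le> best_score I t A"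
  by (simp add: best_score_def)

lemma best_score_ge: "finite A \<Longrightarrow> j \<in> A \<Longrightarrow> score I j t \<le> best_score I t A"
  by (simp add: best_score_def)

lemma best_score_mono: "finite A \<Longrightarrow> B \<subseteq> A \<Longrightarrow> best_score I t B \<le> best_score I t A"
  unfolding best_score_def by (intro Max_mono) auto

lemma best_score_top: "finite A \<Longrightarrow> top_of (\<lambda>i. score I i t) A a \<Longrightarrow> best_score I t A = max 0 (score I a t)"
proof -
  assume *: "finite A" "top_of (\<lambda>i. score I i t) A a"
  have "\<forall>j\<in>A. score I j t \<le> score I a t" using top_of_le[OF *(2)] by blast
  moreover have "a \<in> A" using *(2) by (simp add: top_of_def)
  ultimately show ?thesis
    unfolding best_score_def using *(1) by (intro Max_eqI) (auto simp: max_def intro: order_trans)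
qed

section \<open>Price identities and the value of the price-directed policy\<close>

context sse_inst
begin

text \<open>Prices vanish from the largest deadline on, so the expectation is the finite sum that
  appears in \<open>score\<close>.\<close>

lemma expectation_time_price:
  assumes "j \<in> opts I" "t < max_deadline I"
  shows "measure_pmf.expectation (eval_dist I j) (\<lambda>x. time_price I (t + x))
    = (\<Sum>s<max_deadline I - t. (tail_prob (eval_dist I j) s - tail_prob (eval_dist I j) (Suc s))
        * time_price I (t + Suc s))"
proof -
  let ?n = "max_deadline I - t"
  have "measure_pmf.expectation (eval_dist I j) (\<lambda>x. time_price I (t + x))
      = (\<Sum>x\<in>Suc ` {..<?n}. time_price I (t + x) * pmf (eval_dist I j) x)"
  proof (rule integral_measure_pmf_real)
    fix x assume x: "x \<in> set_pmf (eval_dist I j)" "time_price I (t + x) \<noteq> 0"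
    then have "1 \<le> x" "t + x < max_deadline I"
      using eval_pos[OF assms(1)] time_price_late[of I "t + x"] by (auto simp: not_le[symmetric])
    then show "x \<in> Suc ` {..<?n}" by (intro image_eqI[of _ _ "x - 1"]) auto
  qed simp
  also have "\<dots> = (\<Sum>s<?n. (tail_prob (eval_dist I j) s - tail_prob (eval_dist I j) (Suc s))
        * time_price I (t + Suc s))"
    by (subst sum.reindex) (simp_all add: tail_prob_diff mult.commute)
  finally show ?thesis .
qed

text \<open>The definition of \<open>score\<close> solved for what a selection of \<open>j\<close>
  brings, in the form used by both the lower and the upper bound.\<close>

lemma score_eq:
  assumes "j \<in> opts I" "t < max_deadline I"
  shows "exp_reward I j t + measure_pmf.expectation (eval_dist I j) (\<lambda>x. time_price I (t + x))
    = score I j t + time_price I (Suc t) + option_price I j (Suc t) / tail_prob (exp_dist I j) t"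
  unfolding expectation_time_price[OF assms] using assms(2)
  by (subst score.simps) (simp add: time_price_def)

text \<open>Options are examined by decreasing score until one is found alive and selected. Hence an option is
  examined only once, and the expiration times of the remaining options \<open>N\<close> keep their unconditional
  distributions.\<close>

lemma val_score_rule_ge_step:
  assumes t: "1 \<le> t" "t < max_deadline I" and N: "N \<subseteq> opts I"
    and IH: "\<And>t' M. 1 \<le> t' \<Longrightarrow> max_deadline I \<le> t' + k \<Longrightarrow> M \<subseteq> opts I \<Longrightarrow>
      (\<Sum>j\<in>M. option_price I j t') \<le> val I (index_rule (score I)) (exp_dist I) k t' M ()"
    and k: "max_deadline I \<le> t + Suc k"
  shows "(\<Sum>j\<in>N. option_price I j (Suc t)) + (\<Sum>j\<in>N. share I N t j)
    \<le> val I (index_rule (score I)) (exp_dist I) (Suc k) t N ()"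
proof -
  have "finite N" using N by (rule finite_subset) simp
  then show ?thesis using N
  \<comment> \<open>This inner induction follows the examination of options within one epoch: an
    expired top option is removed without any time passing.\<close>
  proof (induction rule: finite_psubset_induct)
    case (psubset N)
    let ?gr = "index_rule (score I)" and ?f = "\<lambda>j. score I j t"
    show ?case
    proof (cases "N = {}")
      case True
      then show ?thesis using val_bounds(1)[OF admissible_index_rule psubset.prems] by simp
    next
      case False
      then obtain a where a: "top_of ?f N a" using ex_top_of psubset.hyps by blast
      then have aN: "a \<in> N" and ao: "a \<in> opts I" using psubset.prems by (auto simp: top_of_def)
      show ?thesis
      proof (cases "score I a t > 0")
        case False
        \<comment> \<open>Without a positive score the rule idles whatever has expired, and all
          shares are zero.\<close>
        then have neg: "score I j t \<le> 0" if "j \<in> N" for j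
          using top_of_le[OF a that] by simp
        have "pick ?f {j \<in> N. e j > t} = None" for e :: "nat \<Rightarrow> nat"
          using neg psubset.hyps by (subst pick_None_iff) auto
        then have "val I ?gr (exp_dist I) (Suc k) t N () = val I ?gr (exp_dist I) k (t + 1) N ()"
          by (subst val_step[where q = "return_pmf (None, ())"])
            (use psubset.prems in \<open>auto simp: index_rule_def\<close>)
        moreover have "(\<Sum>j\<in>N. option_price I j (t + 1)) \<le> val I ?gr (exp_dist I) k (t + 1) N ()"
          by (rule IH) (use k psubset.prems in auto)
        moreover have "(\<Sum>j\<in>N. share I N t j) = 0"
          by (intro sum.neutral) (simp add: share_def neg max_absorb1)
        ultimately show ?thesis by simp
      next
        case True
        let ?p = "tail_prob (exp_dist I a) t"
        let ?S = "\<Sum>j\<in>N - {a}. option_price I j (Suc t)"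
        let ?X = "\<lambda>x. (exp_dist I)(a := return_pmf x)"
        \<comment> \<open>\<open>sel\<close> and \<open>dead\<close> are the values once
          \<open>a\<close> turns out alive or expired. In the second case the same epoch continues
          with \<open>N - {a}\<close>, hence \<open>Suc k\<close> and \<open>t\<close> in
          \<open>dead\<close>.\<close>
        define sel where "sel = exp_reward I a t + measure_pmf.expectation (eval_dist I a)
            (\<lambda>y. val I ?gr (exp_dist I) k (t + y) (N - {a}) ())"
        define dead where "dead = val I ?gr (exp_dist I) (Suc k) t (N - {a}) ()"
        have fin: "finite N" by (rule psubset.hyps)
        have "val I ?gr (?X x) (Suc k) t N () = (if t < x then sel else dead)" for x
        proof (cases "t < x")
          case alive: True
          have "pick ?f {j \<in> N. e j > t} = Some a" if "e \<in> set_pmf (Pi_pmf N 0 (?X x))" for e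
          proof -
            have "e a = x" using that aN fin by (auto simp: set_Pi_pmf PiE_dflt_def)
            then show ?thesis using a True alive by (auto simp: pick_Some_iff top_of_def)
          qed
          then have "val I ?gr (?X x) (Suc k) t N () = exp_reward I a t
              + measure_pmf.expectation (eval_dist I a) (\<lambda>y. val I ?gr (?X x) k (t + y) (N - {a}) ())"
            by (subst val_step[where q = "return_pmf (Some a, ())"])
              (use psubset.prems in \<open>auto simp: index_rule_def\<close>)
          moreover have "val I ?gr (?X x) k (t + y) (N - {a}) ()
              = val I ?gr (exp_dist I) k (t + y) (N - {a}) ()" for y
            by (rule val_cong) auto
          ultimately show ?thesis using alive by (simp add: sel_def)
        next
          case expired: False
          have "val I ?gr (?X x) (Suc k) t N () = val I ?gr (?X x) (Suc k) t (N - {a}) ()"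
          proof (rule val_subset)
            fix e j assume "e \<in> set_pmf (Pi_pmf N 0 (?X x))" "j \<in> N - (N - {a})"
            then have "e j = x" using aN fin by (auto simp: set_Pi_pmf PiE_dflt_def)
            then show "e j \<le> t" using expired by simp
          qed (use psubset.prems in auto)
          also have "\<dots> = dead" unfolding dead_def by (rule val_cong) auto
          finally show ?thesis using expired by simp
        qed
        then have v: "val I ?gr (exp_dist I) (Suc k) t N () = ?p * sel + (1 - ?p) * dead"
          using psubset.prems aN
          by (subst val_split[of _ _ a]) (simp_all add: expectation_if_prob tail_prob_def)
        have p: "0 < ?p" by (rule exp_tail_pos[OF ao t(1)])
        have "score I a t + option_price I a (Suc t) / ?p + ?S
            = exp_reward I a t + measure_pmf.expectation (eval_dist I a)
                (\<lambda>y. time_price I (t + y) - time_price I (Suc t) + ?S)"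
        proof -
          have "measure_pmf.expectation (eval_dist I a)
                (\<lambda>y. time_price I (t + y) - time_price I (Suc t) + ?S)
              = measure_pmf.expectation (eval_dist I a) (\<lambda>y. time_price I (t + y))
                + (- time_price I (Suc t) + ?S)"
            using Bochner_Integration.integral_add[of "measure_pmf (eval_dist I a)"
                "\<lambda>y. time_price I (t + y)" "\<lambda>_. - time_price I (Suc t) + ?S"]
            by (simp add: integrable_eval[OF ao] algebra_simps)
          then show ?thesis using score_eq[OF ao t(2)] by simp
        qed
        also have "\<dots> \<le> sel"
          unfolding sel_def
        proof (intro add_left_mono expectation_eval_mono[OF ao])
          fix y :: nat assume y: "1 \<le> y"
          \<comment> \<open>While \<open>a\<close> is evaluated, the prices of the remaining options
            drop by at most what those of all options drop, and this larger drop is what the price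
            of time charges.\<close>
          have "(\<Sum>j\<in>N - {a}. option_price I j (Suc t) - option_price I j (t + y))
              \<le> (\<Sum>j\<in>opts I. option_price I j (Suc t) - option_price I j (t + y))"
            by (rule sum_mono2) (use psubset.prems y in \<open>auto intro: option_price_antimono\<close>)
          then have "time_price I (t + y) - time_price I (Suc t) + ?S
              \<le> (\<Sum>j\<in>N - {a}. option_price I j (t + y))"
            by (simp add: sum_subtractf time_price_def)
          also have "\<dots> \<le> val I ?gr (exp_dist I) k (t + y) (N - {a}) ()"
            by (rule IH) (use k t y psubset.prems in auto)
          finally show "time_price I (t + y) - time_price I (Suc t) + ?S
              \<le> val I ?gr (exp_dist I) k (t + y) (N - {a}) ()" .
        qed
        \<comment> \<open>Multiplication by the survival probability cancels the denominator, so
          that the price of \<open>a\<close> at \<open>Suc t\<close> reappears in full.\<close>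
        finally have "?p * (score I a t + option_price I a (Suc t) / ?p + ?S) \<le> ?p * sel"
          using p by simp
        moreover have "?S + (\<Sum>j\<in>N - {a}. share I (N - {a}) t j) \<le> dead"
          unfolding dead_def by (rule psubset.IH) (use aN psubset.prems in auto)
        then have "(1 - ?p) * (?S + (\<Sum>j\<in>N - {a}. share I (N - {a}) t j)) \<le> (1 - ?p) * dead"
          by (intro mult_left_mono) (simp_all add: tail_prob_bounds)
        moreover have "(\<Sum>j\<in>N. option_price I j (Suc t)) = option_price I a (Suc t) + ?S"
          by (rule sum.remove[OF fin aN])
        ultimately show ?thesis
          unfolding v share_remove_top[OF fin a] using p True
          by (simp add: algebra_simps)
      qed
    qed
  qed
qed

text \<open>The increments of \<open>option_price\<close> assume competition among all options, so
  by \<open>share_antimono\<close> they are at most the shares within \<open>N\<close>, which the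
  step lemma shows to be earned.\<close>

lemma val_score_rule_ge:
  assumes "1 \<le> t" "max_deadline I \<le> t + k" "N \<subseteq> opts I"
  shows "(\<Sum>j\<in>N. option_price I j t) \<le> val I (index_rule (score I)) (exp_dist I) k t N ()"
  using assms
proof (induction k arbitrary: t N)
  case 0
  then show ?case by simp
next
  case (Suc k)
  show ?case
  proof (cases "t < max_deadline I")
    case True
    have "(\<Sum>j\<in>N. option_price I j t) \<le> (\<Sum>j\<in>N. option_price I j (Suc t) + share I N t j)"
      using True Suc.prems(3) by (intro sum_mono) (simp add: option_price_Suc share_antimono)
    also have "\<dots> \<le> val I (index_rule (score I)) (exp_dist I) (Suc k) t N ()"
      using val_score_rule_ge_step[OF Suc.prems(1) True Suc.prems(3) Suc.IH Suc.prems(2)]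
      by (simp add: sum.distrib)
    finally show ?thesis .
  next
    case False
    then show ?thesis using val_bounds(1)[OF admissible_index_rule Suc.prems(3)] by simp
  qed
qed

lemma expectation_best_score_le:
  assumes "finite N"
  shows "measure_pmf.expectation (Pi_pmf N 0 (exp_dist I)) (\<lambda>e. best_score I t {j \<in> N. e j > t})
    \<le> (\<Sum>j\<in>N. share I N t j)"
  using assms
proof (induction rule: finite_psubset_induct)
  case (psubset N)
  let ?f = "\<lambda>j. score I j t"
  show ?case
  proof (cases "N = {}")
    case True
    then show ?thesis by (simp add: best_score_def)
  next
    case False
    then obtain a where a: "top_of ?f N a" using ex_top_of psubset.hyps by blast
    then have aN: "a \<in> N" by (simp add: top_of_def)
    have fin: "finite N" by (rule psubset.hyps)
    have N: "N = insert a (N - {a})" and f: "finite (N - {a})" using aN fin by auto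
    let ?p = "tail_prob (exp_dist I a) t" and ?P = "Pi_pmf (N - {a}) 0 (exp_dist I)"
    let ?B = "\<lambda>e. best_score I t {j \<in> N - {a}. e j > t}"
    have b: "0 \<le> best_score I t {j \<in> N. e j > t} \<and> best_score I t {j \<in> N. e j > t} \<le> best_score I t N"
      for e :: "nat \<Rightarrow> nat"
      by (intro conjI best_score_nonneg best_score_mono) (use fin in auto)
    have ins: "Pi_pmf N 0 (exp_dist I) = bind_pmf (exp_dist I a) (\<lambda>x. map_pmf (\<lambda>e. e(a := x)) ?P)"
      by (subst N, subst Pi_pmf_insert'[OF f]) (auto simp: map_pmf_def)
    have "measure_pmf.expectation (Pi_pmf N 0 (exp_dist I)) (\<lambda>e. best_score I t {j \<in> N. e j > t})
        = measure_pmf.expectation (exp_dist I a) (\<lambda>x. measure_pmf.expectation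
            (map_pmf (\<lambda>e. e(a := x)) ?P) (\<lambda>e. best_score I t {j \<in> N. e j > t}))"
      unfolding ins by (rule expectation_bind_pmf) (rule b)
    also have "\<dots> = measure_pmf.expectation (exp_dist I a) (\<lambda>x. if t < x then max 0 (score I a t)
        else measure_pmf.expectation ?P ?B)"
    proof (rule expectation_pmf_cong)
      fix x
      have "best_score I t {j \<in> N. (e(a := x)) j > t} = (if t < x then max 0 (score I a t) else ?B e)"
        for e :: "nat \<Rightarrow> nat"
      proof (cases "t < x")
        case True
        then have "top_of ?f {j \<in> N. (e(a := x)) j > t} a" using a by (auto simp: top_of_def)
        then show ?thesis using True fin by (subst best_score_top) auto
      next
        case False
        then have "{j \<in> N. (e(a := x)) j > t} = {j \<in> N - {a}. e j > t}" by auto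
        then show ?thesis using False by simp
      qed
      then show "measure_pmf.expectation
            (map_pmf (\<lambda>e. e(a := x)) ?P) (\<lambda>e. best_score I t {j \<in> N. e j > t})
          = (if t < x then max 0 (score I a t) else measure_pmf.expectation ?P ?B)"
        by simp
    qed
    also have "\<dots> = ?p * max 0 (score I a t) + (1 - ?p) * measure_pmf.expectation ?P ?B"
      unfolding expectation_if_prob by (simp add: tail_prob_def)
    also have "\<dots> \<le> ?p * max 0 (score I a t) + (1 - ?p) * (\<Sum>j\<in>N - {a}. share I (N - {a}) t j)"
      by (intro add_left_mono mult_left_mono psubset.IH) (use aN in \<open>auto simp: tail_prob_bounds\<close>)
    also have "\<dots> = (\<Sum>j\<in>N. share I N t j)" by (rule share_remove_top[OF fin a, symmetric])
    finally show ?thesis .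
  qed
qed

end

section \<open>An upper bound for online policies\<close>

definition alive_dist :: "sse \<Rightarrow> nat \<Rightarrow> nat \<Rightarrow> nat pmf" where
  "alive_dist I t j = cond_pmf (exp_dist I j) {x. t < x}"

text \<open>The sum runs over all remaining times, including those at which the decision-maker would
  be busy.\<close>

definition later_scores :: "sse \<Rightarrow> nat set \<Rightarrow> nat \<Rightarrow> (nat \<Rightarrow> nat) \<Rightarrow> real" where
  "later_scores I U t e = (\<Sum>\<tau>\<in>{t..<max_deadline I}. best_score I \<tau> {j \<in> U. e j > \<tau>})"

text \<open>A potential for the state in which exactly the options in \<open>A\<close> are
  unselected and alive at \<open>t\<close>. Option prices are unconditional; for an option known to
  be alive they are divided by the survival probability.\<close>

definition value_bound :: "sse \<Rightarrow> nat \<Rightarrow> nat set \<Rightarrow> real" where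
  "value_bound I t A = time_price I t + (\<Sum>j\<in>A. option_price I j t / tail_prob (exp_dist I j) t)
    + measure_pmf.expectation (Pi_pmf A 0 (alive_dist I t)) (later_scores I A t)"

lemma later_scores_mono:
  assumes "finite U" "U' \<subseteq> U" "t \<le> t'" "\<And>j. j \<in> U' \<Longrightarrow> e' j = e j"
  shows "later_scores I U' t' e' \<le> later_scores I U t e"
proof -
  have "later_scores I U' t' e' \<le> (\<Sum>\<tau>\<in>{t'..<max_deadline I}. best_score I \<tau> {j \<in> U. e j > \<tau>})"
    unfolding later_scores_def by (intro sum_mono best_score_mono) (use assms in auto)
  also have "\<dots> \<le> later_scores I U t e"
    unfolding later_scores_def
    by (intro sum_mono2) (use assms in \<open>auto intro: best_score_nonneg\<close>)
  finally show ?thesis .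
qed

lemma later_scores_bounds:
  assumes "finite U"
  shows "0 \<le> later_scores I U t e \<and> later_scores I U t e \<le> (\<Sum>\<tau>\<in>{t..<max_deadline I}. best_score I \<tau> U)"
  unfolding later_scores_def
  by (intro conjI sum_nonneg sum_mono best_score_nonneg best_score_mono) (use assms in auto)

section \<open>Survival laws and the Bellman inequality for the potential\<close>

context sse_inst
begin

lemma exp_dist_meets: "j \<in> opts I \<Longrightarrow> 1 \<le> t \<Longrightarrow> set_pmf (exp_dist I j) \<inter> {x. t < x} \<noteq> {}"
  using exp_tail_pos[of j t] unfolding tail_prob_def by (metis less_irrefl measure_pmf_zero_iff)

lemma alive_dist_gt: "j \<in> opts I \<Longrightarrow> 1 \<le> t \<Longrightarrow> x \<in> set_pmf (alive_dist I t j) \<Longrightarrow> t < x"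
  by (auto simp: alive_dist_def set_cond_pmf[OF exp_dist_meets])

lemma alive_dist_1: "j \<in> opts I \<Longrightarrow> alive_dist I 1 j = exp_dist I j"
  unfolding alive_dist_def
proof (rule cond_pmf_triv)
  assume "j \<in> opts I"
  then have "AE x in exp_dist I j. x \<in> {x. 1 < x}"
    using exp_tail_1[of j] unfolding tail_prob_def by (subst (asm) measure_pmf.prob_eq_1) auto
  then show "set_pmf (exp_dist I j) \<subseteq> {x. 1 < x}" by (auto simp: AE_measure_pmf_iff)
qed

lemma prob_alive_dist:
  assumes "j \<in> opts I" "1 \<le> t" "t \<le> t'"
  shows "measure_pmf.prob (alive_dist I t j) {x. t' < x}
    = tail_prob (exp_dist I j) t' / tail_prob (exp_dist I j) t"
  unfolding alive_dist_def tail_prob_def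
  by (rule prob_cond_pmf[OF exp_dist_meets]) (use assms in auto)

text \<open>\<open>Pi_pmf_resample\<close> for survival past \<open>t'\<close>; conditioning on
  survival past \<open>t\<close> and then past \<open>t'\<close> amounts to conditioning on the
  latter.\<close>

lemma alive_dist_resample:
  assumes "U \<subseteq> opts I" "1 \<le> t" "t \<le> t'"
  shows "map_pmf (\<lambda>e j. if j \<in> U \<and> t' < e j then e j else 0) (Pi_pmf U 0 (alive_dist I t))
    = bind_pmf (Pi_pmf U 0 (alive_dist I t)) (\<lambda>e. Pi_pmf {j \<in> U. t' < e j} 0 (alive_dist I t'))"
proof -
  have fin: "finite U" using assms(1) by (rule finite_subset) simp
  have t': "1 \<le> t'" using assms by simp
  have c: "cond_pmf (alive_dist I t j) {x. t' < x} = alive_dist I t' j" if "j \<in> U" for j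
    unfolding alive_dist_def
    by (rule cond_pmf_cond_pmf[OF exp_dist_meets]) (use that assms in auto)
  have "set_pmf (alive_dist I t j) \<inter> {x. t' < x} \<noteq> {}" if "j \<in> U" for j
  proof -
    have j: "j \<in> opts I" using that assms(1) by blast
    have "set_pmf (exp_dist I j) \<inter> {x. t < x} \<inter> {x. t' < x} = set_pmf (exp_dist I j) \<inter> {x. t' < x}"
      using assms(3) by auto
    then show ?thesis
      using exp_dist_meets[OF j t'] unfolding alive_dist_def set_cond_pmf[OF exp_dist_meets[OF j assms(2)]]
      by simp
  qed
  from Pi_pmf_resample[OF fin this, where d = 0]
  have "map_pmf (\<lambda>e j. if j \<in> U \<and> t' < e j then e j else 0) (Pi_pmf U 0 (alive_dist I t))
      = bind_pmf (Pi_pmf U 0 (alive_dist I t))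
          (\<lambda>e. Pi_pmf {j \<in> U. t' < e j} 0 (\<lambda>j. cond_pmf (alive_dist I t j) {x. t' < x}))"
    by simp
  also have "\<dots> = bind_pmf (Pi_pmf U 0 (alive_dist I t)) (\<lambda>e. Pi_pmf {j \<in> U. t' < e j} 0 (alive_dist I t'))"
    by (intro bind_pmf_cong refl Pi_pmf_cong) (auto simp: c)
  finally show ?thesis .
qed

text \<open>From \<open>t'\<close> on, play is unaffected if expired entries are reset to 0. By
  \<open>alive_dist_resample\<close>, it then suffices to draw the set of survivors and give them
  fresh laws conditioned on survival past \<open>t'\<close>.\<close>

lemma rand_play_resample:
  assumes "admissible act" "U \<subseteq> opts I" "1 \<le> t" "t \<le> t'"
  shows "rand_play I act (alive_dist I t) k t' U m
    = bind_pmf (Pi_pmf U 0 (alive_dist I t))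
        (\<lambda>e. rand_play I act (alive_dist I t') k t' {j \<in> U. t' < e j} m)"
proof -
  have fin: "finite U" using assms(2) by (rule finite_subset) simp
  let ?P = "Pi_pmf U 0 (alive_dist I t)" and ?S = "Pi_pmf U 0 (eval_dist I)"
  let ?r = "\<lambda>(e::nat \<Rightarrow> nat) j. if j \<in> U \<and> t' < e j then e j else 0"
  let ?A = "\<lambda>e::nat \<Rightarrow> nat. {j \<in> U. t' < e j}"
  have red: "play I act s e k t' U m = play I act s e k t' (?A e) m" for s e
    by (rule play_remove_expired) auto
  have "play I act s e k t' U m = play I act s (?r e) k t' U m" for s e
  proof -
    have "?A (?r e) = ?A e" by auto
    moreover have "play I act s e k t' (?A e) m = play I act s (?r e) k t' (?A e) m"
      by (rule play_cong[OF assms(1)]) auto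
    ultimately show ?thesis by (simp only: red[of s e] red[of s "?r e"])
  qed
  then have "rand_play I act (alive_dist I t) k t' U m
      = bind_pmf ?S (\<lambda>s. bind_pmf (map_pmf ?r ?P) (\<lambda>e. play I act s e k t' U m))"
    unfolding rand_play_def bind_map_pmf by (intro bind_pmf_cong refl)
  also have "\<dots> = bind_pmf ?P (\<lambda>e0. bind_pmf ?S (\<lambda>s.
      bind_pmf (Pi_pmf (?A e0) 0 (alive_dist I t')) (\<lambda>e. play I act s e k t' U m)))"
    unfolding alive_dist_resample[OF assms(2-4)] bind_assoc_pmf
    by (subst bind_commute_pmf) (rule refl)
  also have "\<dots> = bind_pmf ?P (\<lambda>e0. rand_play I act (alive_dist I t') k t' (?A e0) m)"
  proof (rule bind_pmf_cong[OF refl])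
    fix e0
    let ?A0 = "?A e0"
    let ?q = "\<lambda>(f::nat \<Rightarrow> nat) x. if x \<in> ?A0 then f x else 0"
    have sub: "Pi_pmf ?A0 0 (eval_dist I) = map_pmf ?q ?S"
      by (rule Pi_pmf_subset[OF fin]) auto
    show "bind_pmf ?S (\<lambda>s. bind_pmf (Pi_pmf ?A0 0 (alive_dist I t')) (\<lambda>e. play I act s e k t' U m))
        = rand_play I act (alive_dist I t') k t' ?A0 m"
      unfolding rand_play_def sub bind_map_pmf
    proof (intro bind_pmf_cong refl)
      fix s e assume "e \<in> set_pmf (Pi_pmf ?A0 0 (alive_dist I t'))"
      then have z: "e j = 0" if "j \<notin> ?A0" for j
        using that set_Pi_pmf_subset[of ?A0 0 "alive_dist I t'"] fin by auto
      have "play I act s e k t' U m = play I act s e k t' ?A0 m"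
        by (rule play_remove_expired) (use z in auto)
      also have "\<dots> = play I act (?q s) e k t' ?A0 m"
        by (rule play_cong[OF assms(1)]) auto
      finally show "play I act s e k t' U m = play I act (?q s) e k t' ?A0 m" .
    qed
  qed
  finally show ?thesis .
qed

text \<open>Averaging over the survivors multiplies each option price by the conditional survival
  probability, which turns the denominator at \<open>t'\<close> into that at \<open>t\<close>.
  Resampling leaves the mean of the later scores unchanged.\<close>

lemma expectation_value_bound:
  assumes "U \<subseteq> opts I" "1 \<le> t" "t \<le> t'"
  shows "measure_pmf.expectation (Pi_pmf U 0 (alive_dist I t)) (\<lambda>e. value_bound I t' {j \<in> U. t' < e j})
    = time_price I t' + (\<Sum>j\<in>U. option_price I j t' / tail_prob (exp_dist I j) t)
      + measure_pmf.expectation (Pi_pmf U 0 (alive_dist I t)) (later_scores I U t')"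
    and "integrable (measure_pmf (Pi_pmf U 0 (alive_dist I t))) (\<lambda>e. value_bound I t' {j \<in> U. t' < e j})"
proof -
  have fin: "finite U" using assms(1) by (rule finite_subset) simp
  let ?P = "Pi_pmf U 0 (alive_dist I t)"
  let ?c = "\<lambda>j. option_price I j t' / tail_prob (exp_dist I j) t'"
  let ?A = "\<lambda>e::nat \<Rightarrow> nat. {j \<in> U. t' < e j}"
  let ?L = "\<lambda>e. measure_pmf.expectation (Pi_pmf (?A e) 0 (alive_dist I t')) (later_scores I (?A e) t')"
  let ?r = "\<lambda>(e::nat \<Rightarrow> nat) j. if j \<in> U \<and> t' < e j then e j else 0"
  have c0: "0 \<le> ?c j" for j by (intro divide_nonneg_nonneg option_price_nonneg tail_prob_bounds)
  have intj: "integrable (measure_pmf ?P) (\<lambda>e. if t' < e j then ?c j else 0)" for j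
    by (rule integrable_pmf_bounded[where B = "?c j"]) (use c0 in auto)
  have sumA: "(\<Sum>j\<in>?A e. ?c j) = (\<Sum>j\<in>U. if t' < e j then ?c j else 0)" for e :: "nat \<Rightarrow> nat"
    using fin by (simp add: sum.inter_filter)
  \<comment> \<open>Entries outside the survivor set are 0 and so exceed no time; the set in
    \<open>later_scores\<close> may thus be enlarged to \<open>U\<close>.\<close>
  have L: "?L e = measure_pmf.expectation (Pi_pmf (?A e) 0 (alive_dist I t')) (later_scores I U t')"
    for e :: "nat \<Rightarrow> nat"
  proof (rule expectation_pmf_cong)
    fix e' assume "e' \<in> set_pmf (Pi_pmf (?A e) 0 (alive_dist I t'))"
    then have "e' j = 0" if "j \<notin> ?A e" for j
      using that set_Pi_pmf_subset[of "?A e" 0 "alive_dist I t'"] fin by auto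
    then have "{j \<in> ?A e. \<tau> < e' j} = {j \<in> U. \<tau> < e' j}" for \<tau> by (metis (lifting) mem_Collect_eq not_less_zero)
    then show "later_scores I (?A e) t' e' = later_scores I U t' e'" by (simp add: later_scores_def)
  qed
  have "measure_pmf.expectation ?P ?L = measure_pmf.expectation ?P (\<lambda>e. later_scores I U t' (?r e))"
  proof -
    have "measure_pmf.expectation ?P ?L
        = measure_pmf.expectation (bind_pmf ?P (\<lambda>e. Pi_pmf (?A e) 0 (alive_dist I t'))) (later_scores I U t')"
      unfolding L by (rule expectation_bind_pmf[symmetric]) (rule later_scores_bounds[OF fin])
    then show ?thesis unfolding alive_dist_resample[OF assms, symmetric] by simp
  qed
  also have "\<dots> = measure_pmf.expectation ?P (later_scores I U t')"
    unfolding later_scores_def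
    by (intro expectation_pmf_cong sum.cong refl arg_cong[where f = "best_score I _"]) auto
  finally have EL: "measure_pmf.expectation ?P ?L = measure_pmf.expectation ?P (later_scores I U t')" .
  have intL: "integrable (measure_pmf ?P) ?L"
    unfolding L
    by (rule integrable_pmf_bounded, rule conjI; rule expectation_pmf_bounds; rule later_scores_bounds[OF fin])
  have Ej: "measure_pmf.expectation ?P (\<lambda>e. if t' < e j then ?c j else 0)
      = option_price I j t' / tail_prob (exp_dist I j) t" if j: "j \<in> U" for j
  proof -
    have jo: "j \<in> opts I" using j assms(1) by blast
    have "measure_pmf.expectation ?P (\<lambda>e. if t' < e j then ?c j else 0)
        = measure_pmf.expectation (map_pmf (\<lambda>e. e j) ?P) (\<lambda>x. if t' < x then ?c j else 0)" by simp
    also have "\<dots> = measure_pmf.prob (alive_dist I t j) {x. t' < x} * ?c j"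
      using j by (subst Pi_pmf_component[OF fin]) (simp add: expectation_if_prob)
    also have "\<dots> = option_price I j t' / tail_prob (exp_dist I j) t"
      using exp_tail_pos[OF jo, of t'] assms by (simp add: prob_alive_dist[OF jo])
    finally show ?thesis .
  qed
  have vb: "value_bound I t' (?A e) = time_price I t' + (\<Sum>j\<in>U. if t' < e j then ?c j else 0) + ?L e"
    for e :: "nat \<Rightarrow> nat"
    unfolding value_bound_def sumA ..
  show "integrable (measure_pmf ?P) (\<lambda>e. value_bound I t' (?A e))"
    unfolding vb by (intro Bochner_Integration.integrable_add intL Bochner_Integration.integrable_sum intj) simp
  show "measure_pmf.expectation ?P (\<lambda>e. value_bound I t' (?A e))
    = time_price I t' + (\<Sum>j\<in>U. option_price I j t' / tail_prob (exp_dist I j) t)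
      + measure_pmf.expectation ?P (later_scores I U t')"
    unfolding vb using intL intj
    by (simp add: Bochner_Integration.integral_add Bochner_Integration.integrable_add
        Bochner_Integration.integrable_sum Bochner_Integration.integral_sum Ej EL)
qed

text \<open>The potential satisfies the Bellman inequality for every decision: by
  \<open>score_eq\<close> a selection brings its score plus the prices of what it consumes, and the
  best score at \<open>t\<close> covers the score. Idling only lets prices fall.\<close>

lemma val_le_value_bound:
  assumes "admissible act" "1 \<le> t" "A \<subseteq> opts I"
  shows "val I act (alive_dist I t) k t A m \<le> value_bound I t A"
  using assms(2,3)
proof (induction k arbitrary: t A m)
  case 0
  have "0 \<le> value_bound I t A"
    unfolding value_bound_def
    by (intro add_nonneg_nonneg sum_nonneg divide_nonneg_nonneg time_price_nonneg option_price_nonneg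
        tail_prob_bounds expectation_pmf_bounds(1)[where B = "\<Sum>\<tau>\<in>{t..<max_deadline I}. best_score I \<tau> A"]
        later_scores_bounds)
      (use 0 in \<open>auto intro: finite_subset\<close>)
  then show ?case by simp
next
  case (Suc k)
  have fin: "finite A" using Suc.prems(2) by (rule finite_subset) simp
  let ?P = "Pi_pmf A 0 (alive_dist I t)"
  let ?p = "\<lambda>j. tail_prob (exp_dist I j) t"
  define L where "L = measure_pmf.expectation ?P (later_scores I A (Suc t))"
  note vb = val_bounds[OF assms(1)]
  \<comment> \<open>The continuation from \<open>t'\<close>, averaged over the survivors, with
    denominators still at \<open>t\<close>.\<close>
  have after: "val I act (alive_dist I t) k t' U m'
      \<le> time_price I t' + (\<Sum>j\<in>U. option_price I j t' / ?p j) + L"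
    if U: "U \<subseteq> A" and t': "t < t'" for t' U m'
  proof -
    have Uo: "U \<subseteq> opts I" using U Suc.prems(2) by blast
    let ?Q = "Pi_pmf U 0 (alive_dist I t)"
    have "val I act (alive_dist I t) k t' U m'
        = measure_pmf.expectation ?Q (\<lambda>e. val I act (alive_dist I t') k t' {j \<in> U. t' < e j} m')"
      by (rule val_bind[OF assms(1)], use Uo in blast, rule rand_play_resample[OF assms(1) Uo])
        (use Suc.prems t' in auto)
    also have "\<dots> \<le> measure_pmf.expectation ?Q (\<lambda>e. value_bound I t' {j \<in> U. t' < e j})"
    proof (rule integral_mono_AE)
      show "integrable (measure_pmf ?Q) (\<lambda>e. val I act (alive_dist I t') k t' {j \<in> U. t' < e j} m')"
        by (rule integrable_pmf_bounded[where B = "\<Sum>j\<in>opts I. reward I j"], intro conjI vb)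
          (use Uo in auto)
      show "integrable (measure_pmf ?Q) (\<lambda>e. value_bound I t' {j \<in> U. t' < e j})"
        by (rule expectation_value_bound(2)[OF Uo]) (use Suc.prems t' in auto)
      show "AE e in ?Q. val I act (alive_dist I t') k t' {j \<in> U. t' < e j} m'
          \<le> value_bound I t' {j \<in> U. t' < e j}"
        by (intro AE_I2 Suc.IH) (use Suc.prems t' Uo in auto)
    qed
    also have "\<dots> = time_price I t' + (\<Sum>j\<in>U. option_price I j t' / ?p j)
        + measure_pmf.expectation ?Q (later_scores I U t')"
      by (rule expectation_value_bound(1)[OF Uo]) (use Suc.prems t' in auto)
    \<comment> \<open>Fewer options and a later start can only lower the sum of best scores.\<close>
    also have "measure_pmf.expectation ?Q (later_scores I U t') \<le> L"
    proof -
      have "?Q = map_pmf (\<lambda>f x. if x \<in> U then f x else 0) ?P"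
        by (rule Pi_pmf_subset[OF fin U])
      then have "measure_pmf.expectation ?Q (later_scores I U t')
          = measure_pmf.expectation ?P (\<lambda>e. later_scores I U t' (\<lambda>x. if x \<in> U then e x else 0))"
        by simp
      also have "\<dots> \<le> L" unfolding L_def
        by (rule expectation_pmf_mono[where B = "\<Sum>\<tau>\<in>{Suc t..<max_deadline I}. best_score I \<tau> A"])
          (use fin U t' in \<open>auto intro: later_scores_mono later_scores_bounds[THEN conjunct1]
            later_scores_bounds[THEN conjunct2] finite_subset\<close>)
      finally show ?thesis .
    qed
    finally show ?thesis by simp
  qed
  \<comment> \<open>From the largest deadline on, \<open>later_scores\<close> has no term for
    \<open>t\<close>.\<close>
  let ?b = "if t < max_deadline I then best_score I t A else 0"
  have b0: "0 \<le> ?b" using best_score_nonneg[OF fin] by simp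
  have alive: "{j \<in> A. t < e j} = A" if "e \<in> set_pmf ?P" for e
    using that fin Suc.prems alive_dist_gt[of _ t] by (auto simp: set_Pi_pmf PiE_dflt_def)
  have bound: "value_bound I t A = time_price I t + (\<Sum>j\<in>A. option_price I j t / ?p j) + ?b + L"
  proof -
    have "measure_pmf.expectation ?P (later_scores I A t)
        = measure_pmf.expectation ?P (\<lambda>e. ?b + later_scores I A (Suc t) e)"
      by (rule expectation_pmf_cong)
        (auto simp: later_scores_def alive sum.atLeast_Suc_lessThan)
    also have "\<dots> = ?b + L"
      unfolding L_def
      by (subst Bochner_Integration.integral_add)
        (simp_all add: integrable_pmf_bounded[OF later_scores_bounds[OF fin]])
    finally show ?thesis by (simp add: value_bound_def)
  qed
  have op: "option_price I j t' / ?p j \<le> option_price I j t / ?p j" if "t \<le> t'" for j t'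
    by (intro divide_right_mono option_price_antimono that tail_prob_bounds)
  have *: "0 \<le> (case d of None \<Rightarrow> val I act (alive_dist I t) k (t + 1) A m'
      | Some j \<Rightarrow> exp_reward I j t + measure_pmf.expectation (eval_dist I j)
            (\<lambda>x. val I act (alive_dist I t) k (t + x) (A - {j}) m'))
      \<and> (case d of None \<Rightarrow> val I act (alive_dist I t) k (t + 1) A m'
      | Some j \<Rightarrow> exp_reward I j t + measure_pmf.expectation (eval_dist I j)
            (\<lambda>x. val I act (alive_dist I t) k (t + x) (A - {j}) m')) \<le> value_bound I t A"
    if dm: "(d, m') \<in> set_pmf (act m t A)" for d m'
  proof (cases d)
    case None
    have "val I act (alive_dist I t) k (t + 1) A m'
        \<le> time_price I (t + 1) + (\<Sum>j\<in>A. option_price I j (t + 1) / ?p j) + L"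
      by (rule after) auto
    also have "\<dots> \<le> time_price I t + (\<Sum>j\<in>A. option_price I j t / ?p j) + L"
      by (intro add_mono sum_mono op time_price_antimono) auto
    also have "\<dots> \<le> value_bound I t A" unfolding bound using b0 by linarith
    finally show ?thesis using None vb(1)[OF Suc.prems(2)] by simp
  next
    case (Some j)
    have j: "j \<in> A" using admissibleD[OF assms(1), of j m' m t A] dm Some by auto
    then have jo: "j \<in> opts I" using Suc.prems by blast
    let ?E = "measure_pmf.expectation (eval_dist I j) (\<lambda>x. val I act (alive_dist I t) k (t + x) (A - {j}) m')"
    let ?S = "\<Sum>i\<in>A - {j}. option_price I i t / ?p i"
    have "0 \<le> exp_reward I j t + ?E"
      by (intro add_nonneg_nonneg exp_reward_nonneg[OF jo] Bochner_Integration.integral_nonneg vb)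
        (use Suc.prems in auto)
    moreover have "?E \<le> measure_pmf.expectation (eval_dist I j) (\<lambda>x. time_price I (t + x) + (?S + L))"
    proof (rule expectation_eval_mono[OF jo])
      fix x :: nat assume x: "1 \<le> x"
      have "val I act (alive_dist I t) k (t + x) (A - {j}) m'
          \<le> time_price I (t + x) + (\<Sum>i\<in>A - {j}. option_price I i (t + x) / ?p i) + L"
        by (rule after) (use x in auto)
      also have "\<dots> \<le> time_price I (t + x) + ?S + L"
        by (intro add_mono sum_mono op order_refl) auto
      finally show "val I act (alive_dist I t) k (t + x) (A - {j}) m' \<le> time_price I (t + x) + (?S + L)"
        by simp
    qed
    then have "?E \<le> measure_pmf.expectation (eval_dist I j) (\<lambda>x. time_price I (t + x)) + (?S + L)"
      by (subst (asm) Bochner_Integration.integral_add) (simp_all add: integrable_eval[OF jo])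
    moreover have "exp_reward I j t + measure_pmf.expectation (eval_dist I j) (\<lambda>x. time_price I (t + x))
        \<le> ?b + time_price I t + option_price I j t / ?p j"
    proof (cases "t < max_deadline I")
      case True
      have "score I j t \<le> ?b" using best_score_ge[OF fin j] True by simp
      moreover have "time_price I (Suc t) \<le> time_price I t" by (rule time_price_antimono) simp
      moreover have "option_price I j (Suc t) / ?p j \<le> option_price I j t / ?p j" by (rule op) simp
      ultimately show ?thesis unfolding score_eq[OF jo True] by linarith
    next
      case False
      then show ?thesis by (simp add: exp_reward_late[OF jo])
    qed
    moreover have "(\<Sum>i\<in>A. option_price I i t / ?p i) = option_price I j t / ?p j + ?S"
      by (rule sum.remove[OF fin j])
    ultimately show ?thesis unfolding bound Some by simp
  qed
  have "val I act (alive_dist I t) (Suc k) t A m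
    = measure_pmf.expectation (act m t A) (\<lambda>(d, m'). case d of
      None \<Rightarrow> val I act (alive_dist I t) k (t + 1) A m'
    | Some j \<Rightarrow> exp_reward I j t + measure_pmf.expectation (eval_dist I j)
            (\<lambda>x. val I act (alive_dist I t) k (t + x) (A - {j}) m'))"
    by (rule val_step[OF assms(1) Suc.prems(2)]) (simp add: alive)
  also have "\<dots> \<le> value_bound I t A"
  proof (rule expectation_pmf_bounds(2))
    fix z assume "z \<in> set_pmf (act m t A)"
    then show "0 \<le> (case z of (d, m') \<Rightarrow> case d of None \<Rightarrow> val I act (alive_dist I t) k (t + 1) A m'
      | Some j \<Rightarrow> exp_reward I j t + measure_pmf.expectation (eval_dist I j)
            (\<lambda>x. val I act (alive_dist I t) k (t + x) (A - {j}) m'))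
      \<and> (case z of (d, m') \<Rightarrow> case d of None \<Rightarrow> val I act (alive_dist I t) k (t + 1) A m'
      | Some j \<Rightarrow> exp_reward I j t + measure_pmf.expectation (eval_dist I j)
            (\<lambda>x. val I act (alive_dist I t) k (t + x) (A - {j}) m')) \<le> value_bound I t A"
      using * by (cases z) simp
  qed
  finally show ?case .
qed

text \<open>Each of the three terms is at most \<open>time_price I 1\<close>: the first is equal to
  it, the option prices add up to it because survival to time 1 is certain, and the expected best
  scores are at most shares, which telescope.\<close>

lemma value_bound_1_le: "value_bound I 1 (opts I) \<le> 3 * time_price I 1"
proof -
  let ?P = "Pi_pmf (opts I) 0 (exp_dist I)" and ?D = "max_deadline I"
  have P: "Pi_pmf (opts I) 0 (alive_dist I 1) = ?P"
    by (rule Pi_pmf_cong) (simp_all add: alive_dist_1[simplified])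
  have int: "integrable (measure_pmf ?P) (\<lambda>e. best_score I \<tau> {j \<in> opts I. \<tau> < e j})" for \<tau>
    by (rule integrable_pmf_bounded[where B = "best_score I \<tau> (opts I)"])
      (auto intro: best_score_nonneg best_score_mono)
  have "measure_pmf.expectation ?P (later_scores I (opts I) 1)
      = (\<Sum>\<tau>\<in>{1..<?D}. measure_pmf.expectation ?P (\<lambda>e. best_score I \<tau> {j \<in> opts I. \<tau> < e j}))"
    unfolding later_scores_def by (rule Bochner_Integration.integral_sum) (rule int)
  also have "\<dots> \<le> (\<Sum>\<tau>\<in>{1..<?D}. time_price I \<tau> - time_price I (Suc \<tau>))"
  proof (rule sum_mono)
    fix \<tau> assume "\<tau> \<in> {1..<?D}"
    then have "time_price I \<tau> - time_price I (Suc \<tau>) = (\<Sum>j\<in>opts I. share I (opts I) \<tau> j)"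
      by (simp add: time_price_def option_price_Suc sum.distrib)
    then show "measure_pmf.expectation ?P (\<lambda>e. best_score I \<tau> {j \<in> opts I. \<tau> < e j})
        \<le> time_price I \<tau> - time_price I (Suc \<tau>)"
      using expectation_best_score_le[OF finite_opts, of I \<tau>] by simp
  qed
  also have "\<dots> \<le> time_price I 1"
  proof (cases "1 \<le> ?D")
    case True
    show ?thesis using sum_Suc_diff'[OF True, of "\<lambda>i. - time_price I i"] time_price_nonneg[of I ?D] by simp
  qed (simp add: time_price_nonneg)
  finally show ?thesis
    unfolding value_bound_def P by (simp add: exp_tail_1[simplified] time_price_def)
qed

text \<open>All options are alive at time 1, so the conditional and the original laws agree there.
  The lower and the upper bound then meet at \<open>time_price I 1\<close>.\<close>

lemma score_rule_third:
  assumes "admissible act"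
  shows "expected_value I act m \<le> 3 * expected_value I (index_rule (score I)) ()"
proof -
  have "expected_value I act m = val I act (alive_dist I 1) (max_deadline I) 1 (opts I) m"
    unfolding expected_value_eq_val by (rule val_cong) (simp add: alive_dist_1[simplified])
  also have "\<dots> \<le> value_bound I 1 (opts I)" by (rule val_le_value_bound[OF assms]) auto
  also have "\<dots> \<le> 3 * time_price I 1" by (rule value_bound_1_le)
  also have "\<dots> \<le> 3 * expected_value I (index_rule (score I)) ()"
    unfolding expected_value_eq_val time_price_def
    using val_score_rule_ge[of 1 "max_deadline I" "opts I"] by simp
  finally show ?thesis .
qed

end

section \<open>Deterministic programs\<close>

lemma steps_add: "steps (a + b) c = bind_pmf (steps a c) (steps b)"
proof (induction a arbitrary: c)
  case (Suc a)
  then have "steps (a + b) = (\<lambda>c. bind_pmf (steps a c) (steps b))" by blast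
  then show ?case by (simp add: bind_assoc_pmf)
qed (simp add: bind_return_pmf)

lemma steps_halted: "steps k ([], \<sigma>) = return_pmf ([], \<sigma>)"
  by (induction k) (simp_all add: bind_return_pmf)

text \<open>Total correctness with a step bound, for runs that end in a single store. Quantifying
  over the rest \<open>K\<close> of the stack makes it compositional; an empty \<open>K\<close>
  gives halting.\<close>

definition runs :: "prog \<Rightarrow> nat \<Rightarrow> store \<Rightarrow> (store \<Rightarrow> bool) \<Rightarrow> bool" where
  "runs P c \<sigma> Q \<longleftrightarrow> (\<exists>k \<sigma>'. k \<le> c \<and> (\<forall>K. steps k (P # K, \<sigma>) = return_pmf (K, \<sigma>')) \<and> Q \<sigma>')"

lemma runs_le: "runs P c \<sigma> Q \<Longrightarrow> c \<le> c' \<Longrightarrow> runs P c' \<sigma> Q"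
  unfolding runs_def using order_trans by blast

lemma runs_conseq: "runs P c \<sigma> Q \<Longrightarrow> (\<And>\<sigma>'. Q \<sigma>' \<Longrightarrow> Q' \<sigma>') \<Longrightarrow> runs P c \<sigma> Q'"
  unfolding runs_def by blast

lemma runs_1: "(\<And>K. exec1 P K \<sigma> = return_pmf (K, \<sigma>')) \<Longrightarrow> Q \<sigma>' \<Longrightarrow> runs P 1 \<sigma> Q"
  unfolding runs_def by (intro exI[of _ 1] exI[of _ \<sigma>']) (simp add: bind_return_pmf)

lemma runs_Skip: "Q \<sigma> \<Longrightarrow> runs Skip 1 \<sigma> Q"
  by (rule runs_1) simp_all

lemma runs_NAssign: "Q (nset x (map (neval \<sigma>) is) (neval \<sigma> a) \<sigma>) \<Longrightarrow> runs (NAssign x is a) 1 \<sigma> Q"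
  by (rule runs_1) simp_all

lemma runs_RAssign: "Q (rset x (map (neval \<sigma>) is) (reval \<sigma> a) \<sigma>) \<Longrightarrow> runs (RAssign x is a) 1 \<sigma> Q"
  by (rule runs_1) simp_all

lemma runs_Seq:
  assumes "runs P c \<sigma> (\<lambda>\<sigma>'. runs P' c' \<sigma>' Q)"
  shows "runs (Seq P P') (Suc (c + c')) \<sigma> Q"
proof -
  from assms obtain k \<sigma>' where k: "k \<le> c" "\<And>K. steps k (P # K, \<sigma>) = return_pmf (K, \<sigma>')"
    and "runs P' c' \<sigma>' Q"
    unfolding runs_def by blast
  then obtain k' \<sigma>'' where k': "k' \<le> c'" "\<And>K. steps k' (P' # K, \<sigma>') = return_pmf (K, \<sigma>'')" "Q \<sigma>''"
    unfolding runs_def by blast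
  show ?thesis
    unfolding runs_def
    by (intro exI[of _ "Suc (k + k')"] exI[of _ \<sigma>''])
      (use k k' in \<open>auto simp: steps_add bind_return_pmf\<close>)
qed

lemma runs_Suc:
  assumes "\<And>K. exec1 P K \<sigma> = return_pmf (P' # K, \<sigma>)" "runs P' c \<sigma> Q"
  shows "runs P (Suc c) \<sigma> Q"
proof -
  from assms(2) obtain k \<sigma>' where "k \<le> c" "\<And>K. steps k (P' # K, \<sigma>) = return_pmf (K, \<sigma>')" "Q \<sigma>'"
    unfolding runs_def by blast
  then show ?thesis
    unfolding runs_def
    by (intro exI[of _ "Suc k"] exI[of _ \<sigma>']) (simp add: assms(1) bind_return_pmf)
qed

lemma runs_Cond:
  "(beval \<sigma> b \<Longrightarrow> runs P c \<sigma> Q) \<Longrightarrow> (\<not> beval \<sigma> b \<Longrightarrow> runs P' c' \<sigma> Q)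
    \<Longrightarrow> runs (Cond b P P') (Suc (max c c')) \<sigma> Q"
  by (rule runs_Suc[where P' = "if beval \<sigma> b then P else P'"]) (auto intro: runs_le)

text \<open>For loops whose number \<open>N\<close> of rounds is known beforehand: the invariant is
  indexed by the rounds completed, and the induction is on the rounds left.\<close>

lemma runs_While:
  assumes "Inv 0 \<sigma>" and "\<And>i \<sigma>. i \<le> N \<Longrightarrow> Inv i \<sigma> \<Longrightarrow> beval \<sigma> b \<longleftrightarrow> i < N"
    and "\<And>i \<sigma>. i < N \<Longrightarrow> Inv i \<sigma> \<Longrightarrow> runs P c \<sigma> (Inv (Suc i))"
    and "\<And>\<sigma>. Inv N \<sigma> \<Longrightarrow> Q \<sigma>"
  shows "runs (While b P) (Suc (N * Suc c)) \<sigma> Q"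
proof -
  have "runs (While b P) (Suc ((N - i) * Suc c)) \<sigma> Q" if "i \<le> N" "Inv i \<sigma>" for i \<sigma>
    using that
  proof (induction "N - i" arbitrary: i \<sigma>)
    case 0
    then have "i = N" by simp
    with 0 assms(2)[of N \<sigma>] have "\<not> beval \<sigma> b" "Q \<sigma>" using assms(4) by auto
    then have "runs (While b P) 1 \<sigma> Q" by (intro runs_1[of _ _ \<sigma>]) simp_all
    then show ?case by (rule runs_le) simp
  next
    case (Suc d)
    then have i: "i < N" by simp
    with Suc assms(2)[of i \<sigma>] have b: "beval \<sigma> b" by simp
    have "runs P c \<sigma> (\<lambda>\<sigma>'. runs (While b P) (Suc ((N - Suc i) * Suc c)) \<sigma>' Q)"
      by (rule runs_conseq[OF assms(3)[OF i Suc.prems(2)]], rule Suc.hyps(1))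
        (use Suc.hyps(2) i in auto)
    then obtain k \<sigma>' where k: "k \<le> c" "\<And>K. steps k (P # K, \<sigma>) = return_pmf (K, \<sigma>')"
      and "runs (While b P) (Suc ((N - Suc i) * Suc c)) \<sigma>' Q"
      unfolding runs_def by blast
    then obtain k' \<sigma>'' where k': "k' \<le> Suc ((N - Suc i) * Suc c)"
        "\<And>K. steps k' (While b P # K, \<sigma>') = return_pmf (K, \<sigma>'')" "Q \<sigma>''"
      unfolding runs_def by blast
    have "N - i = Suc (N - Suc i)" using i by simp
    then show ?case
      unfolding runs_def
      by (intro exI[of _ "Suc (k + k')"] exI[of _ \<sigma>''])
        (use k k' b in \<open>auto simp: steps_add bind_return_pmf\<close>)
  qed
  from this[of 0 \<sigma>] assms(1) show ?thesis by simp
qed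

text \<open>The counter is increased before the body, so that the body sees the numbers from 1 on,
  as options are numbered.\<close>

definition for_loop :: "string \<Rightarrow> nexp \<Rightarrow> prog \<Rightarrow> prog" where
  "for_loop x b P = Seq (NAssign x [] (NConst 0))
     (While (NLess (NCell x []) b) (Seq (NAssign x [] (NAdd (NCell x []) (NConst 1))) P))"

text \<open>Per round, the guard, the sequencing and the increment cost 3 steps, and so do the
  initialization and the final test together. Bounding the rounds by a common \<open>M\<close> lets
  the costs of different loops combine.\<close>

lemma runs_for_loop:
  assumes "Inv 0 (nset x [] 0 \<sigma>)"
    and "\<And>i \<sigma>. i \<le> N \<Longrightarrow> Inv i \<sigma> \<Longrightarrow> ncell \<sigma> x [] = i \<and> neval \<sigma> b = N"
    and "\<And>i \<sigma>. i < N \<Longrightarrow> Inv i \<sigma> \<Longrightarrow> runs P c (nset x [] (Suc i) \<sigma>) (Inv (Suc i))"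
    and "\<And>\<sigma>. Inv N \<sigma> \<Longrightarrow> Q \<sigma>" and "N \<le> M"
  shows "runs (for_loop x b P) (M * (c + 3) + 3) \<sigma> Q"
proof -
  let ?P = "Seq (NAssign x [] (NAdd (NCell x []) (NConst 1))) P"
  have "runs (for_loop x b P) (Suc (1 + Suc (N * Suc (Suc (1 + c))))) \<sigma> Q"
    unfolding for_loop_def
  proof (intro runs_Seq runs_NAssign runs_While[where Inv = Inv])
    show "Inv 0 (nset x (map (neval \<sigma>) []) (neval \<sigma> (NConst 0)) \<sigma>)" using assms(1) by simp
  next
    fix i \<sigma> assume i: "i \<le> N" "Inv i \<sigma>"
    show "beval \<sigma> (NLess (NCell x []) b) \<longleftrightarrow> i < N" using assms(2)[OF i] by simp
  next
    fix i \<sigma> assume i: "i < N" "Inv i \<sigma>"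
    show "runs P c (nset x (map (neval \<sigma>) []) (neval \<sigma> (NAdd (NCell x []) (NConst 1))) \<sigma>) (Inv (Suc i))"
      using assms(3)[OF i] assms(2)[of i \<sigma>] i by simp
  qed (rule assms(4))
  then show ?thesis
    by (rule runs_le) (use mult_le_mono1[OF assms(5), of "c + 3"] in \<open>simp add: algebra_simps\<close>)
qed

section \<open>Memory cells and input tables\<close>

lemma ncell_nset [simp]:
  "ncell (nset x i a \<sigma>) y k = (if y = x \<and> k = i then a else ncell \<sigma> y k)"
  and rcell_nset [simp]: "rcell (nset x i a \<sigma>) = rcell \<sigma>"
  and ncell_rset [simp]: "ncell (rset x i r \<sigma>) = ncell \<sigma>"
  and rcell_rset [simp]: "rcell (rset x i r \<sigma>) y k = (if y = x \<and> k = i then r else rcell \<sigma> y k)"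
  by (simp_all add: nset_def rset_def)

text \<open>The part of the store that must survive from call to call. Evaluation tails are
  described for all times, as cells past the horizon read 0, the true tail; expiration tails are
  tabulated up to the largest deadline.\<close>

definition inputs :: "sse \<Rightarrow> store \<Rightarrow> bool" where
  "inputs I \<sigma> \<longleftrightarrow> ncell \<sigma> ''n'' [] = num_opts I \<and> ncell \<sigma> ''Dmax'' [] = max_deadline I
    \<and> (\<forall>j\<in>opts I. ncell \<sigma> ''D'' [j] = deadline I j \<and> rcell \<sigma> ''v'' [j] = reward I j
        \<and> (\<forall>t. rcell \<sigma> ''FS'' [j, t] = tail_prob (eval_dist I j) t)
        \<and> (\<forall>t\<le>max_deadline I. rcell \<sigma> ''p'' [j, t] = tail_prob (exp_dist I j) t))"

lemma (in sse_inst) inputs_input_store: "inputs I (input_store I)"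
proof -
  have "tail_prob (eval_dist I j) t = 0" if "j \<in> opts I" "\<not> t \<le> horizon I" for j t
  proof -
    have "tail_prob (eval_dist I j) t \<le> tail_prob (eval_dist I j) (horizon I)"
      unfolding tail_prob_def by (rule measure_pmf.finite_measure_mono) (use that in auto)
    then show ?thesis using eval_tail[OF that(1)] tail_prob_bounds(1)[of "eval_dist I j" t] by simp
  qed
  then show ?thesis by (auto simp: inputs_def input_store_def)
qed

definition observed :: "sse \<Rightarrow> nat \<Rightarrow> nat set \<Rightarrow> store \<Rightarrow> bool" where
  "observed I t A \<sigma> \<longleftrightarrow> inputs I \<sigma> \<and> ncell \<sigma> ''t'' [] = t \<and> ncell \<sigma> ''sel'' [] = 0
    \<and> (\<forall>j. ncell \<sigma> ''avail'' [j] = of_bool (j \<in> A))"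

lemma observed_observe: "inputs I \<sigma> \<Longrightarrow> observed I t A (observe t A \<sigma>)"
  by (simp add: observed_def observe_def inputs_def)

lemma observed_nset [simp]:
  "x \<notin> {''n'', ''Dmax'', ''D'', ''t'', ''sel'', ''avail''} \<Longrightarrow> observed I t A (nset x i a \<sigma>) = observed I t A \<sigma>"
proof -
  assume "x \<notin> {''n'', ''Dmax'', ''D'', ''t'', ''sel'', ''avail''}"
  then have "ncell (nset x i a \<sigma>) y = ncell \<sigma> y"
    if "y \<in> {''n'', ''Dmax'', ''D'', ''t'', ''sel'', ''avail''}" for y
    using that by (simp add: nset_def) blast
  then show ?thesis unfolding observed_def inputs_def by simp
qed

lemma observed_rset [simp]:
  "x \<notin> {''v'', ''FS'', ''p''} \<Longrightarrow> observed I t A (rset x i r \<sigma>) = observed I t A \<sigma>"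
proof -
  assume "x \<notin> {''v'', ''FS'', ''p''}"
  then have "rcell (rset x i r \<sigma>) y = rcell \<sigma> y" if "y \<in> {''v'', ''FS'', ''p''}" for y
    using that by (simp add: rset_def) blast
  then show ?thesis unfolding observed_def inputs_def by simp
qed

text \<open>Scanning in increasing order with a strict comparison keeps the earlier option on ties,
  as \<open>before\<close> demands. The initial value 0 reflects that \<open>pick\<close> takes only
  positive values.\<close>

lemma pick_insert:
  assumes "finite B" "\<And>i. i \<in> B \<Longrightarrow> i < k"
  shows "pick f (insert k B) = (if (case pick f B of None \<Rightarrow> 0 | Some a \<Rightarrow> f a) < f k then Some k else pick f B)"
proof (cases "pick f B")
  case None
  then have le: "\<forall>j\<in>B. f j \<le> 0" using pick_None_iff[OF assms(1)] by blast
  show ?thesis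
  proof (cases "0 < f k")
    case True
    then have "top_of f (insert k B) k" using le by (force simp: top_of_def before_def)
    with True None show ?thesis by (auto simp: pick_Some_iff)
  next
    case False
    then have "pick f (insert k B) = None" using le assms(1) by (subst pick_None_iff) auto
    with False None show ?thesis by simp
  qed
next
  case (Some a)
  then have a: "top_of f B a" "0 < f a" by (auto simp: pick_Some_iff)
  then have aB: "a \<in> B" by (simp add: top_of_def)
  show ?thesis
  proof (cases "f a < f k")
    case True
    then have "f i < f k" if "i \<in> B" for i using top_of_le[OF a(1) that] by linarith
    then have "top_of f (insert k B) k" by (auto simp: top_of_def before_def)
    then have "pick f (insert k B) = Some k" using True a(2) by (simp add: pick_Some_iff)
    then show ?thesis using True Some by simp
  next
    case False
    then have "top_of f (insert k B) a"
      using a(1) assms(2)[OF aB] by (auto simp: top_of_def before_def)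
    then have "pick f (insert k B) = Some a" using a(2) by (simp add: pick_Some_iff)
    then show ?thesis using False Some by simp
  qed
qed

section \<open>Selection of the largest index, and the greedy program\<close>

abbreviation var :: "string \<Rightarrow> nexp" where "var x \<equiv> NCell x []"
abbreviation rvar :: "string \<Rightarrow> rexp" where "rvar x \<equiv> RCell x []"

definition select_prog :: prog where
  "select_prog = Seq (RAssign ''b'' [] (RConst 0)) (for_loop ''j'' (var ''n'')
     (Cond (BAnd (NLess (NConst 0) (NCell ''avail'' [var ''j'']))
                 (RLess (rvar ''b'') (RCell ''sc'' [var ''j''])))
       (Seq (RAssign ''b'' [] (RCell ''sc'' [var ''j''])) (NAssign ''sel'' [] (var ''j''))) Skip))"

lemma runs_select_prog:
  assumes "observed I t A \<sigma>" "A \<subseteq> opts I" "num_opts I \<le> M"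
    and "\<And>j. j \<in> opts I \<Longrightarrow> rcell \<sigma> ''sc'' [j] = f j"
  shows "runs select_prog (M * 7 + 5) \<sigma> (\<lambda>\<sigma>'. inputs I \<sigma>' \<and> decision A \<sigma>' = pick f A)"
proof -
  define Inv where "Inv i \<sigma> \<longleftrightarrow> inputs I \<sigma> \<and> ncell \<sigma> ''j'' [] = i
      \<and> (\<forall>j. ncell \<sigma> ''avail'' [j] = of_bool (j \<in> A)) \<and> (\<forall>j\<in>opts I. rcell \<sigma> ''sc'' [j] = f j)
      \<and> (case pick f (A \<inter> {1..i}) of None \<Rightarrow> ncell \<sigma> ''sel'' [] = 0 \<and> rcell \<sigma> ''b'' [] = 0
          | Some a \<Rightarrow> ncell \<sigma> ''sel'' [] = a \<and> rcell \<sigma> ''b'' [] = f a)" for i \<sigma>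
  have body: "runs (Cond (BAnd (NLess (NConst 0) (NCell ''avail'' [var ''j'']))
                 (RLess (rvar ''b'') (RCell ''sc'' [var ''j''])))
       (Seq (RAssign ''b'' [] (RCell ''sc'' [var ''j''])) (NAssign ''sel'' [] (var ''j''))) Skip)
      (Suc (max (Suc (1 + 1)) 1)) (nset ''j'' [] (Suc i) \<sigma>) (Inv (Suc i))"
    if i: "i < num_opts I" and inv: "Inv i \<sigma>" for i \<sigma>
  proof -
    have io: "Suc i \<in> opts I" using i by (simp add: opts_def)
    have b: "rcell \<sigma> ''b'' [] = (case pick f (A \<inter> {1..i}) of None \<Rightarrow> 0 | Some a \<Rightarrow> f a)"
      using inv by (auto simp: Inv_def split: option.splits)
    have ins: "A \<inter> {1..Suc i} = (if Suc i \<in> A then insert (Suc i) (A \<inter> {1..i}) else A \<inter> {1..i})"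
      by (auto simp: le_Suc_eq)
    have p: "pick f (A \<inter> {1..Suc i})
        = (if Suc i \<in> A \<and> rcell \<sigma> ''b'' [] < f (Suc i) then Some (Suc i) else pick f (A \<inter> {1..i}))"
      unfolding ins b using pick_insert[of "A \<inter> {1..i}" "Suc i" f] by auto
    show ?thesis
    proof (intro runs_Cond runs_Seq runs_RAssign runs_NAssign runs_Skip)
      assume "beval (nset ''j'' [] (Suc i) \<sigma>) (BAnd (NLess (NConst 0) (NCell ''avail'' [var ''j'']))
                 (RLess (rvar ''b'') (RCell ''sc'' [var ''j''])))"
      then show "Inv (Suc i) (nset ''sel'' (map (neval (rset ''b'' (map (neval (nset ''j'' [] (Suc i) \<sigma>)) [])
           (reval (nset ''j'' [] (Suc i) \<sigma>) (RCell ''sc'' [var ''j''])) (nset ''j'' [] (Suc i) \<sigma>))) [])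
         (neval (rset ''b'' (map (neval (nset ''j'' [] (Suc i) \<sigma>)) [])
           (reval (nset ''j'' [] (Suc i) \<sigma>) (RCell ''sc'' [var ''j''])) (nset ''j'' [] (Suc i) \<sigma>)) (var ''j''))
         (rset ''b'' (map (neval (nset ''j'' [] (Suc i) \<sigma>)) [])
           (reval (nset ''j'' [] (Suc i) \<sigma>) (RCell ''sc'' [var ''j''])) (nset ''j'' [] (Suc i) \<sigma>)))"
        using inv io p by (simp add: Inv_def inputs_def split: if_splits)
    next
      assume "\<not> beval (nset ''j'' [] (Suc i) \<sigma>) (BAnd (NLess (NConst 0) (NCell ''avail'' [var ''j'']))
                 (RLess (rvar ''b'') (RCell ''sc'' [var ''j''])))"
      then show "Inv (Suc i) (nset ''j'' [] (Suc i) \<sigma>)"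
        using inv io p by (auto simp: Inv_def inputs_def split: if_splits option.splits)
    qed
  qed
  have "runs select_prog (Suc (1 + (M * (Suc (max (Suc (1 + 1)) 1) + 3) + 3))) \<sigma>
      (\<lambda>\<sigma>'. inputs I \<sigma>' \<and> decision A \<sigma>' = pick f A)"
    unfolding select_prog_def
  proof (intro runs_Seq runs_RAssign, rule runs_for_loop[where Inv = Inv and N = "num_opts I"])
    show "Inv 0 (nset ''j'' [] 0 (rset ''b'' (map (neval \<sigma>) []) (reval \<sigma> (RConst 0)) \<sigma>))"
      using assms(1,4) by (simp add: Inv_def observed_def inputs_def pick_None_iff[THEN iffD2])
  next
    fix \<sigma>' assume inv: "Inv (num_opts I) \<sigma>'"
    have "A \<inter> {1..num_opts I} = A" using assms(2) by (auto simp: opts_def)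
    \<comment> \<open>Options are numbered from 1, so the initial 0 in \<open>''sel''\<close> is
      read as no selection.\<close>
    moreover have "0 \<notin> A" using assms(2) by (auto simp: opts_def)
    ultimately show "inputs I \<sigma>' \<and> decision A \<sigma>' = pick f A"
      using inv pick_mem[of f A] by (auto simp: Inv_def decision_def split: option.splits)
  qed (use body assms(3) in \<open>auto simp: Inv_def inputs_def\<close>)
  then show ?thesis by (rule runs_le) simp
qed

definition greedy_prog :: prog where
  "greedy_prog = Seq
     (for_loop ''j'' (var ''n'') (RAssign ''sc'' [var ''j'']
       (RMul (RCell ''v'' [var ''j'']) (RSub (RConst 1)
         (RCell ''FS'' [var ''j'', NSub (NCell ''D'' [var ''j'']) (var ''t'')])))))
     select_prog"

lemma runs_greedy_prog:
  assumes "observed I t A \<sigma>" "A \<subseteq> opts I" "num_opts I \<le> M"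
  shows "runs greedy_prog (M * 11 + 9) \<sigma>
    (\<lambda>\<sigma>'. inputs I \<sigma>' \<and> decision A \<sigma>' = pick (\<lambda>j. exp_reward I j t) A)"
proof -
  define Inv where "Inv i \<sigma> \<longleftrightarrow> observed I t A \<sigma> \<and> ncell \<sigma> ''j'' [] = i
      \<and> (\<forall>j\<in>{1..i}. rcell \<sigma> ''sc'' [j] = exp_reward I j t)" for i \<sigma>
  have "runs greedy_prog (Suc ((M * (1 + 3) + 3) + (M * 7 + 5))) \<sigma>
    (\<lambda>\<sigma>'. inputs I \<sigma>' \<and> decision A \<sigma>' = pick (\<lambda>j. exp_reward I j t) A)"
    unfolding greedy_prog_def
  proof (intro runs_Seq, rule runs_for_loop[where Inv = Inv and N = "num_opts I"])
    fix i \<sigma> assume i: "i < num_opts I" "Inv i \<sigma>"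
    then have "Suc i \<in> opts I" by (simp add: opts_def)
    with i have "rcell \<sigma> ''v'' [Suc i] = reward I (Suc i)" "ncell \<sigma> ''D'' [Suc i] = deadline I (Suc i)"
        "\<And>d. rcell \<sigma> ''FS'' [Suc i, d] = tail_prob (eval_dist I (Suc i)) d" "ncell \<sigma> ''t'' [] = t"
      by (auto simp: Inv_def observed_def inputs_def)
    with i show "runs (RAssign ''sc'' [var ''j'']
       (RMul (RCell ''v'' [var ''j'']) (RSub (RConst 1)
         (RCell ''FS'' [var ''j'', NSub (NCell ''D'' [var ''j'']) (var ''t'')])))) 1 (nset ''j'' [] (Suc i) \<sigma>)
         (Inv (Suc i))"
      by (intro runs_RAssign) (simp add: Inv_def exp_reward_def atLeastAtMostSuc_conv)
  next
    fix \<sigma>' assume "Inv (num_opts I) \<sigma>'"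
    then show "runs select_prog (M * 7 + 5) \<sigma>'
        (\<lambda>\<sigma>'. inputs I \<sigma>' \<and> decision A \<sigma>' = pick (\<lambda>j. exp_reward I j t) A)"
      by (intro runs_select_prog[where t = t]) (use assms in \<open>auto simp: Inv_def opts_def\<close>)
  qed (use assms in \<open>auto simp: Inv_def observed_def inputs_def\<close>)
  then show ?thesis by (rule runs_le) simp
qed

section \<open>The program of the price-directed policy\<close>

abbreviation num :: "nat \<Rightarrow> nexp" where "num \<equiv> NConst"

text \<open>Needs only prices of later times. The loop counter starts at 1, hence the tail
  differences are shifted by one against those in \<open>score\<close>.\<close>

definition score_body :: prog where
  "score_body = Seq
     (RAssign ''a'' [] (RSub (RMul (RCell ''v'' [var ''j''])
        (RSub (RConst 1) (RCell ''FS'' [var ''j'', NSub (NCell ''D'' [var ''j'']) (var ''u'')])))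
        (RCell ''h'' [NAdd (var ''u'') (num 1)])))
     (Seq
     (for_loop ''s'' (NSub (var ''Dmax'') (var ''u'')) (RAssign ''a'' [] (RAdd (rvar ''a'')
        (RMul (RSub (RCell ''FS'' [var ''j'', NSub (var ''s'') (num 1)]) (RCell ''FS'' [var ''j'', var ''s'']))
          (RCell ''h'' [NAdd (var ''u'') (var ''s'')])))))
     (RAssign ''sc'' [var ''j''] (RSub (rvar ''a'')
        (RDiv (RCell ''C'' [var ''j'']) (RCell ''p'' [var ''j'', var ''u''])))))"

text \<open>The loop guard is \<open>before\<close>, with its disjunction written through negation
  and conjunction. The price is updated in place.\<close>

definition price_body :: prog where
  "price_body = Seq
     (Cond (RLess (RConst 0) (RCell ''sc'' [var ''j'']))
        (RAssign ''a'' [] (RMul (RCell ''p'' [var ''j'', var ''u'']) (RCell ''sc'' [var ''j''])))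
        (RAssign ''a'' [] (RConst 0)))
     (Seq
     (for_loop ''i'' (var ''n'') (Cond
        (BAnd (BNot (RLess (RCell ''sc'' [var ''i'']) (RCell ''sc'' [var ''j''])))
          (BNot (BAnd (BNot (RLess (RCell ''sc'' [var ''j'']) (RCell ''sc'' [var ''i''])))
            (BNot (NLess (var ''i'') (var ''j''))))))
        (RAssign ''a'' [] (RMul (rvar ''a'') (RSub (RConst 1) (RCell ''p'' [var ''i'', var ''u'']))))
        Skip))
     (RAssign ''C'' [var ''j''] (RAdd (RCell ''C'' [var ''j'']) (rvar ''a''))))"

definition sum_prog :: prog where
  "sum_prog = Seq (RAssign ''h'' [var ''u''] (RConst 0))
     (for_loop ''j'' (var ''n'') (RAssign ''h'' [var ''u'']
        (RAdd (RCell ''h'' [var ''u'']) (RCell ''C'' [var ''j'']))))"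

text \<open>All scores are computed before any price is updated: a score needs the old price, and a
  new price needs the scores of all competitors.\<close>

definition time_step_prog :: prog where
  "time_step_prog = Seq (NAssign ''u'' [] (NSub (var ''u'') (num 1)))
     (Seq (for_loop ''j'' (var ''n'') score_body)
     (Seq (for_loop ''j'' (var ''n'') price_body) sum_prog))"

text \<open>Every call recomputes the tables from the largest deadline down to \<open>t\<close>, so
  that only the inputs have to persist between calls.\<close>

definition score_prog :: prog where
  "score_prog = Seq (RAssign ''h'' [var ''Dmax''] (RConst 0))
     (Seq (for_loop ''j'' (var ''n'') (Seq (RAssign ''C'' [var ''j''] (RConst 0))
        (RAssign ''sc'' [var ''j''] (RConst 0))))
     (Seq (NAssign ''u'' [] (var ''Dmax''))
     (Seq (While (NLess (var ''t'') (var ''u'')) time_step_prog) select_prog)))"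

text \<open>The cell of \<open>''h''\<close> for the time \<open>u\<close> itself is left open, so
  that its sum can be accumulated there without breaking the invariant.\<close>

definition tables :: "sse \<Rightarrow> nat \<Rightarrow> nat set \<Rightarrow> nat \<Rightarrow> store \<Rightarrow> bool" where
  "tables I t A u \<sigma> \<longleftrightarrow> observed I t A \<sigma> \<and> ncell \<sigma> ''u'' [] = u
    \<and> (\<forall>\<tau>. u < \<tau> \<and> \<tau> \<le> max_deadline I \<longrightarrow> rcell \<sigma> ''h'' [\<tau>] = time_price I \<tau>)"

lemma tables_nset [simp]:
  assumes "x \<notin> {''n'', ''Dmax'', ''D'', ''t'', ''sel'', ''avail'', ''u''}"
  shows "tables I t A u (nset x i a \<sigma>) = tables I t A u \<sigma>"
proof -
  have "''u'' \<noteq> x" using assms by blast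
  then show ?thesis
    unfolding tables_def using observed_nset[of x] assms by (simp only: ncell_nset rcell_nset) simp
qed

lemma tables_rset [simp]:
  assumes "x \<notin> {''v'', ''FS'', ''p'', ''h''}"
  shows "tables I t A u (rset x i r \<sigma>) = tables I t A u \<sigma>"
proof -
  have "''h'' \<noteq> x" using assms by blast
  then show ?thesis
    unfolding tables_def using observed_rset[of x] assms by (simp only: ncell_rset rcell_rset) simp
qed

lemma tables_rset_h [simp]:
  "tables I t A u (rset ''h'' [u] r \<sigma>) = tables I t A u \<sigma>"
  by (simp add: tables_def)

lemma tables_inputs:
  assumes "tables I t A u \<sigma>"
  shows "inputs I \<sigma>" "ncell \<sigma> ''u'' [] = u" "ncell \<sigma> ''n'' [] = num_opts I"
    "ncell \<sigma> ''Dmax'' [] = max_deadline I"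
    "\<And>j. j \<in> opts I \<Longrightarrow> ncell \<sigma> ''D'' [j] = deadline I j"
    "\<And>j. j \<in> opts I \<Longrightarrow> rcell \<sigma> ''v'' [j] = reward I j"
    "\<And>j s. j \<in> opts I \<Longrightarrow> rcell \<sigma> ''FS'' [j, s] = tail_prob (eval_dist I j) s"
    "\<And>j s. j \<in> opts I \<Longrightarrow> s \<le> max_deadline I \<Longrightarrow> rcell \<sigma> ''p'' [j, s] = tail_prob (exp_dist I j) s"
    "\<And>\<tau>. u < \<tau> \<Longrightarrow> \<tau> \<le> max_deadline I \<Longrightarrow> rcell \<sigma> ''h'' [\<tau>] = time_price I \<tau>"
  using assms by (auto simp: tables_def observed_def inputs_def)

lemma runs_score_body:
  assumes "tables I t A u \<sigma>" "ncell \<sigma> ''j'' [] = j" "j \<in> opts I" "u < max_deadline I"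
    "rcell \<sigma> ''C'' [j] = option_price I j (Suc u)" "max_deadline I \<le> M"
  shows "runs score_body (M * 4 + 7) \<sigma> (\<lambda>\<sigma>'. tables I t A u \<sigma>' \<and> ncell \<sigma>' ''j'' [] = j
    \<and> (\<forall>k. rcell \<sigma>' ''C'' k = rcell \<sigma> ''C'' k)
    \<and> (\<forall>k. rcell \<sigma>' ''sc'' k = (if k = [j] then score I j u else rcell \<sigma> ''sc'' k)))"
    (is "runs _ _ _ ?Q")
proof -
  let ?D = "max_deadline I"
  let ?term = "\<lambda>s. (tail_prob (eval_dist I j) s - tail_prob (eval_dist I j) (Suc s)) * time_price I (u + Suc s)"
  define Inv where "Inv i \<sigma>' \<longleftrightarrow> tables I t A u \<sigma>' \<and> ncell \<sigma>' ''j'' [] = j \<and> ncell \<sigma>' ''s'' [] = i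
    \<and> (\<forall>k. rcell \<sigma>' ''C'' k = rcell \<sigma> ''C'' k) \<and> (\<forall>k. rcell \<sigma>' ''sc'' k = rcell \<sigma> ''sc'' k)
    \<and> rcell \<sigma>' ''a'' [] = exp_reward I j u - time_price I (Suc u) + (\<Sum>s<i. ?term s)" for i \<sigma>'
  have score: "score I j u = exp_reward I j u - time_price I (Suc u) + (\<Sum>s<?D - u. ?term s)
      - option_price I j (Suc u) / tail_prob (exp_dist I j) u"
    using assms(4) by (subst score.simps) (simp add: time_price_def)
  have "runs score_body (Suc (1 + Suc ((M * (1 + 3) + 3) + 1))) \<sigma> ?Q"
    unfolding score_body_def
  proof (rule runs_Seq, rule runs_RAssign, rule runs_Seq,
      rule runs_for_loop[where Inv = Inv and N = "?D - u"])
    show "Inv 0 (nset ''s'' [] 0 (rset ''a'' (map (neval \<sigma>) []) (reval \<sigma> (RSub (RMul (RCell ''v'' [var ''j''])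
        (RSub (RConst 1) (RCell ''FS'' [var ''j'', NSub (NCell ''D'' [var ''j'']) (var ''u'')])))
        (RCell ''h'' [NAdd (var ''u'') (num 1)]))) \<sigma>))"
      using assms tables_inputs[OF assms(1)] by (simp add: Inv_def exp_reward_def)
  next
    fix i \<sigma>' assume "Inv i \<sigma>'"
    then show "ncell \<sigma>' ''s'' [] = i \<and> neval \<sigma>' (NSub (var ''Dmax'') (var ''u'')) = ?D - u"
      by (simp add: Inv_def tables_inputs[of I t A u])
  next
    fix i \<sigma>' assume "i < ?D - u" "Inv i \<sigma>'"
    then show "runs (RAssign ''a'' [] (RAdd (rvar ''a'')
        (RMul (RSub (RCell ''FS'' [var ''j'', NSub (var ''s'') (num 1)]) (RCell ''FS'' [var ''j'', var ''s'']))
          (RCell ''h'' [NAdd (var ''u'') (var ''s'')])))) 1 (nset ''s'' [] (Suc i) \<sigma>') (Inv (Suc i))"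
      by (intro runs_RAssign) (simp add: Inv_def tables_inputs[of I t A u] assms(3))
  next
    fix \<sigma>' assume "Inv (?D - u) \<sigma>'"
    then show "runs (RAssign ''sc'' [var ''j''] (RSub (rvar ''a'')
        (RDiv (RCell ''C'' [var ''j'']) (RCell ''p'' [var ''j'', var ''u''])))) 1 \<sigma>' ?Q"
      using assms(3-5) by (intro runs_RAssign) (simp add: Inv_def tables_inputs[of I t A u] score)
  qed (use assms(6) in simp)
  then show ?thesis by (rule runs_le) simp
qed

lemma runs_price_body:
  assumes "tables I t A u \<sigma>" "ncell \<sigma> ''j'' [] = j" "j \<in> opts I" "u < max_deadline I"
    "rcell \<sigma> ''C'' [j] = option_price I j (Suc u)" "num_opts I \<le> M"
    "\<And>i. i \<in> opts I \<Longrightarrow> rcell \<sigma> ''sc'' [i] = score I i u"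
  shows "runs price_body (M * 5 + 8) \<sigma> (\<lambda>\<sigma>'. tables I t A u \<sigma>' \<and> ncell \<sigma>' ''j'' [] = j
    \<and> (\<forall>k. rcell \<sigma>' ''sc'' k = rcell \<sigma> ''sc'' k)
    \<and> (\<forall>k. rcell \<sigma>' ''C'' k = (if k = [j] then option_price I j u else rcell \<sigma> ''C'' k)))"
    (is "runs _ _ _ ?Q")
proof -
  let ?f = "\<lambda>i. score I i u" and ?p = "\<lambda>i. tail_prob (exp_dist I i) u"
  define Inv where "Inv m \<sigma>' \<longleftrightarrow> tables I t A u \<sigma>' \<and> ncell \<sigma>' ''j'' [] = j \<and> ncell \<sigma>' ''i'' [] = m
    \<and> (\<forall>k. rcell \<sigma>' ''C'' k = rcell \<sigma> ''C'' k) \<and> (\<forall>k. rcell \<sigma>' ''sc'' k = rcell \<sigma> ''sc'' k)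
    \<and> rcell \<sigma>' ''a'' [] = ?p j * max 0 (score I j u) * (\<Prod>i\<in>{i \<in> {1..m}. before ?f i j}. 1 - ?p i)" for m \<sigma>'
  let ?loop = "Cond
        (BAnd (BNot (RLess (RCell ''sc'' [var ''i'']) (RCell ''sc'' [var ''j''])))
          (BNot (BAnd (BNot (RLess (RCell ''sc'' [var ''j'']) (RCell ''sc'' [var ''i''])))
            (BNot (NLess (var ''i'') (var ''j''))))))
        (RAssign ''a'' [] (RMul (rvar ''a'') (RSub (RConst 1) (RCell ''p'' [var ''i'', var ''u'']))))
        Skip"
  have body: "runs ?loop (Suc (max 1 1)) (nset ''i'' [] (Suc m) \<sigma>') (Inv (Suc m))"
    if m: "m < num_opts I" and inv: "Inv m \<sigma>'" for m \<sigma>'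
  proof -
    let ?\<sigma> = "nset ''i'' [] (Suc m) \<sigma>'"
    have mo: "Suc m \<in> opts I" using m by (simp add: opts_def)
    have set: "{i \<in> {1..Suc m}. before ?f i j}
        = (if before ?f (Suc m) j then insert (Suc m) {i \<in> {1..m}. before ?f i j} else {i \<in> {1..m}. before ?f i j})"
      by (auto simp: le_Suc_eq)
    have sc: "rcell \<sigma>' ''sc'' [Suc m] = score I (Suc m) u" "rcell \<sigma>' ''sc'' [j] = score I j u"
      using inv assms(3,7) mo by (simp_all add: Inv_def)
    show ?thesis
    proof (rule runs_Cond; (rule runs_RAssign | rule runs_Skip))
      assume "beval ?\<sigma> (BAnd (BNot (RLess (RCell ''sc'' [var ''i'']) (RCell ''sc'' [var ''j''])))
          (BNot (BAnd (BNot (RLess (RCell ''sc'' [var ''j'']) (RCell ''sc'' [var ''i''])))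
            (BNot (NLess (var ''i'') (var ''j''))))))"
      then have "before ?f (Suc m) j" using inv sc by (auto simp: before_def Inv_def)
      then show "Inv (Suc m) (rset ''a'' (map (neval ?\<sigma>) [])
          (reval ?\<sigma> (RMul (rvar ''a'') (RSub (RConst 1) (RCell ''p'' [var ''i'', var ''u''])))) ?\<sigma>)"
        using inv assms(4) mo unfolding Inv_def set by (simp add: tables_inputs[of I t A u])
    next
      assume "\<not> beval ?\<sigma> (BAnd (BNot (RLess (RCell ''sc'' [var ''i'']) (RCell ''sc'' [var ''j''])))
          (BNot (BAnd (BNot (RLess (RCell ''sc'' [var ''j'']) (RCell ''sc'' [var ''i''])))
            (BNot (NLess (var ''i'') (var ''j''))))))"
      then have "\<not> before ?f (Suc m) j" using inv sc by (auto simp: before_def Inv_def)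
      then show "Inv (Suc m) ?\<sigma>" using inv unfolding Inv_def set by simp
    qed
  qed
  have "runs price_body (Suc (Suc (max 1 1) + Suc ((M * (Suc (max 1 1) + 3) + 3) + 1))) \<sigma> ?Q"
    unfolding price_body_def
  proof (rule runs_Seq)
    let ?rest = "Seq (for_loop ''i'' (var ''n'') ?loop)
        (RAssign ''C'' [var ''j''] (RAdd (RCell ''C'' [var ''j'']) (rvar ''a'')))"
    have rest: "runs ?rest (Suc ((M * (Suc (max 1 1) + 3) + 3) + 1)) \<sigma>' ?Q"
      if "Inv 0 (nset ''i'' [] 0 \<sigma>')" for \<sigma>'
    proof (rule runs_Seq, rule runs_for_loop[where Inv = Inv and N = "num_opts I"])
      fix \<sigma>' assume inv: "Inv (num_opts I) \<sigma>'"
      show "runs (RAssign ''C'' [var ''j''] (RAdd (RCell ''C'' [var ''j'']) (rvar ''a''))) 1 \<sigma>' ?Q"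
        using inv assms(3,5) option_price_Suc[OF assms(4), of j]
        by (intro runs_RAssign) (simp add: Inv_def share_def opts_def)
    qed (use that body assms(6) in \<open>auto simp: Inv_def tables_inputs[of I t A u]\<close>)
    show "runs (Cond (RLess (RConst 0) (RCell ''sc'' [var ''j'']))
        (RAssign ''a'' [] (RMul (RCell ''p'' [var ''j'', var ''u'']) (RCell ''sc'' [var ''j''])))
        (RAssign ''a'' [] (RConst 0))) (Suc (max 1 1)) \<sigma>
        (\<lambda>\<sigma>'. runs ?rest (Suc ((M * (Suc (max 1 1) + 3) + 3) + 1)) \<sigma>' ?Q)"
      by (intro runs_Cond runs_RAssign rest)
        (use assms in \<open>simp_all add: Inv_def tables_inputs[of I t A u] max_def\<close>)
  qed
  then show ?thesis by (rule runs_le) simp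
qed

lemma runs_sum_prog:
  assumes "tables I t A u \<sigma>" "num_opts I \<le> M"
    "\<And>j. j \<in> opts I \<Longrightarrow> rcell \<sigma> ''C'' [j] = option_price I j u"
  shows "runs sum_prog (M * 4 + 5) \<sigma> (\<lambda>\<sigma>'. tables I t A u \<sigma>' \<and> rcell \<sigma>' ''h'' [u] = time_price I u
    \<and> (\<forall>k. rcell \<sigma>' ''C'' k = rcell \<sigma> ''C'' k) \<and> (\<forall>k. rcell \<sigma>' ''sc'' k = rcell \<sigma> ''sc'' k))"
    (is "runs _ _ _ ?Q")
proof -
  define Inv where "Inv i \<sigma>' \<longleftrightarrow> tables I t A u \<sigma>' \<and> ncell \<sigma>' ''j'' [] = i
    \<and> (\<forall>k. rcell \<sigma>' ''C'' k = rcell \<sigma> ''C'' k) \<and> (\<forall>k. rcell \<sigma>' ''sc'' k = rcell \<sigma> ''sc'' k)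
    \<and> rcell \<sigma>' ''h'' [u] = (\<Sum>j\<in>{1..i}. option_price I j u)" for i \<sigma>'
  have "runs sum_prog (Suc (1 + (M * (1 + 3) + 3))) \<sigma> ?Q"
    unfolding sum_prog_def
  proof (rule runs_Seq, rule runs_RAssign, rule runs_for_loop[where Inv = Inv and N = "num_opts I"])
    fix i \<sigma>' assume "i < num_opts I" "Inv i \<sigma>'"
    moreover from this have "Suc i \<in> opts I" by (simp add: opts_def)
    ultimately show "runs (RAssign ''h'' [var ''u''] (RAdd (RCell ''h'' [var ''u'']) (RCell ''C'' [var ''j''])))
        1 (nset ''j'' [] (Suc i) \<sigma>') (Inv (Suc i))"
      by (intro runs_RAssign) (simp add: Inv_def tables_inputs[of I t A u] assms(3))
  qed (use assms in \<open>auto simp: Inv_def tables_inputs[of I t A u] time_price_def opts_def\<close>)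
  then show ?thesis by (rule runs_le) simp
qed

lemma runs_time_step_prog:
  assumes "tables I t A (Suc u) \<sigma>" "rcell \<sigma> ''h'' [Suc u] = time_price I (Suc u)"
    "u < max_deadline I" "num_opts I \<le> M" "max_deadline I \<le> M"
    "\<And>j. j \<in> opts I \<Longrightarrow> rcell \<sigma> ''C'' [j] = option_price I j (Suc u)"
  shows "runs time_step_prog (M * (M * 9 + 25) + 15) \<sigma> (\<lambda>\<sigma>'. tables I t A u \<sigma>'
    \<and> rcell \<sigma>' ''h'' [u] = time_price I u
    \<and> (\<forall>j\<in>opts I. rcell \<sigma>' ''C'' [j] = option_price I j u \<and> rcell \<sigma>' ''sc'' [j] = score I j u))"
    (is "runs _ _ _ ?Q")
proof -
  let ?n = "num_opts I"
  define Inv1 where "Inv1 i \<sigma>' \<longleftrightarrow> tables I t A u \<sigma>' \<and> ncell \<sigma>' ''j'' [] = i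
    \<and> (\<forall>j\<in>opts I. rcell \<sigma>' ''C'' [j] = option_price I j (Suc u))
    \<and> (\<forall>j\<in>{1..i}. rcell \<sigma>' ''sc'' [j] = score I j u)" for i \<sigma>'
  \<comment> \<open>Prices are overwritten one by one: up to \<open>i\<close> they already refer to
    \<open>u\<close>, the others still to \<open>Suc u\<close>.\<close>
  define Inv2 where "Inv2 i \<sigma>' \<longleftrightarrow> tables I t A u \<sigma>' \<and> ncell \<sigma>' ''j'' [] = i
    \<and> (\<forall>j\<in>opts I. rcell \<sigma>' ''C'' [j] = option_price I j (if j \<le> i then u else Suc u))
    \<and> (\<forall>j\<in>opts I. rcell \<sigma>' ''sc'' [j] = score I j u)" for i \<sigma>'
  have body1: "runs score_body (M * 4 + 7) (nset ''j'' [] (Suc i) \<sigma>') (Inv1 (Suc i))"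
    if "i < ?n" "Inv1 i \<sigma>'" for i \<sigma>'
  proof -
    have io: "Suc i \<in> opts I" using that(1) by (simp add: opts_def)
    show ?thesis
      by (rule runs_conseq, rule runs_score_body[of I t A u _ "Suc i"])
        (use that io assms(3,5) in \<open>auto simp: Inv1_def\<close>)
  qed
  have body2: "runs price_body (M * 5 + 8) (nset ''j'' [] (Suc i) \<sigma>') (Inv2 (Suc i))"
    if "i < ?n" "Inv2 i \<sigma>'" for i \<sigma>'
  proof -
    have io: "Suc i \<in> opts I" using that(1) by (simp add: opts_def)
    show ?thesis
      by (rule runs_conseq, rule runs_price_body[of I t A u _ "Suc i"])
        (use that io assms(3,4) in \<open>auto simp: Inv2_def\<close>)
  qed
  have sum: "runs sum_prog (M * 4 + 5) \<sigma>' ?Q" if "Inv2 ?n \<sigma>'" for \<sigma>'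
  proof -
    have "j \<le> ?n" if "j \<in> opts I" for j using that by (simp add: opts_def)
    with that show ?thesis
      by (intro runs_conseq[OF runs_sum_prog[of I t A u]]) (use assms(4) in \<open>auto simp: Inv2_def\<close>)
  qed
  have "runs time_step_prog
      (Suc (1 + Suc ((M * (M * 4 + 7 + 3) + 3) + Suc ((M * (M * 5 + 8 + 3) + 3) + (M * 4 + 5))))) \<sigma> ?Q"
    unfolding time_step_prog_def
  proof (rule runs_Seq, rule runs_NAssign, rule runs_Seq, rule runs_for_loop[where Inv = Inv1 and N = ?n])
    let ?\<sigma> = "nset ''u'' (map (neval \<sigma>) []) (neval \<sigma> (NSub (var ''u'') (num 1))) \<sigma>"
    have "rcell \<sigma> ''h'' [\<tau>] = time_price I \<tau>" if "u < \<tau>" "\<tau> \<le> max_deadline I" for \<tau>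
      using assms(1,2) that by (cases "\<tau> = Suc u") (auto simp: tables_def)
    then have "tables I t A u ?\<sigma>"
      using assms(1) by (simp add: tables_def observed_def inputs_def)
    then show "Inv1 0 (nset ''j'' [] 0 ?\<sigma>)" using assms(6) by (simp add: Inv1_def)
  next
    fix \<sigma>' assume inv: "Inv1 ?n \<sigma>'"
    show "runs (Seq (for_loop ''j'' (var ''n'') price_body) sum_prog)
        (Suc ((M * (M * 5 + 8 + 3) + 3) + (M * 4 + 5))) \<sigma>' ?Q"
    proof (rule runs_Seq, rule runs_for_loop[where Inv = Inv2 and N = ?n])
      show "Inv2 0 (nset ''j'' [] 0 \<sigma>')" using inv by (auto simp: Inv1_def Inv2_def opts_def)
    qed (use body2 sum assms(4) in \<open>auto simp: Inv2_def tables_inputs[of I t A u]\<close>)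
  qed (use body1 assms(4) in \<open>auto simp: Inv1_def tables_inputs[of I t A u]\<close>)
  then show ?thesis by (rule runs_le) (simp add: algebra_simps)
qed

lemma runs_score_prog:
  assumes "observed I t A \<sigma>" "A \<subseteq> opts I" "num_opts I \<le> M" "max_deadline I \<le> M"
  shows "runs score_prog (M * (M * (M * 9 + 25)) + M * 29 + 15) \<sigma>
    (\<lambda>\<sigma>'. inputs I \<sigma>' \<and> decision A \<sigma>' = pick (\<lambda>j. score I j t) A)" (is "runs _ _ _ ?Q")
proof -
  let ?D = "max_deadline I" and ?n = "num_opts I"
  define Inv0 where "Inv0 i \<sigma>' \<longleftrightarrow> observed I t A \<sigma>' \<and> ncell \<sigma>' ''j'' [] = i \<and> rcell \<sigma>' ''h'' [?D] = 0
    \<and> (\<forall>j\<in>{1..i}. rcell \<sigma>' ''C'' [j] = 0 \<and> rcell \<sigma>' ''sc'' [j] = 0)" for i \<sigma>'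
  define Inv where "Inv i \<sigma>' \<longleftrightarrow> tables I t A (?D - i) \<sigma>' \<and> rcell \<sigma>' ''h'' [?D - i] = time_price I (?D - i)
    \<and> (\<forall>j\<in>opts I. rcell \<sigma>' ''C'' [j] = option_price I j (?D - i) \<and> rcell \<sigma>' ''sc'' [j] = score I j (?D - i))"
    for i \<sigma>'
  let ?c = "M * (M * 9 + 25) + 15"
  let ?W = "While (NLess (var ''t'') (var ''u'')) time_step_prog"
  have loop: "runs (Seq ?W select_prog) (Suc (Suc (M * Suc ?c) + (M * 7 + 5))) \<sigma>' ?Q"
    if inv0: "Inv 0 \<sigma>'" for \<sigma>'
  proof (rule runs_Seq, rule runs_le)
    show "runs ?W (Suc ((?D - t) * Suc ?c)) \<sigma>' (\<lambda>\<sigma>'. runs select_prog (M * 7 + 5) \<sigma>' ?Q)"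
    proof (rule runs_While[where Inv = Inv])
      fix i \<sigma>' assume "i \<le> ?D - t" "Inv i \<sigma>'"
      then show "beval \<sigma>' (NLess (var ''t'') (var ''u'')) \<longleftrightarrow> i < ?D - t"
        by (auto simp: Inv_def tables_def observed_def)
    next
      fix i \<sigma>' assume i: "i < ?D - t" "Inv i \<sigma>'"
      then have eq: "?D - i = Suc (?D - Suc i)" by simp
      show "runs time_step_prog ?c \<sigma>' (Inv (Suc i))"
        unfolding Inv_def
        by (rule runs_time_step_prog) (use i assms(3,4) in \<open>auto simp: Inv_def eq\<close>)
    next
      fix \<sigma>' assume inv: "Inv (?D - t) \<sigma>'"
      \<comment> \<open>The truncated difference is \<open>t\<close> for \<open>t \<le> ?D\<close>
        and \<open>?D\<close> otherwise; in the latter case both scores are 0.\<close>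
      have "score I j (?D - (?D - t)) = score I j t" for j by (cases "t \<le> ?D") simp_all
      then show "runs select_prog (M * 7 + 5) \<sigma>' ?Q"
        using inv assms(2,3) by (intro runs_select_prog[where t = t]) (auto simp: Inv_def tables_def)
    qed (rule inv0)
    have "(?D - t) * Suc ?c \<le> M * Suc ?c" using assms(4) by (intro mult_le_mono1) simp
    then show "Suc ((?D - t) * Suc ?c) \<le> Suc (M * Suc ?c)" by simp
  qed
  have "runs score_prog (Suc (1 + Suc ((M * (Suc (1 + 1) + 3) + 3)
      + Suc (1 + Suc (Suc (M * Suc ?c) + (M * 7 + 5)))))) \<sigma> ?Q"
    unfolding score_prog_def
  proof (rule runs_Seq, rule runs_RAssign, rule runs_Seq, rule runs_for_loop[where Inv = Inv0 and N = ?n])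
    fix i \<sigma>' assume i: "i < ?n" "Inv0 i \<sigma>'"
    then show "runs (Seq (RAssign ''C'' [var ''j''] (RConst 0)) (RAssign ''sc'' [var ''j''] (RConst 0)))
        (Suc (1 + 1)) (nset ''j'' [] (Suc i) \<sigma>') (Inv0 (Suc i))"
      by (intro runs_Seq runs_RAssign) (auto simp: Inv0_def atLeastAtMostSuc_conv)
  next
    fix \<sigma>' assume "Inv0 ?n \<sigma>'"
    then have "Inv 0 (nset ''u'' (map (neval \<sigma>') []) (neval \<sigma>' (var ''Dmax'')) \<sigma>')"
      by (auto simp: Inv0_def Inv_def tables_def observed_def inputs_def opts_def)
    then show "runs (Seq (NAssign ''u'' [] (var ''Dmax'')) (Seq ?W select_prog))
        (Suc (1 + Suc (Suc (M * Suc ?c) + (M * 7 + 5)))) \<sigma>' ?Q"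
      by (intro runs_Seq[of "NAssign _ _ _"] runs_NAssign loop)
  qed (use assms in \<open>auto simp: Inv0_def observed_def inputs_def\<close>)
  then show ?thesis by (rule runs_le) (simp add: algebra_simps)
qed

section \<open>From programs to approximation guarantees\<close>

context sse_inst
begin

text \<open>A halted machine stays halted, so a run of at most \<open>B\<close> steps can be padded
  to exactly \<open>B\<close>.\<close>

lemma rule_of_prog_runs:
  assumes "runs P B (observe t A \<sigma>) (\<lambda>\<sigma>'. inputs I \<sigma>' \<and> decision A \<sigma>' = d)"
  shows "\<exists>\<sigma>'. inputs I \<sigma>' \<and> rule_of_prog P B (Some \<sigma>) t A = return_pmf (d, Some \<sigma>')"
proof -
  from assms obtain k \<sigma>' where k: "k \<le> B" "steps k ([P], observe t A \<sigma>) = return_pmf ([], \<sigma>')"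
    and "inputs I \<sigma>'" "decision A \<sigma>' = d"
    unfolding runs_def by blast
  moreover have "steps B ([P], observe t A \<sigma>) = return_pmf ([], \<sigma>')"
    using k steps_add[of k "B - k" "([P], observe t A \<sigma>)"] by (simp add: bind_return_pmf steps_halted)
  ultimately show ?thesis by auto
qed

text \<open>Simulation: each call makes the decision of the index rule and preserves the inputs,
  which is all that the next call requires. The memories differ, so only the values are
  compared.\<close>

lemma play_index_prog:
  assumes P: "\<And>\<sigma> t A. inputs I \<sigma> \<Longrightarrow> A \<subseteq> opts I \<Longrightarrow>
      runs P B (observe t A \<sigma>) (\<lambda>\<sigma>'. inputs I \<sigma>' \<and> decision A \<sigma>' = pick (\<lambda>j. f j t) A)"
    and "inputs I \<sigma>" "U \<subseteq> opts I"
  shows "map_pmf fst (play I (rule_of_prog P B) s e k t U (Some \<sigma>))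
      = map_pmf fst (play I (index_rule f) s e k t U ())
    \<and> None \<notin> snd ` set_pmf (play I (rule_of_prog P B) s e k t U (Some \<sigma>))"
  using assms(2,3)
proof (induction k arbitrary: t U \<sigma>)
  case (Suc k)
  let ?A = "{j \<in> U. e j > t}" and ?d = "pick (\<lambda>j. f j t) {j \<in> U. e j > t}"
  have "?A \<subseteq> opts I" using Suc.prems(2) by blast
  then obtain \<sigma>' where \<sigma>': "inputs I \<sigma>'" "rule_of_prog P B (Some \<sigma>) t ?A = return_pmf (?d, Some \<sigma>')"
    using rule_of_prog_runs[OF P[OF Suc.prems(1)]] by blast
  have ir: "index_rule f () t ?A = return_pmf (?d, ())" by (simp add: index_rule_def)
  show ?case
  proof (cases ?d)
    case None
    show ?thesis using Suc.IH[OF \<sigma>'(1) Suc.prems(2), of "t + 1"]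
      unfolding play.simps \<sigma>'(2) ir bind_return_pmf None prod.case option.case .
  next
    case (Some j)
    have "U - {j} \<subseteq> opts I" using Suc.prems(2) by blast
    note IH = Suc.IH[OF \<sigma>'(1) this, of "t + s j"]
    let ?r = "if t + s j \<le> deadline I j then reward I j else 0"
    have eq: "map_pmf fst (map_pmf (\<lambda>(w, m''). (?r + w, m'')) p) = map_pmf ((+) ?r) (map_pmf fst p)"
      for p :: "(real \<times> 'b) pmf"
      by (simp add: pmf.map_comp o_def case_prod_unfold)
    show ?thesis
      using IH unfolding play.simps \<sigma>'(2) ir bind_return_pmf Some prod.case option.case eq
      by (auto simp: image_image case_prod_unfold)
  qed
qed simp

text \<open>The program and the index rule have equal values; as the optimum is nonnegative, the
  factor may be lowered from \<open>\<alpha>\<close> to \<open>\<beta>\<close>.\<close>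

lemma achieves_index_prog:
  assumes P: "\<And>\<sigma> t A. inputs I \<sigma> \<Longrightarrow> A \<subseteq> opts I \<Longrightarrow>
      runs P B (observe t A \<sigma>) (\<lambda>\<sigma>'. inputs I \<sigma>' \<and> decision A \<sigma>' = pick (\<lambda>j. f j t) A)"
    and opt: "\<And>\<pi>. online_policy \<pi> \<Longrightarrow> \<alpha> * policy_value I \<pi> \<le> expected_value I (index_rule f) ()"
    and "\<beta> \<le> \<alpha>" "0 < \<alpha>"
  shows "achieves P B \<beta> I"
proof -
  note sim = play_index_prog[OF P inputs_input_store subset_refl]
  have "map_pmf fst (outcome I (rule_of_prog P B) (Some (input_store I)))
      = map_pmf fst (outcome I (index_rule f) ())"
    unfolding outcome_def map_bind_pmf by (intro bind_pmf_cong refl sim[THEN conjunct1])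
  then have "measure_pmf.expectation (map_pmf fst (outcome I (rule_of_prog P B) (Some (input_store I)))) (\<lambda>x. x)
      = measure_pmf.expectation (map_pmf fst (outcome I (index_rule f) ())) (\<lambda>x. x)"
    by simp
  then have pv: "prog_value I P B = expected_value I (index_rule f) ()"
    by (simp add: prog_value_def expected_value_def)
  have "online_opt I \<le> prog_value I P B / \<alpha>"
    unfolding online_opt_def
    by (rule cSUP_least) (use ex_online_policy opt assms(4) in \<open>auto simp: pv field_simps\<close>)
  moreover have "0 \<le> online_opt I"
  proof -
    obtain \<pi> where \<pi>: "online_policy \<pi>" using ex_online_policy by blast
    have "0 \<le> policy_value I \<pi>"
      unfolding policy_value_def using fst_rule_of_policy[OF \<pi>] inst by (rule expected_value_bounds)
    also have "\<dots> \<le> online_opt I"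
      unfolding online_opt_def using \<pi> by (intro cSUP_upper bdd_above_policy_value inst) simp
    finally show ?thesis .
  qed
  then have "\<beta> * online_opt I \<le> \<alpha> * online_opt I" using assms(3) by (rule mult_right_mono[rotated])
  ultimately have "\<beta> * online_opt I \<le> prog_value I P B" using assms(4) by (simp add: field_simps)
  moreover have "runs_within I P B"
    unfolding runs_within_def outcome_def set_bind_pmf using sim[THEN conjunct2] by fastforce
  ultimately show ?thesis by (simp add: achieves_def)
qed

lemma admissible_rule_of_policy: "online_policy \<pi> \<Longrightarrow> admissible (rule_of_policy \<pi>)"
  unfolding admissible_def by (auto dest: fst_rule_of_policy)

lemma achieves_score_prog:
  assumes "\<beta> \<le> 1 / 3" "100 * (1 + num_opts I + horizon I + max_deadline I) ^ 3 \<le> B"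
  shows "achieves score_prog B \<beta> I"
proof (rule achieves_index_prog[where f = "score I" and \<alpha> = "1 / 3"])
  let ?M = "1 + num_opts I + horizon I + max_deadline I"
  \<comment> \<open>Since \<open>?M\<close> is at least 1, the step count is at most 9 + 25 + 29 +
    15 = 78 times its cube.\<close>
  have "1 \<le> ?M ^ 3" "?M \<le> ?M ^ 3" "?M * ?M \<le> ?M ^ 3"
    by (simp_all add: power3_eq_cube)
  then have "?M * (?M * (?M * 9 + 25)) + ?M * 29 + 15 \<le> B"
    using assms(2) by (simp only: power3_eq_cube algebra_simps)
  then show "runs score_prog B (observe t A \<sigma>)
      (\<lambda>\<sigma>'. inputs I \<sigma>' \<and> decision A \<sigma>' = pick (\<lambda>j. score I j t) A)"
    if "inputs I \<sigma>" "A \<subseteq> opts I" for \<sigma> t A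
    by (intro runs_le[OF runs_score_prog[where M = ?M]] observed_observe that) auto
  show "1 / 3 * policy_value I \<pi> \<le> expected_value I (index_rule (score I)) ()" if "online_policy \<pi>" for \<pi>
    using score_rule_third[OF admissible_rule_of_policy[OF that], of "[]"] by (simp add: policy_value_def)
qed (use assms(1) in auto)

lemma achieves_greedy_prog:
  assumes "iid_eval_times I" "20 * (1 + num_opts I + horizon I + max_deadline I) \<le> B"
  shows "achieves greedy_prog B (1 / 2) I"
proof (rule achieves_index_prog[where f = "exp_reward I" and \<alpha> = "1 / 2"])
  let ?M = "1 + num_opts I + horizon I + max_deadline I"
  show "runs greedy_prog B (observe t A \<sigma>)
      (\<lambda>\<sigma>'. inputs I \<sigma>' \<and> decision A \<sigma>' = pick (\<lambda>j. exp_reward I j t) A)"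
    if "inputs I \<sigma>" "A \<subseteq> opts I" for \<sigma> t A
    \<comment> \<open>\<open>11 * ?M + 9\<close> is at most \<open>20 * ?M\<close>.\<close>
    by (intro runs_le[OF runs_greedy_prog[where M = ?M]] observed_observe that) (use assms(2) in auto)
  show "1 / 2 * policy_value I \<pi> \<le> expected_value I (index_rule (exp_reward I)) ()" if "online_policy \<pi>" for \<pi>
    using greedy_half[OF assms(1) admissible_rule_of_policy[OF that], of "[]"] by (simp add: policy_value_def)
qed auto

end

theorem theorem1p3:
  shows "(\<exists>(c::nat) (k::nat). \<forall>\<epsilon>::real. \<epsilon> > 0 \<longrightarrow> (\<exists>P. \<forall>I. sse_instance I \<longrightarrow>
            achieves P (nat \<lfloor>real c * (1 + num_opts I + horizon I + max_deadline I + 1 / \<epsilon>) ^ k\<rfloor>)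
              (0.316 - \<epsilon>) I)) \<and>
         (\<exists>(c::nat) (k::nat). \<exists>P. \<forall>I. sse_instance I \<and> iid_eval_times I \<longrightarrow>
            achieves P (c * (1 + num_opts I + horizon I + max_deadline I) ^ k) 0.5 I)"
proof (intro conjI)
  have "achieves score_prog
      (nat \<lfloor>real 100 * (1 + num_opts I + horizon I + max_deadline I + 1 / \<epsilon>) ^ 3\<rfloor>) (0.316 - \<epsilon>) I"
    if "\<epsilon> > 0" "sse_instance I" for \<epsilon> :: real and I
  proof -
    interpret sse_inst I using that(2) by unfold_locales
    let ?M = "1 + num_opts I + horizon I + max_deadline I"
    \<comment> \<open>Dropping \<open>1 / \<epsilon>\<close> leaves a natural number, below which
      the floor cannot fall.\<close>
    have "real (100 * ?M ^ 3) \<le> real 100 * (1 + num_opts I + horizon I + max_deadline I + 1 / \<epsilon>) ^ 3"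
      unfolding of_nat_mult of_nat_power by (intro mult_left_mono power_mono) (use that(1) in auto)
    then have "100 * ?M ^ 3 \<le> nat \<lfloor>real 100 * (1 + num_opts I + horizon I + max_deadline I + 1 / \<epsilon>) ^ 3\<rfloor>"
      by (simp only: le_nat_floor)
    then show ?thesis using that(1) by (intro achieves_score_prog) auto
  qed
  then show "\<exists>(c::nat) (k::nat). \<forall>\<epsilon>::real. \<epsilon> > 0 \<longrightarrow> (\<exists>P. \<forall>I. sse_instance I \<longrightarrow>
            achieves P (nat \<lfloor>real c * (1 + num_opts I + horizon I + max_deadline I + 1 / \<epsilon>) ^ k\<rfloor>)
              (0.316 - \<epsilon>) I)"
    by blast
  have "achieves greedy_prog (20 * (1 + num_opts I + horizon I + max_deadline I) ^ 1) 0.5 I"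
    if "sse_instance I" "iid_eval_times I" for I
  proof -
    interpret sse_inst I using that(1) by unfold_locales
    show ?thesis using achieves_greedy_prog[OF that(2)] by simp
  qed
  then show "\<exists>(c::nat) (k::nat). \<exists>P. \<forall>I. sse_instance I \<and> iid_eval_times I \<longrightarrow>
            achieves P (c * (1 + num_opts I + horizon I + max_deadline I) ^ k) 0.5 I"
    by blast
qed

end
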